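(* Let $1\le m<n$ be integers, $K:\mathcal{X}^m\to[-1,1]$ a measurable, permutation-symmetric kernel on a measurable space $\mathcal{X}$, $\mu$ a probability measure on $\mathcal{X}$, $\mathbf{X}=(X_1,\dots,X_n)\sim\mu^n$ an i.i.d. vector with values in $\mathcal{X}^n$, $\theta=\mathbb{E}[K(X_1,\dots,X_m)]$, and let $$U(\mathbf{X})=\binom{n}{m}^{-1}\sum_{1\le i_1<\dots<i_m\le n}K(X_{i_1},\dots,X_{i_m})$$ be the complete U-statistic. With $\alpha=\alpha(K)$, $\beta=\beta(K)$, $\gamma=\gamma(K)$ and $\sigma_1^2$ as defined in the context, for every $t>0$ $$\Pr\left\{U(\mathbf{X})-\theta>t\right\}\le\exp\left(\frac{-nt^2}{2m^2\sigma_1^2+m^4\beta/(2n)+\left(m^2\sqrt{\gamma}+(4/3)m\right)t}\right),$$ and for every $0<\delta\le1/e$, with probability at least $1-\delta$, $$U(\mathbf{X})-\theta\le\sqrt{\frac{2m^2\sigma_1^2\ln(1/\delta)}{n}}+\frac{\left(\alpha m^2+4m/3\right)\ln(1/\delta)}{n}.$$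
   Context: Difference operators: for $f:\mathcal{X}^N\to\mathbb{R}$, $k\in\{1,\dots,N\}$, $y,y'\in\mathcal{X}$, $D^k_{y,y'}f(\mathbf{x})=f(S_y^k\mathbf{x})-f(S_{y'}^k\mathbf{x})$, where $S_y^k\mathbf{x}$ is $\mathbf{x}$ with its $k$-th coordinate replaced by $y$. Kernel quantities: with $X_1,\dots,X_m,X_1',X_2'$ i.i.d. $\sim\mu$, $$\beta(K)=\mathbb{E}\left[\left(D^1_{X_1,X_1'}D^2_{X_2,X_2'}K(X_1,X_2,\dots,X_m)\right)^2\right],$$ $$\gamma(K)=\sup_{\mathbf{x}\in\mathcal{X}^m,\,y,y'\in\mathcal{X}}\mathbb{E}\left[\left(D^1_{y,y'}D^2_{X_2,X_2'}K(x_1,x_2,x_3,\dots,x_m)\right)^2\right],$$ $$\alpha(K)=\sqrt{\beta(K)/2}+\sqrt{\gamma(K)}.$$ Finally $\sigma_1^2=\mathrm{Var}\left[\mathbb{E}[K(X_1,\dots,X_m)\mid X_1]\right]$. *)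

theory Defs
  imports "HOL-Probability.Probability"
begin

text \<open>
  The measurable space $\mathcal{X}$ is the one underlying a probability measure \<open>\<mu>\<close>, and
  $\mathcal{X}^N$ is \<open>space (Pi\<^sub>M {1..N} (\<lambda>_. \<mu>))\<close>, i.e. the functions that map \<open>{1..N}\<close> into
  \<open>space \<mu>\<close> and are \<open>undefined\<close> elsewhere.
\<close>

abbreviation power_measure :: "'a measure \<Rightarrow> nat \<Rightarrow> (nat \<Rightarrow> 'a) measure" where
  "power_measure \<mu> N \<equiv> Pi\<^sub>M {1..N} (\<lambda>_. \<mu>)"

text \<open>
  The restriction keeps the result in $\mathcal{X}^N$. It has an effect only for \<open>k \<notin> {1..N}\<close>: then
  the substitution is the identity on $\mathcal{X}^N$ and the difference operator below vanishes.
  This gives second-order differences a meaning (zero) for kernels of a single argument.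
\<close>

definition coord_subst :: "nat \<Rightarrow> nat \<Rightarrow> 'a \<Rightarrow> (nat \<Rightarrow> 'a) \<Rightarrow> nat \<Rightarrow> 'a" where
  "coord_subst N k y x = restrict (x(k := y)) {1..N}"

definition diff_op ::
    "nat \<Rightarrow> nat \<Rightarrow> 'a \<Rightarrow> 'a \<Rightarrow> ((nat \<Rightarrow> 'a) \<Rightarrow> real) \<Rightarrow> (nat \<Rightarrow> 'a) \<Rightarrow> real" where
  "diff_op N k y y' f x = f (coord_subst N k y x) - f (coord_subst N k y' x)"

definition symmetric_kernel :: "'a measure \<Rightarrow> nat \<Rightarrow> ((nat \<Rightarrow> 'a) \<Rightarrow> real) \<Rightarrow> bool" where
  "symmetric_kernel \<mu> m K \<longleftrightarrow>
     (\<forall>\<pi> x. \<pi> permutes {1..m} \<longrightarrow> x \<in> space (power_measure \<mu> m) \<longrightarrow> K (x \<circ> \<pi>) = K x)"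

definition kernel_beta :: "'a measure \<Rightarrow> nat \<Rightarrow> ((nat \<Rightarrow> 'a) \<Rightarrow> real) \<Rightarrow> real" where
  "kernel_beta \<mu> m K =
     (\<integral>(x, x1', x2'). (diff_op m 1 (x 1) x1' (diff_op m 2 (x 2) x2' K) x)\<^sup>2
        \<partial>(power_measure \<mu> m \<Otimes>\<^sub>M (\<mu> \<Otimes>\<^sub>M \<mu>)))"

text \<open>
  The supremum is taken in the reals; for a bounded kernel its index set is bounded and, \<open>\<mu>\<close> being
  a probability measure, nonempty.
\<close>

definition kernel_gamma :: "'a measure \<Rightarrow> nat \<Rightarrow> ((nat \<Rightarrow> 'a) \<Rightarrow> real) \<Rightarrow> real" where
  "kernel_gamma \<mu> m K =
     (SUP (x, y, y') \<in> space (power_measure \<mu> m) \<times> space \<mu> \<times> space \<mu>.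
        \<integral>(x2, x2'). (diff_op m 1 y y' (diff_op m 2 x2 x2' K) x)\<^sup>2 \<partial>(\<mu> \<Otimes>\<^sub>M \<mu>))"

definition kernel_alpha :: "'a measure \<Rightarrow> nat \<Rightarrow> ((nat \<Rightarrow> 'a) \<Rightarrow> real) \<Rightarrow> real" where
  "kernel_alpha \<mu> m K = sqrt (kernel_beta \<mu> m K / 2) + sqrt (kernel_gamma \<mu> m K)"

text \<open>
  Variance of $E[K(X_1,\dots,X_m) \mid X_1]$, with $X_1,\dots,X_m$ the coordinates of the
  canonical space $(\mathcal{X}^m, \mu^m)$; the conditioning is on the sigma-algebra generated by
  the first coordinate.
\<close>

definition kernel_sigma1_sq :: "'a measure \<Rightarrow> nat \<Rightarrow> ((nat \<Rightarrow> 'a) \<Rightarrow> real) \<Rightarrow> real" where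
  "kernel_sigma1_sq \<mu> m K =
     (let P = power_measure \<mu> m
      in prob_space.variance P (real_cond_exp P (vimage_algebra (space P) (\<lambda>x. x 1) \<mu>) K))"

definition U_statistic :: "nat \<Rightarrow> nat \<Rightarrow> ((nat \<Rightarrow> 'a) \<Rightarrow> real) \<Rightarrow> (nat \<Rightarrow> 'a) \<Rightarrow> real" where
  "U_statistic n m K x =
     (\<Sum>i \<in> {i \<in> {1..m} \<rightarrow>\<^sub>E {1..n}. strict_mono_on {1..m} i}. K (\<lambda>j\<in>{1..m}. x (i j)))
       / real (n choose m)"

end

theory Submission
  imports Defs
begin

text \<open>
  The proof is the entropy method for functions of independent variables whose dependence on one
  coordinate varies little with the others.

  Write \<open>V\<^sub>k f\<close> for the conditional variance of \<open>f\<close> in its \<open>k\<close>-th coordinate and \<open>S\<close> for the sum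
  of all \<open>V\<^sub>k f\<close>. Entropy is subadditive over product measures, and in one coordinate the entropy of
  \<open>exp (s f)\<close>, divided by its mean, is the integral over \<open>u\<close> from \<open>0\<close> to \<open>s\<close> of \<open>u\<close> times the variance of \<open>f\<close> under the
  measure tilted by \<open>exp (u f)\<close>. If \<open>f\<close> exceeds its conditional means by at most \<open>b\<close>, this gives
  \<open>Ent (exp (s f)) \<le> q(s) E[S exp (s f)]\<close> with \<open>q(s) = (s\<^sup>2 / 2) / (1 - s b / 3)\<^sup>2\<close>.

  In Bernstein's inequality for sums \<open>S\<close> is constant. Here it is random, and
  the variational formula for the entropy decouples it from \<open>exp (s f)\<close> at the price of an
  exponential moment of \<open>S\<close>. That moment is controlled by the same method because \<open>S\<close> bounds its own
  oscillation: \<open>S\<close> is a squared norm of the vector of all first differences of \<open>f\<close>, and replacing one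
  coordinate moves this vector by at most the norm of the second differences, so that
  \<open>(S - S')\<^sup>2 \<le> \<rho> (2 S + 2 S')\<close> if \<open>\<rho>\<close> bounds the square of that norm. The outcome is \<open>bounded_interaction_bernstein\<close>, a Bernstein bound with
  variance proxy \<open>E S\<close> and scale \<open>2 b / 3 + J\<close>, for any \<open>J\<close> whose square is at least twice the number of
  coordinates times \<open>\<rho>\<close>.

  For a U-statistic the first differences are at most \<open>2 m / n\<close>, since a fraction \<open>m / n\<close> of the index
  tuples contains a given index. A fraction \<open>m (m - 1) / (n (n - 1))\<close> contains a given pair, so a
  second difference of \<open>U\<close> is that fraction times an average of second differences of the kernel;
  by Jensen this bounds \<open>\<rho>\<close> by \<open>\<gamma>\<close>. For \<open>E S\<close> one more application of Efron--Stein, to the first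
  difference \<open>U(x(k := y)) - U(x(k := y'))\<close> as a function of \<open>x\<close>, splits \<open>E (V\<^sub>k U)\<close> into a part coming
  from the mean of that difference, which yields \<open>\<sigma>\<^sub>1\<^sup>2\<close>, and a part made of second differences, which
  yields \<open>\<beta>\<close>. The second claim is the first one with the exponent inverted.
\<close>

section \<open>Bounded measurable functions\<close>

text \<open>Boundedness is demanded on the space only, because a kernel is unconstrained outside of it. All
  functions integrated below are of this kind, which settles every question of integrability.\<close>
definition bounded_rv :: "'b measure \<Rightarrow> ('b \<Rightarrow> real) \<Rightarrow> bool" where
  "bounded_rv N f \<longleftrightarrow> f \<in> borel_measurable N \<and> (\<exists>B. \<forall>x\<in>space N. \<bar>f x\<bar> \<le> B)"

lemma bounded_rvI:
  "f \<in> borel_measurable N \<Longrightarrow> (\<And>x. x \<in> space N \<Longrightarrow> \<bar>f x\<bar> \<le> B) \<Longrightarrow> bounded_rv N f"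
  unfolding bounded_rv_def by blast

lemma bounded_rvE:
  assumes "bounded_rv N f"
  obtains B where "B > 0" "\<And>x. x \<in> space N \<Longrightarrow> \<bar>f x\<bar> \<le> B"
proof -
  obtain B where "\<forall>x\<in>space N. \<bar>f x\<bar> \<le> B" using assms unfolding bounded_rv_def by blast
  then have "\<And>x. x \<in> space N \<Longrightarrow> \<bar>f x\<bar> \<le> max B 1" "max B 1 > 0" by force+
  then show ?thesis using that by blast
qed

lemma bounded_rv_measurable: "bounded_rv N f \<Longrightarrow> f \<in> borel_measurable N"
  unfolding bounded_rv_def by blast

lemma bounded_rv_const: "bounded_rv N (\<lambda>_. c)"
  by (rule bounded_rvI[where B="\<bar>c\<bar>"]) auto

lemma bounded_rv_add:
  assumes "bounded_rv N f" "bounded_rv N g" shows "bounded_rv N (\<lambda>x. f x + g x)"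
proof -
  obtain A B where "\<And>x. x \<in> space N \<Longrightarrow> \<bar>f x\<bar> \<le> A" "\<And>x. x \<in> space N \<Longrightarrow> \<bar>g x\<bar> \<le> B"
    using assms by (metis bounded_rvE)
  then show ?thesis using assms
    by (intro bounded_rvI[where B="A+B"] borel_measurable_add)
      (auto simp: bounded_rv_measurable add_mono intro!: order_trans[OF abs_triangle_ineq])
qed

lemma bounded_rv_mult:
  assumes "bounded_rv N f" "bounded_rv N g" shows "bounded_rv N (\<lambda>x. f x * g x)"
proof -
  obtain A B where "\<And>x. x \<in> space N \<Longrightarrow> \<bar>f x\<bar> \<le> A" "\<And>x. x \<in> space N \<Longrightarrow> \<bar>g x\<bar> \<le> B" "A > 0"
    using assms by (metis bounded_rvE)
  then show ?thesis using assms
    by (intro bounded_rvI[where B="A*B"] borel_measurable_times)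
      (auto simp: bounded_rv_measurable abs_mult intro!: mult_mono)
qed

lemma bounded_rv_diff:
  assumes "bounded_rv N f" "bounded_rv N g" shows "bounded_rv N (\<lambda>x. f x - g x)"
  using bounded_rv_add[OF assms(1) bounded_rv_mult[OF bounded_rv_const[of N "-1"] assms(2)]] by simp

lemma bounded_rv_power: "bounded_rv N f \<Longrightarrow> bounded_rv N (\<lambda>x. f x ^ p)"
  by (induction p) (auto intro: bounded_rv_const bounded_rv_mult)

lemma bounded_rv_sum: "(\<And>k. k \<in> J \<Longrightarrow> bounded_rv N (f k)) \<Longrightarrow> bounded_rv N (\<lambda>x. \<Sum>k\<in>J. f k x)"
  by (induction J rule: infinite_finite_induct) (auto intro: bounded_rv_const bounded_rv_add)

lemma bounded_rv_exp:
  assumes "bounded_rv N f" shows "bounded_rv N (\<lambda>x. exp (f x))"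
proof -
  obtain A where "\<And>x. x \<in> space N \<Longrightarrow> \<bar>f x\<bar> \<le> A" using assms by (metis bounded_rvE)
  then show ?thesis using assms
    by (intro bounded_rvI[where B="exp A"] borel_measurable_exp[THEN measurable_compose[rotated]])
      (auto simp: bounded_rv_measurable abs_le_iff)
qed

lemma bounded_rv_compose:
  assumes "bounded_rv N f" "T \<in> measurable L N" shows "bounded_rv L (\<lambda>x. f (T x))"
proof -
  obtain A where "\<And>x. x \<in> space N \<Longrightarrow> \<bar>f x\<bar> \<le> A" using assms by (metis bounded_rvE)
  then show ?thesis using assms measurable_space[OF assms(2)]
    by (intro bounded_rvI[where B=A]) (auto intro: measurable_compose bounded_rv_measurable)
qed

lemma bounded_rv_integrable:
  assumes "prob_space N" "bounded_rv N f" shows "integrable N f"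
proof -
  interpret prob_space N by fact
  obtain A where "\<And>x. x \<in> space N \<Longrightarrow> \<bar>f x\<bar> \<le> A" using assms by (metis bounded_rvE)
  then show ?thesis using assms
    by (intro integrable_const_bound[where B=A]) (auto simp: bounded_rv_measurable)
qed

lemma bounded_rv_between:
  "g \<in> borel_measurable N \<Longrightarrow> (\<And>x. x \<in> space N \<Longrightarrow> g x \<in> {lo..hi::real}) \<Longrightarrow> bounded_rv N g"
  by (intro bounded_rvI[where B="max \<bar>lo\<bar> \<bar>hi\<bar>"]) (fastforce simp: abs_if max_def)+

lemma integral_between:
  assumes "prob_space N" "g \<in> borel_measurable N" "\<And>x. x \<in> space N \<Longrightarrow> g x \<in> {lo..hi::real}"
  shows "integral\<^sup>L N g \<in> {lo..hi}"
proof -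
  interpret prob_space N by fact
  have "bounded_rv N g" using assms(2,3)
    by (intro bounded_rvI[where B="max \<bar>lo\<bar> \<bar>hi\<bar>"]) (fastforce simp: abs_if max_def)+
  then have "integrable N g" using assms(1) bounded_rv_integrable by blast
  then show ?thesis
    using integral_ge_const[of g lo] integral_le_const[of g hi] assms(3) by auto
qed

lemma bounded_rv_integral:
  assumes "prob_space M" "bounded_rv (N \<Otimes>\<^sub>M M) (\<lambda>(x, y). f x y)"
  shows "bounded_rv N (\<lambda>x. \<integral>y. f x y \<partial>M)"
proof -
  interpret prob_space M by fact
  obtain A where A: "\<And>z. z \<in> space (N \<Otimes>\<^sub>M M) \<Longrightarrow> \<bar>(\<lambda>(x, y). f x y) z\<bar> \<le> A" using assms by (metis bounded_rvE)
  have m: "(\<lambda>(x, y). f x y) \<in> borel_measurable (N \<Otimes>\<^sub>M M)" using assms(2) by (rule bounded_rv_measurable)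
  show ?thesis
  proof (rule bounded_rvI[where B=A])
    show "(\<lambda>x. \<integral>y. f x y \<partial>M) \<in> borel_measurable N"
      using m by (intro borel_measurable_lebesgue_integral)
    fix x assume x: "x \<in> space N"
    have "(\<lambda>y. f x y) \<in> borel_measurable M" using measurable_Pair2[OF m x] by simp
    moreover have "f x y \<in> {-A..A}" if "y \<in> space M" for y
      using A[of "(x,y)"] x that by (simp add: space_pair_measure abs_le_iff)
    ultimately have "(\<integral>y. f x y \<partial>M) \<in> {-A..A}" by (intro integral_between assms(1))
    then show "\<bar>\<integral>y. f x y \<partial>M\<bar> \<le> A" by auto
  qed
qed

lemmas bounded_rv_intros = bounded_rv_const bounded_rv_add bounded_rv_diff bounded_rv_mult
  bounded_rv_power bounded_rv_sum bounded_rv_exp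

lemma bounded_rv_fubini:
  assumes "prob_space M" "prob_space N" "bounded_rv (N \<Otimes>\<^sub>M M) (\<lambda>(x, y). f x y)"
  shows "(\<integral>x. (\<integral>y. f x y \<partial>M) \<partial>N) = (\<integral>y. (\<integral>x. f x y \<partial>N) \<partial>M)"
    and "(\<integral>x. (\<integral>y. f x y \<partial>M) \<partial>N) = (\<integral>z. f (fst z) (snd z) \<partial>(N \<Otimes>\<^sub>M M))"
proof -
  interpret pair_prob_space N M using assms by (intro pair_prob_space.intro pair_sigma_finite.intro prob_space_imp_sigma_finite)
  have i: "integrable (N \<Otimes>\<^sub>M M) (\<lambda>(x, y). f x y)"
    using assms bounded_rv_integrable prob_space_pair by blast
  show "(\<integral>x. (\<integral>y. f x y \<partial>M) \<partial>N) = (\<integral>y. (\<integral>x. f x y \<partial>N) \<partial>M)"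
    using Fubini_integral[OF i] by simp
  show "(\<integral>x. (\<integral>y. f x y \<partial>M) \<partial>N) = (\<integral>z. f (fst z) (snd z) \<partial>(N \<Otimes>\<^sub>M M))"
    using integral_fst'[of "\<lambda>(x, y). f x y"] i by (simp add: case_prod_unfold)
qed

section \<open>Exponential moments and tilted variances\<close>

text \<open>The two bounds \<open>u \<le> exp u - 1 \<le> u exp u\<close> come from \<open>1 + v \<le> exp v\<close> at \<open>v = u\<close> and \<open>v = -u\<close>.\<close>
lemma exp_second_order_bound: "\<bar>exp u - 1 - u\<bar> \<le> u\<^sup>2 * exp \<bar>u\<bar>" for u :: real
proof -
  have 1: "1 + u \<le> exp u" by (rule exp_ge_add_one_self)
  have "1 - u \<le> exp (-u)" using exp_ge_add_one_self[of "-u"] by simp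
  then have "(1 - u) * exp u \<le> exp (-u) * exp u" by (intro mult_right_mono) auto
  then have 2: "exp u - 1 \<le> u * exp u" by (simp add: exp_minus field_simps)
  have "exp u - 1 - u \<le> u * (exp u - 1)" using 2 by (simp add: algebra_simps)
  also have "\<dots> \<le> u\<^sup>2 * exp \<bar>u\<bar>"
  proof (cases "u \<ge> 0")
    case True
    then show ?thesis using mult_left_mono[OF 2 True] by (simp add: power2_eq_square mult.assoc)
  next
    case False
    then have "u * (exp u - 1) \<le> u * u" using 1 by (intro mult_left_mono_neg) linarith+
    also have "\<dots> \<le> u * u * exp \<bar>u\<bar>" by (simp add: mult_le_cancel_left1 mult_less_0_iff)
    finally show ?thesis by (simp add: power2_eq_square)
  qed
  finally show ?thesis using 1 by linarith
qed

lemma integral_exp_deriv: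
  assumes "prob_space M" "bounded_rv M p" "bounded_rv M h"
  shows "((\<lambda>s. \<integral>x. p x * exp (s * h x) \<partial>M) has_real_derivative
            (\<integral>x. p x * h x * exp (s * h x) \<partial>M)) (at s)"
proof -
  interpret prob_space M by fact
  obtain A where A: "A > 0" "\<And>x. x \<in> space M \<Longrightarrow> \<bar>p x\<bar> \<le> A" using assms by (metis bounded_rvE)
  obtain B where B: "B > 0" "\<And>x. x \<in> space M \<Longrightarrow> \<bar>h x\<bar> \<le> B" using assms by (metis bounded_rvE)
  define F where "F = (\<lambda>s. \<integral>x. p x * exp (s * h x) \<partial>M)"
  define D where "D = (\<integral>x. p x * h x * exp (s * h x) \<partial>M)"
  define C where "C = A * exp (\<bar>s\<bar> * B) * (B\<^sup>2 * exp B)"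
  note bi = bounded_rv_intros assms(2,3)
  have int: "integrable M (\<lambda>x. p x * exp (s * h x))" "integrable M (\<lambda>x. p x * h x * exp (s * h x))" for s
    by (intro bounded_rv_integrable assms(1) bi)+
  have key: "\<bar>(F (s + d) - F s) / d - D\<bar> \<le> C * \<bar>d\<bar>" if d: "d \<noteq> 0" "\<bar>d\<bar> < 1" for d
  proof -
    let ?r = "\<lambda>x. p x * exp (s * h x) * (exp (d * h x) - 1 - d * h x)"
    have eq: "F (s + d) - F s - d * D = (\<integral>x. ?r x \<partial>M)"
    proof -
      have "(\<integral>x. ?r x \<partial>M) = (\<integral>x. p x * exp ((s+d) * h x) - p x * exp (s * h x) - d * (p x * h x * exp (s * h x)) \<partial>M)"
        by (intro Bochner_Integration.integral_cong refl) (simp add: algebra_simps exp_add)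
      also have "\<dots> = F (s + d) - F s - d * D"
        using int unfolding F_def D_def by (simp add: Bochner_Integration.integral_diff)
      finally show ?thesis by simp
    qed
    have "\<bar>?r x\<bar> \<le> C * d\<^sup>2" if x: "x \<in> space M" for x
    proof -
      have "\<bar>d * h x\<bar> \<le> 1 * B" unfolding abs_mult using d B x by (intro mult_mono) auto
      then have e: "exp \<bar>d * h x\<bar> \<le> exp B" by simp
      have "(d * h x)\<^sup>2 = d\<^sup>2 * \<bar>h x\<bar>\<^sup>2" by (simp add: power_mult_distrib)
      also have "\<dots> \<le> d\<^sup>2 * B\<^sup>2" using B x by (intro mult_left_mono power_mono) auto
      finally have "\<bar>exp (d * h x) - 1 - d * h x\<bar> \<le> d\<^sup>2 * B\<^sup>2 * exp B"
        using exp_second_order_bound[of "d * h x"] mult_mono[OF _ e, of "(d * h x)\<^sup>2" "d\<^sup>2 * B\<^sup>2"] by fastforce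
      moreover have "exp (s * h x) \<le> exp (\<bar>s\<bar> * B)"
      proof -
        have "s * h x \<le> \<bar>s\<bar> * \<bar>h x\<bar>" by (metis abs_ge_self abs_mult)
        also have "\<dots> \<le> \<bar>s\<bar> * B" using B x by (intro mult_left_mono) auto
        finally show ?thesis by simp
      qed
      moreover note A(2)[OF x]
      ultimately have "\<bar>?r x\<bar> \<le> (A * exp (\<bar>s\<bar> * B)) * (d\<^sup>2 * B\<^sup>2 * exp B)"
        unfolding abs_mult using A(1) by (intro mult_mono) auto
      then show ?thesis unfolding C_def by (simp add: algebra_simps)
    qed
    then have r: "?r x \<in> {-(C * d\<^sup>2)..C * d\<^sup>2}" if "x \<in> space M" for x using that by (metis abs_le_iff atLeastAtMost_iff minus_le_iff)
    have "(\<integral>x. ?r x \<partial>M) \<in> {-(C * d\<^sup>2)..C * d\<^sup>2}"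
      using r by (intro integral_between[OF assms(1)] bounded_rv_measurable bi) auto
    then have "\<bar>F (s + d) - F s - d * D\<bar> \<le> C * d\<^sup>2" unfolding eq by auto
    then have "\<bar>F (s + d) - F s - d * D\<bar> / \<bar>d\<bar> \<le> C * d\<^sup>2 / \<bar>d\<bar>" by (intro divide_right_mono) auto
    moreover have "\<bar>F (s + d) - F s - d * D\<bar> / \<bar>d\<bar> = \<bar>(F (s + d) - F s) / d - D\<bar>"
      using d(1) by (simp add: abs_divide[symmetric] diff_divide_distrib)
    moreover have "C * d\<^sup>2 / \<bar>d\<bar> = C * \<bar>d\<bar>" using d(1) by (simp add: power2_eq_square abs_if)
    ultimately show ?thesis by simp
  qed
  have "((\<lambda>d. (F (s + d) - F s) / d) \<longlongrightarrow> D) (at 0)"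
  proof (rule Lim_null[THEN iffD2], rule Lim_null_comparison)
    show "\<forall>\<^sub>F d in at 0. norm ((F (s + d) - F s) / d - D) \<le> C * \<bar>d\<bar>"
      unfolding eventually_at by (rule exI[of _ 1]) (use key in \<open>auto simp: dist_real_def\<close>)
    show "((\<lambda>d. C * \<bar>d\<bar>) \<longlongrightarrow> 0) (at 0)" by (auto intro!: tendsto_eq_intros)
  qed
  then show ?thesis unfolding DERIV_def F_def D_def .
qed

lemma integral_exp_pos:
  assumes "prob_space M" "bounded_rv M h"
  shows "(\<integral>x. exp (h x) \<partial>M) > 0"
proof -
  obtain B where B: "B > 0" "\<And>x. x \<in> space M \<Longrightarrow> \<bar>h x\<bar> \<le> B" using assms by (metis bounded_rvE)
  have "(\<integral>x. exp (h x) \<partial>M) \<in> {exp (-B)..exp B}"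
  proof (rule integral_between[OF assms(1)])
    show "(\<lambda>x. exp (h x)) \<in> borel_measurable M" using assms by (intro bounded_rv_measurable bounded_rv_exp)
    show "exp (h x) \<in> {exp (-B)..exp B}" if "x \<in> space M" for x using B(2)[OF that] by auto
  qed
  then show ?thesis using exp_gt_zero[of "-B"] by (metis atLeastAtMost_iff less_le_trans)
qed

text \<open>
  The Jensen gap of \<open>\<phi>\<close>: the variance for \<open>\<phi> u = u\<^sup>2\<close> and the entropy for \<open>\<phi> u = u ln u\<close>. Both are
  needed, and they are subadditive over products for the same reason.
\<close>
definition phi_entropy :: "(real \<Rightarrow> real) \<Rightarrow> 'b measure \<Rightarrow> ('b \<Rightarrow> real) \<Rightarrow> real" where
  "phi_entropy \<phi> M g = (\<integral>x. \<phi> (g x) \<partial>M) - \<phi> (\<integral>x. g x \<partial>M)"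

abbreviation xlnx :: "real \<Rightarrow> real" where "xlnx u \<equiv> u * ln u"

definition exp_moment :: "'b measure \<Rightarrow> ('b \<Rightarrow> real) \<Rightarrow> nat \<Rightarrow> real \<Rightarrow> real" where
  "exp_moment M h j s = (\<integral>x. h x ^ j * exp (s * h x) \<partial>M)"

lemma exp_moment_deriv:
  assumes "prob_space M" "bounded_rv M h"
  shows "(exp_moment M h j has_real_derivative exp_moment M h (Suc j) s) (at s)"
proof -
  have "bounded_rv M (\<lambda>x. h x ^ j)" using assms by (intro bounded_rv_intros)
  then show ?thesis using integral_exp_deriv[OF assms(1) _ assms(2)] unfolding exp_moment_def
    by (simp add: power_Suc2 del: power_Suc)
qed

lemma exp_moment_0_pos: "prob_space M \<Longrightarrow> bounded_rv M h \<Longrightarrow> exp_moment M h 0 s > 0"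
  unfolding exp_moment_def by (simp add: integral_exp_pos bounded_rv_intros)

lemma phi_entropy_exp:
  "phi_entropy xlnx M (\<lambda>x. exp (s * h x)) = s * exp_moment M h 1 s - exp_moment M h 0 s * ln (exp_moment M h 0 s)"
proof -
  have "(\<integral>x. exp (s * h x) * (s * h x) \<partial>M) = (\<integral>x. s * (h x * exp (s * h x)) \<partial>M)"
    by (intro Bochner_Integration.integral_cong refl) (simp add: algebra_simps)
  then show ?thesis unfolding phi_entropy_def exp_moment_def by simp
qed

lemma log_mgf_deriv:
  assumes "prob_space M" "bounded_rv M h"
  shows "((\<lambda>s. ln (exp_moment M h 0 s)) has_real_derivative exp_moment M h 1 s / exp_moment M h 0 s) (at s)"
  using DERIV_chain2[OF DERIV_ln_divide[OF exp_moment_0_pos[OF assms, of s]] exp_moment_deriv[OF assms, of 0 s]] by simp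

text \<open>
  Divided by the exponential moment, the entropy of \<open>exp (s h)\<close> vanishes at \<open>s = 0\<close> and has derivative
  \<open>s\<close> times the variance of \<open>h\<close> under the measure tilted by \<open>exp (s h)\<close>. A bound on the tilted variance
  therefore integrates to a bound on the entropy; giving the primitive \<open>Q\<close> instead of an integral
  keeps the statement free of integrals over \<open>s\<close>.
\<close>
lemma entropy_le_of_tilted_variance:
  assumes M: "prob_space M" "bounded_rv M h" and "\<beta> \<ge> 0"
    and Q: "\<And>s. 0 \<le> s \<Longrightarrow> s \<le> \<beta> \<Longrightarrow> (Q has_real_derivative Q' s) (at s)" "Q 0 = 0"
    and le: "\<And>s. 0 \<le> s \<Longrightarrow> s \<le> \<beta> \<Longrightarrow>
      s * (exp_moment M h 2 s * exp_moment M h 0 s - (exp_moment M h 1 s)\<^sup>2) \<le> Q' s * (exp_moment M h 0 s)\<^sup>2"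
  shows "phi_entropy xlnx M (\<lambda>x. exp (\<beta> * h x)) \<le> Q \<beta> * exp_moment M h 0 \<beta>"
proof -
  interpret prob_space M by (rule M)
  let ?m = "exp_moment M h"
  let ?R = "\<lambda>s. Q s - (s * (?m 1 s / ?m 0 s) - ln (?m 0 s))"
  have "?R 0 \<le> ?R \<beta>"
  proof (rule DERIV_nonneg_imp_nondecreasing[OF \<open>\<beta> \<ge> 0\<close>])
    fix s assume s: "0 \<le> s" "s \<le> \<beta>"
    have p: "?m 0 s > 0" by (rule exp_moment_0_pos[OF M])
    have "(?R has_real_derivative Q' s - (1 * (?m 1 s / ?m 0 s) + ((?m 2 s * ?m 0 s - ?m 1 s * ?m 1 s) / (?m 0 s * ?m 0 s)) * s
         - ?m 1 s / ?m 0 s)) (at s)"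
      using exp_moment_deriv[OF M, of 1 s] exp_moment_deriv[OF M, of 0 s] p
      by (intro DERIV_diff Q s DERIV_mult DERIV_ident log_mgf_deriv M DERIV_divide) (auto simp: numeral_2_eq_2)
    moreover have "(?m 2 s * ?m 0 s - ?m 1 s * ?m 1 s) / (?m 0 s * ?m 0 s) * s \<le> Q' s"
      using le[OF s] p by (simp add: field_simps power2_eq_square)
    ultimately show "\<exists>y. (?R has_real_derivative y) (at s) \<and> 0 \<le> y" by (intro exI conjI) auto
  qed
  moreover have "?m 0 0 = 1" unfolding exp_moment_def by (simp add: prob_space)
  ultimately have "\<beta> * (?m 1 \<beta> / ?m 0 \<beta>) - ln (?m 0 \<beta>) \<le> Q \<beta>" using Q(2) by simp
  then show ?thesis unfolding phi_entropy_exp using exp_moment_0_pos[OF M, of \<beta>]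
    by (simp add: field_simps)
qed

section \<open>Subadditivity of variance and entropy over product measures\<close>

lemma space_PiM_upd:
  "x \<in> space (PiM I (\<lambda>_. M)) \<Longrightarrow> y \<in> space M \<Longrightarrow> k \<in> I \<Longrightarrow> x(k := y) \<in> space (PiM I (\<lambda>_. M))"
  by (auto simp: space_PiM PiE_def extensional_def)

lemma space_PiM_component: "x \<in> space (PiM I (\<lambda>_. M)) \<Longrightarrow> k \<in> I \<Longrightarrow> x k \<in> space M"
  by (auto simp: space_PiM)

lemma measurable_upd:
  "k \<in> I \<Longrightarrow> u \<in> measurable N (PiM I (\<lambda>_. M)) \<Longrightarrow> v \<in> measurable N M \<Longrightarrow>
    (\<lambda>x. (u x)(k := v x)) \<in> measurable N (PiM I (\<lambda>_. M))"
  by (rule measurable_fun_upd) auto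

lemma integral_PiM_insert:
  assumes "prob_space M" "finite I" "i \<notin> I" "bounded_rv (PiM (insert i I) (\<lambda>_. M)) f"
  shows "(\<integral>x. f x \<partial>PiM (insert i I) (\<lambda>_. M)) = (\<integral>x. (\<integral>y. f (x(i := y)) \<partial>M) \<partial>PiM I (\<lambda>_. M))"
proof -
  interpret prob_space M by fact
  interpret product_sigma_finite "\<lambda>_. M"
    by (intro product_sigma_finite.intro sigma_finite_measure_axioms)
  show ?thesis
    using assms by (intro product_integral_insert bounded_rv_integrable prob_space_PiM)
qed

text \<open>Replacing one coordinate by an independent copy does not change the distribution.\<close>
lemma integral_PiM_resample:
  assumes M: "prob_space M" and I: "finite I" "k \<in> I" and f: "bounded_rv (PiM I (\<lambda>_. M)) f"
  shows "(\<integral>x. (\<integral>y. f (x(k := y)) \<partial>M) \<partial>PiM I (\<lambda>_. M)) = (\<integral>x. f x \<partial>PiM I (\<lambda>_. M))"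
proof -
  interpret prob_space M by fact
  obtain J where J: "I = insert k J" "k \<notin> J" using I(2) by (meson mk_disjoint_insert)
  have "finite J" using I J by simp
  have b: "bounded_rv (PiM I (\<lambda>_. M)) (\<lambda>x. \<integral>y. f (x(k := y)) \<partial>M)"
    using bounded_rv_compose[OF f measurable_upd[OF I(2), of fst "PiM I (\<lambda>_. M) \<Otimes>\<^sub>M M" M snd]]
    by (intro bounded_rv_integral[OF M]) (simp add: case_prod_unfold)
  show ?thesis
    using integral_PiM_insert[OF M \<open>finite J\<close> J(2) b[unfolded J(1)]]
      integral_PiM_insert[OF M \<open>finite J\<close> J(2) f[unfolded J(1)]] unfolding J(1)
    by (simp add: prob_space)
qed

text \<open>Induction on the set of coordinates. The chain rule splits the \<open>\<phi>\<close>-entropy over \<open>insert i I\<close> into the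
  mean \<open>\<phi>\<close>-entropy in coordinate \<open>i\<close> and the \<open>\<phi>\<close>-entropy over \<open>I\<close> of the function averaged over
  coordinate \<open>i\<close>. The induction hypothesis bounds the latter by one-coordinate terms of the average,
  and the assumption \<open>convex\<close> takes the average out of these terms.\<close>
lemma phi_entropy_tensorization:
  assumes M: "prob_space M" and I: "finite I"
    and \<phi>: "\<phi> \<in> borel_measurable borel" "\<And>u. u \<in> {lo..hi} \<Longrightarrow> \<bar>\<phi> u\<bar> \<le> B"
    and convex: "\<And>G. G \<in> borel_measurable (M \<Otimes>\<^sub>M M) \<Longrightarrow> (\<And>z. z \<in> space (M \<Otimes>\<^sub>M M) \<Longrightarrow> G z \<in> {lo..hi}) \<Longrightarrow>
        phi_entropy \<phi> M (\<lambda>z. \<integral>y. G (z, y) \<partial>M) \<le> (\<integral>y. phi_entropy \<phi> M (\<lambda>z. G (z, y)) \<partial>M)"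
    and g: "g \<in> borel_measurable (PiM I (\<lambda>_. M))" "\<And>x. x \<in> space (PiM I (\<lambda>_. M)) \<Longrightarrow> g x \<in> {lo..hi}"
  shows "phi_entropy \<phi> (PiM I (\<lambda>_. M)) g
      \<le> (\<Sum>k\<in>I. \<integral>x. phi_entropy \<phi> M (\<lambda>y. g (x(k := y))) \<partial>PiM I (\<lambda>_. M))"
  using I g
proof (induction I arbitrary: g rule: finite_induct)
  case empty
  then show ?case by (simp add: phi_entropy_def PiM_empty lebesgue_integral_count_space_finite)
next
  case (insert i I)
  interpret prob_space M by fact
  let ?P = "PiM I (\<lambda>_. M)" and ?Q = "PiM (insert i I) (\<lambda>_. M)"
  have pP: "prob_space ?P" and pQ: "prob_space ?Q" using M by (auto intro: prob_space_PiM)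
  let ?c = "max \<bar>lo\<bar> \<bar>hi\<bar>"
  have bI: "bounded_rv N f \<and> bounded_rv N (\<lambda>x. \<phi> (f x))"
    if "f \<in> borel_measurable N" "\<And>x. x \<in> space N \<Longrightarrow> f x \<in> {lo..hi}" for N :: "'c measure" and f
  proof
    show "bounded_rv N f" using that by (intro bounded_rvI[where B="?c"]) (fastforce simp: abs_if max_def)+
    show "bounded_rv N (\<lambda>x. \<phi> (f x))"
      using that by (intro bounded_rvI[where B=B] \<phi>(2) measurable_compose[OF _ \<phi>(1)])
  qed
  have bent: "bounded_rv N (\<lambda>x. phi_entropy \<phi> M (\<lambda>y. F (x, y)))"
    if F: "F \<in> borel_measurable (N \<Otimes>\<^sub>M M)" "\<And>x. x \<in> space (N \<Otimes>\<^sub>M M) \<Longrightarrow> F x \<in> {lo..hi}"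
    for N :: "'c measure" and F
  proof -
    have b: "bounded_rv (N \<Otimes>\<^sub>M M) (\<lambda>(x, y). F (x, y))" "bounded_rv (N \<Otimes>\<^sub>M M) (\<lambda>(x, y). \<phi> (F (x, y)))"
      using bI[OF F] by (simp_all add: case_prod_unfold)
    have "bounded_rv N (\<lambda>x. \<phi> (\<integral>y. F (x, y) \<partial>M))"
    proof (rule bI[THEN conjunct2])
      show "(\<lambda>x. \<integral>y. F (x, y) \<partial>M) \<in> borel_measurable N"
        using bounded_rv_integral[OF M b(1)] by (rule bounded_rv_measurable)
      show "(\<integral>y. F (x, y) \<partial>M) \<in> {lo..hi}" if "x \<in> space N" for x
        using that F by (intro integral_between[OF M]) (auto simp: space_pair_measure measurable_Pair2)
    qed
    then show ?thesis unfolding phi_entropy_def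
      using bounded_rv_integral[OF M b(2)] by (intro bounded_rv_diff)
  qed
  have upd: "(\<lambda>z. (fst z)(i := snd z)) \<in> measurable (?P \<Otimes>\<^sub>M M) ?Q"
    by (rule measurable_fun_upd[where J=I]) auto
  have upd_sp: "x(i := y) \<in> space ?Q" if "x \<in> space ?P" "y \<in> space M" for x y
    using measurable_space[OF upd, of "(x, y)"] that by (simp add: space_pair_measure)
  define G where "G x = (\<integral>y. g (x(i := y)) \<partial>M)" for x
  have gu: "(\<lambda>z. g ((fst z)(i := snd z))) \<in> borel_measurable (?P \<Otimes>\<^sub>M M)"
    using measurable_compose[OF upd insert.prems(1)] .
  have gur: "g (x(i := y)) \<in> {lo..hi}" if "x \<in> space ?P" "y \<in> space M" for x y
    using that by (intro insert.prems(2) upd_sp)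
  have gx: "(\<lambda>y. g (x(i := y))) \<in> borel_measurable M" if "x \<in> space ?P" for x
    using measurable_Pair2[OF gu that] by simp
  have Gm: "G \<in> borel_measurable ?P" unfolding G_def
    using gu by (intro borel_measurable_lebesgue_integral) (simp add: case_prod_unfold)
  have Gr: "G x \<in> {lo..hi}" if "x \<in> space ?P" for x
    unfolding G_def using that by (intro integral_between[OF M] gx gur)
  have bg: "bounded_rv ?Q g" "bounded_rv ?Q (\<lambda>x. \<phi> (g x))" using bI[OF insert.prems] by auto
  have bG: "bounded_rv ?P G" "bounded_rv ?P (\<lambda>x. \<phi> (G x))" using bI[OF Gm Gr] by auto
  have bE: "bounded_rv ?P (\<lambda>x. phi_entropy \<phi> M (\<lambda>y. g (x(i := y))))"
    using bent[OF gu] gur by (auto simp: space_pair_measure)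
  have bEk: "bounded_rv ?Q (\<lambda>x. phi_entropy \<phi> M (\<lambda>y. g (x(k := y))))" if "k \<in> insert i I" for k
  proof -
    have m: "(\<lambda>z. (fst z)(k := snd z)) \<in> measurable (?Q \<Otimes>\<^sub>M M) ?Q"
      using that by (intro measurable_upd) auto
    show ?thesis
      using bent[OF measurable_compose[OF m insert.prems(1)] insert.prems(2)[OF measurable_space[OF m]]]
      by (simp only: fst_conv snd_conv)
  qed
  have chain: "phi_entropy \<phi> ?Q g = (\<integral>x. phi_entropy \<phi> M (\<lambda>y. g (x(i := y))) \<partial>?P) + phi_entropy \<phi> ?P G"
  proof -
    have "(\<integral>x. \<phi> (g x) \<partial>?Q) = (\<integral>x. (\<integral>y. \<phi> (g (x(i := y))) \<partial>M) \<partial>?P)"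
      using integral_PiM_insert[OF M insert.hyps bg(2)] .
    also have "\<dots> = (\<integral>x. phi_entropy \<phi> M (\<lambda>y. g (x(i := y))) + \<phi> (G x) \<partial>?P)"
      by (simp add: phi_entropy_def G_def)
    also have "\<dots> = (\<integral>x. phi_entropy \<phi> M (\<lambda>y. g (x(i := y))) \<partial>?P) + (\<integral>x. \<phi> (G x) \<partial>?P)"
      by (intro Bochner_Integration.integral_add bounded_rv_integrable pP bE bG)
    moreover have "(\<integral>x. g x \<partial>?Q) = (\<integral>x. G x \<partial>?P)"
      using integral_PiM_insert[OF M insert.hyps bg(1)] unfolding G_def .
    ultimately show ?thesis unfolding phi_entropy_def by simp
  qed
  have first: "(\<integral>x. phi_entropy \<phi> M (\<lambda>y. g (x(i := y))) \<partial>?P) = (\<integral>x. phi_entropy \<phi> M (\<lambda>y. g (x(i := y))) \<partial>?Q)"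
    using integral_PiM_insert[OF M insert.hyps bEk[of i]] by (simp add: prob_space)
  have rest: "(\<integral>x. phi_entropy \<phi> M (\<lambda>z. G (x(k := z))) \<partial>?P) \<le> (\<integral>x. phi_entropy \<phi> M (\<lambda>z. g (x(k := z))) \<partial>?Q)"
    if k: "k \<in> I" for k
  proof -
    have ki: "k \<noteq> i" using k insert.hyps by auto
    have b1: "bounded_rv ?P (\<lambda>x. phi_entropy \<phi> M (\<lambda>z. G (x(k := z))))"
      using bent[OF measurable_compose[OF measurable_upd[OF k, of fst "?P \<Otimes>\<^sub>M M" M snd] Gm]] Gr k
      by (auto simp: space_pair_measure space_PiM_upd)
    have b2: "bounded_rv ?P (\<lambda>x. \<integral>y. phi_entropy \<phi> M (\<lambda>z. g (x(i := y, k := z))) \<partial>M)"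
      using bounded_rv_compose[OF bEk[of k] upd] k
      by (intro bounded_rv_integral[OF M]) (simp add: case_prod_unfold)
    have "(\<integral>x. phi_entropy \<phi> M (\<lambda>z. G (x(k := z))) \<partial>?P) \<le> (\<integral>x. (\<integral>y. phi_entropy \<phi> M (\<lambda>z. g (x(i := y, k := z))) \<partial>M) \<partial>?P)"
    proof (intro integral_mono bounded_rv_integrable pP b1 b2)
      fix x assume x: "x \<in> space ?P"
      let ?T = "\<lambda>z. x(i := snd z, k := fst z)"
      have T: "?T \<in> measurable (M \<Otimes>\<^sub>M M) ?Q"
        using k by (intro measurable_upd measurable_fun_upd[where J=I] measurable_const x) auto
      have "phi_entropy \<phi> M (\<lambda>z. \<integral>y. g (?T (z, y)) \<partial>M) \<le> (\<integral>y. phi_entropy \<phi> M (\<lambda>z. g (?T (z, y))) \<partial>M)"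
      proof (rule convex[of "\<lambda>z. g (?T z)"])
        show "(\<lambda>z. g (?T z)) \<in> borel_measurable (M \<Otimes>\<^sub>M M)"
          by (rule measurable_compose[OF T insert.prems(1)])
        show "g (?T z) \<in> {lo..hi}" if "z \<in> space (M \<Otimes>\<^sub>M M)" for z
          by (rule insert.prems(2)[OF measurable_space[OF T that]])
      qed
      then show "phi_entropy \<phi> M (\<lambda>z. G (x(k := z))) \<le> (\<integral>y. phi_entropy \<phi> M (\<lambda>z. g (x(i := y, k := z))) \<partial>M)"
        unfolding G_def using ki by (simp add: fun_upd_twist[OF ki])
    qed
    also have "\<dots> = (\<integral>x. phi_entropy \<phi> M (\<lambda>z. g (x(k := z))) \<partial>?Q)"
      using integral_PiM_insert[OF M insert.hyps bEk[of k]] k by simp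
    finally show ?thesis .
  qed
  have "phi_entropy \<phi> ?P G \<le> (\<Sum>k\<in>I. \<integral>x. phi_entropy \<phi> M (\<lambda>y. G (x(k := y))) \<partial>?P)"
    by (rule insert.IH[OF Gm Gr])
  also have "\<dots> \<le> (\<Sum>k\<in>I. \<integral>x. phi_entropy \<phi> M (\<lambda>z. g (x(k := z))) \<partial>?Q)"
    by (intro sum_mono rest)
  finally show ?case unfolding chain first sum.insert[OF insert.hyps] by (intro add_left_mono)
qed

text \<open>
  The Gibbs variational principle, from \<open>ln u \<le> u - 1\<close> at the ratio \<open>u\<close> of the two densities
  \<open>exp T / E exp T\<close> and \<open>g / E g\<close>. It yields the convexity of the entropy, and later the decoupling of
  \<open>S\<close> from \<open>exp (s f)\<close>.
\<close>
lemma entropy_duality: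
  assumes M: "prob_space M" and g: "bounded_rv M g" "bounded_rv M (\<lambda>x. ln (g x))" "\<And>x. x \<in> space M \<Longrightarrow> g x > 0"
    and pos: "(\<integral>x. g x \<partial>M) > 0"
    and T: "bounded_rv M T"
  shows "(\<integral>x. g x * T x \<partial>M) \<le> phi_entropy xlnx M g + (\<integral>x. g x \<partial>M) * ln (\<integral>x. exp (T x) \<partial>M)"
proof -
  interpret prob_space M by fact
  define m where "m = (\<integral>x. g x \<partial>M)"
  define Z where "Z = (\<integral>x. exp (T x) \<partial>M)"
  have Z: "Z > 0" unfolding Z_def by (rule integral_exp_pos[OF M T])
  have m: "m > 0" using pos unfolding m_def .
  note bi = bounded_rv_intros g(1,2) T
  have "(\<integral>x. g x * T x \<partial>M) \<le> (\<integral>x. g x * ln (g x) + (ln Z - ln m - 1) * g x + (m / Z) * exp (T x) \<partial>M)"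
  proof (intro integral_mono bounded_rv_integrable M bi)
    fix x assume x: "x \<in> space M"
    let ?u = "m * exp (T x) / (Z * g x)"
    have gp: "g x > 0" using g(3) x .
    have up: "?u > 0" using m Z gp by simp
    have "ln ?u = ln m + T x - ln Z - ln (g x)"
      using m Z gp by (simp add: ln_div ln_mult)
    moreover have "ln ?u \<le> ?u - 1" using up by (rule ln_le_minus_one)
    ultimately have "g x * (ln m + T x - ln Z - ln (g x)) \<le> g x * (?u - 1)" using gp by (intro mult_left_mono) auto
    also have "\<dots> = (m / Z) * exp (T x) - g x" using gp Z by (simp add: field_simps)
    finally show "g x * T x \<le> g x * ln (g x) + (ln Z - ln m - 1) * g x + (m / Z) * exp (T x)"
      by (simp add: algebra_simps)
  qed
  also have "\<dots> = (\<integral>x. g x * ln (g x) \<partial>M) + (ln Z - ln m - 1) * m + (m / Z) * Z"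
    unfolding m_def Z_def
    by (simp add: Bochner_Integration.integral_add bounded_rv_integrable M bi)
  also have "\<dots> = phi_entropy xlnx M g + m * ln Z"
    unfolding phi_entropy_def m_def[symmetric] using Z by (simp add: algebra_simps)
  finally show ?thesis unfolding m_def Z_def .
qed

lemma ln_between: "0 < lo \<Longrightarrow> u \<in> {lo..hi} \<Longrightarrow> ln u \<in> {ln lo..ln hi::real}"
  by auto

text \<open>The function \<open>T = ln (g / E g)\<close> is optimal in the variational formula for the average \<open>g\<close> and
  admissible for every \<open>G (_, y)\<close>. The formula is linear in its first argument, so averaging over \<open>y\<close>
  gives the claim.\<close>
lemma entropy_convex:
  assumes M: "prob_space M" and lo: "0 < lo"
    and G: "G \<in> borel_measurable (M \<Otimes>\<^sub>M M)" "\<And>z. z \<in> space (M \<Otimes>\<^sub>M M) \<Longrightarrow> G z \<in> {lo..hi}"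
  shows "phi_entropy xlnx M (\<lambda>z. \<integral>y. G (z, y) \<partial>M) \<le> (\<integral>y. phi_entropy xlnx M (\<lambda>z. G (z, y)) \<partial>M)"
proof -
  interpret prob_space M by fact
  note bG = bounded_rv_between[OF G]
  have blnG: "bounded_rv (M \<Otimes>\<^sub>M M) (\<lambda>z. ln (G z))"
    using G lo by (intro bounded_rv_between[where lo="ln lo" and hi="ln hi"] ln_between) auto
  have sw: "(\<lambda>(y, z). (z, y)) \<in> measurable (M \<Otimes>\<^sub>M M) (M \<Otimes>\<^sub>M M)" by measurable
  define g where "g z = (\<integral>y. G (z, y) \<partial>M)" for z
  have gr: "g z \<in> {lo..hi}" if "z \<in> space M" for z
    unfolding g_def using that G by (intro integral_between[OF M]) (auto simp: space_pair_measure measurable_Pair2)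
  have bg: "bounded_rv M g" unfolding g_def
    using bG by (intro bounded_rv_integral[OF M]) (simp add: case_prod_unfold)
  have blng: "bounded_rv M (\<lambda>x. ln (g x))"
    using gr lo by (intro bounded_rv_between[where lo="ln lo" and hi="ln hi"] ln_between borel_measurable_ln bounded_rv_measurable[OF bg]) auto
  define m where "m = (\<integral>z. g z \<partial>M)"
  have m: "m > 0" using integral_between[OF M bounded_rv_measurable[OF bg] gr] lo unfolding m_def by auto
  define T where "T z = ln (g z) - ln m" for z
  have bT: "bounded_rv M T" unfolding T_def by (intro bounded_rv_intros blng)
  have "(\<integral>z. exp (T z) \<partial>M) = (\<integral>z. g z / m \<partial>M)"
    using gr lo m by (intro Bochner_Integration.integral_cong refl) (force simp: T_def exp_diff)
  also have "\<dots> = 1" using m unfolding m_def[symmetric] by (simp add: m_def[symmetric])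
  finally have eT: "(\<integral>z. exp (T z) \<partial>M) = 1" .
  have bGT: "bounded_rv (M \<Otimes>\<^sub>M M) (\<lambda>(z, y). G (z, y) * T z)"
    using bounded_rv_mult[OF bG bounded_rv_compose[OF bT measurable_fst]] by (simp add: case_prod_unfold)
  have "phi_entropy xlnx M g = (\<integral>z. g z * T z \<partial>M)"
    unfolding phi_entropy_def T_def m_def[symmetric] using bg blng m
    by (simp add: right_diff_distrib Bochner_Integration.integral_diff bounded_rv_integrable M bounded_rv_intros m_def)
  also have "\<dots> = (\<integral>z. (\<integral>y. G (z, y) * T z \<partial>M) \<partial>M)" unfolding g_def by simp
  also have "\<dots> = (\<integral>y. (\<integral>z. G (z, y) * T z \<partial>M) \<partial>M)" by (rule bounded_rv_fubini(1)[OF M M bGT])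
  also have "\<dots> \<le> (\<integral>y. phi_entropy xlnx M (\<lambda>z. G (z, y)) \<partial>M)"
  proof (intro integral_mono bounded_rv_integrable M)
    show "bounded_rv M (\<lambda>y. \<integral>z. G (z, y) * T z \<partial>M)"
      using bounded_rv_compose[OF bGT sw] by (intro bounded_rv_integral[OF M]) (simp add: case_prod_unfold)
    have bl: "bounded_rv M (\<lambda>y. \<integral>z. G (z, y) * ln (G (z, y)) \<partial>M)"
      using bounded_rv_compose[OF bounded_rv_mult[OF bG blnG] sw] by (intro bounded_rv_integral[OF M]) (simp add: case_prod_unfold)
    have bi: "bounded_rv M (\<lambda>y. \<integral>z. G (z, y) \<partial>M)"
      using bounded_rv_compose[OF bG sw] by (intro bounded_rv_integral[OF M]) (simp add: case_prod_unfold)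
    have ir: "(\<integral>z. G (z, y) \<partial>M) \<in> {lo..hi}" if "y \<in> space M" for y
      using that G by (intro integral_between[OF M]) (auto simp: space_pair_measure measurable_Pair1)
    have "bounded_rv M (\<lambda>y. ln (\<integral>z. G (z, y) \<partial>M))"
      using ir lo by (intro bounded_rv_between[where lo="ln lo" and hi="ln hi"] ln_between borel_measurable_ln bounded_rv_measurable[OF bi]) auto
    then show "bounded_rv M (\<lambda>y. phi_entropy xlnx M (\<lambda>z. G (z, y)))"
      unfolding phi_entropy_def by (intro bounded_rv_intros bl bi)
    fix y assume y: "y \<in> space M"
    have mk: "(\<lambda>z. (z, y)) \<in> measurable M (M \<Otimes>\<^sub>M M)" using y by measurable
    have "(\<integral>z. G (z, y) * T z \<partial>M) \<le> phi_entropy xlnx M (\<lambda>z. G (z, y)) + (\<integral>z. G (z, y) \<partial>M) * ln (\<integral>z. exp (T z) \<partial>M)"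
    proof (rule entropy_duality[OF M bounded_rv_compose[OF bG mk] bounded_rv_compose[OF blnG mk] _ _ bT])
      show "G (z, y) > 0" if "z \<in> space M" for z using G(2)[of "(z, y)"] that y lo by (simp add: space_pair_measure)
      show "(\<integral>z. G (z, y) \<partial>M) > 0" using ir[OF y] lo by simp
    qed
    then show "(\<integral>z. G (z, y) * T z \<partial>M) \<le> phi_entropy xlnx M (\<lambda>z. G (z, y))" unfolding eT by simp
  qed
  finally show ?thesis unfolding g_def .
qed

text \<open>As for the entropy, with the linear lower bound \<open>Var f \<ge> 2 Cov (f, g) - Var g\<close>, which is
  \<open>Var (f - g) \<ge> 0\<close>.\<close>
lemma variance_convex:
  assumes M: "prob_space M" 
    and G: "G \<in> borel_measurable (M \<Otimes>\<^sub>M M)" "\<And>z. z \<in> space (M \<Otimes>\<^sub>M M) \<Longrightarrow> G z \<in> {lo..hi}"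
  shows "phi_entropy (\<lambda>u. u\<^sup>2) M (\<lambda>z. \<integral>y. G (z, y) \<partial>M) \<le> (\<integral>y. phi_entropy (\<lambda>u. u\<^sup>2) M (\<lambda>z. G (z, y)) \<partial>M)"
proof -
  interpret prob_space M by fact
  note bG = bounded_rv_between[OF G]
  have sw: "(\<lambda>(y, z). (z, y)) \<in> measurable (M \<Otimes>\<^sub>M M) (M \<Otimes>\<^sub>M M)" by measurable
  define g where "g z = (\<integral>y. G (z, y) \<partial>M)" for z
  have bg: "bounded_rv M g" unfolding g_def
    using bG by (intro bounded_rv_integral[OF M]) (simp add: case_prod_unfold)
  define m where "m = (\<integral>z. g z \<partial>M)"
  define T where "T z = 2 * (g z - m)" for z
  have bT: "bounded_rv M T" unfolding T_def by (intro bounded_rv_intros bg)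
  have bGT: "bounded_rv (M \<Otimes>\<^sub>M M) (\<lambda>(z, y). G (z, y) * T z)"
    using bounded_rv_mult[OF bG bounded_rv_compose[OF bT measurable_fst]] by (simp add: case_prod_unfold)
  define v where "v = phi_entropy (\<lambda>u. u\<^sup>2) M g"
  have v: "v = (\<integral>z. (g z)\<^sup>2 \<partial>M) - m\<^sup>2" unfolding v_def phi_entropy_def m_def by simp
  have gT: "(\<integral>z. g z * T z \<partial>M) = 2 * v"
  proof -
    have "(\<integral>z. g z * T z \<partial>M) = (\<integral>z. 2 * (g z)\<^sup>2 - 2 * m * g z \<partial>M)"
      by (intro Bochner_Integration.integral_cong refl) (simp add: T_def power2_eq_square algebra_simps)
    also have "\<dots> = 2 * (\<integral>z. (g z)\<^sup>2 \<partial>M) - 2 * m * m"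
      by (simp add: Bochner_Integration.integral_diff bounded_rv_integrable M bounded_rv_intros bg m_def)
    finally show ?thesis unfolding v by (simp add: power2_eq_square)
  qed
  have "(\<integral>z. g z * T z \<partial>M) = (\<integral>z. (\<integral>y. G (z, y) * T z \<partial>M) \<partial>M)" unfolding g_def by simp
  also have "\<dots> = (\<integral>y. (\<integral>z. G (z, y) * T z \<partial>M) \<partial>M)" by (rule bounded_rv_fubini(1)[OF M M bGT])
  finally have 1: "2 * v = (\<integral>y. (\<integral>z. G (z, y) * T z \<partial>M) \<partial>M)" unfolding gT .
  have b1: "bounded_rv M (\<lambda>y. \<integral>z. G (z, y) * T z \<partial>M)"
    using bounded_rv_compose[OF bGT sw] by (intro bounded_rv_integral[OF M]) (simp add: case_prod_unfold)
  have bs: "bounded_rv M (\<lambda>y. \<integral>z. (G (z, y))\<^sup>2 \<partial>M)"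
    using bounded_rv_compose[OF bounded_rv_power[OF bG] sw] by (intro bounded_rv_integral[OF M]) (simp add: case_prod_unfold)
  have bi: "bounded_rv M (\<lambda>y. \<integral>z. G (z, y) \<partial>M)"
    using bounded_rv_compose[OF bG sw] by (intro bounded_rv_integral[OF M]) (simp add: case_prod_unfold)
  have "(\<integral>y. (\<integral>z. G (z, y) * T z \<partial>M) \<partial>M) - v = (\<integral>y. (\<integral>z. G (z, y) * T z \<partial>M) - v \<partial>M)"
    by (simp add: bounded_rv_integrable M b1 prob_space)
  also have "\<dots> \<le> (\<integral>y. phi_entropy (\<lambda>u. u\<^sup>2) M (\<lambda>z. G (z, y)) \<partial>M)"
  proof (intro integral_mono bounded_rv_integrable M)
    show "bounded_rv M (\<lambda>y. (\<integral>z. G (z, y) * T z \<partial>M) - v)" by (intro bounded_rv_intros b1)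
    show "bounded_rv M (\<lambda>y. phi_entropy (\<lambda>u. u\<^sup>2) M (\<lambda>z. G (z, y)))"
      unfolding phi_entropy_def by (intro bounded_rv_intros bs bi)
    fix y assume y: "y \<in> space M"
    have mk: "(\<lambda>z. (z, y)) \<in> measurable M (M \<Otimes>\<^sub>M M)" using y by measurable
    define f where "f z = G (z, y)" for z
    have bf: "bounded_rv M f" unfolding f_def by (rule bounded_rv_compose[OF bG mk])
    note bI = bounded_rv_integrable[OF M] and bi = bounded_rv_intros bf bg
    let ?d = "\<lambda>z. f z - g z"
    have "0 \<le> phi_entropy (\<lambda>u. u\<^sup>2) M ?d"
      unfolding phi_entropy_def using variance_positive[of ?d]
      by (subst (asm) variance_eq) (auto intro!: bI bi)
    also have "\<dots> = phi_entropy (\<lambda>u. u\<^sup>2) M f - (\<integral>z. f z * T z \<partial>M) + v"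
    proof -
      have "(\<integral>z. (?d z)\<^sup>2 \<partial>M) = (\<integral>z. (f z)\<^sup>2 - (f z * T z + 2 * m * f z) + (g z)\<^sup>2 \<partial>M)"
        by (intro Bochner_Integration.integral_cong refl) (simp add: T_def power2_eq_square algebra_simps)
      also have "\<dots> = (\<integral>z. (f z)\<^sup>2 \<partial>M) - ((\<integral>z. f z * T z \<partial>M) + 2 * m * (\<integral>z. f z \<partial>M)) + (\<integral>z. (g z)\<^sup>2 \<partial>M)"
        by (simp add: bI bi bT)
      finally have e1: "(\<integral>z. (?d z)\<^sup>2 \<partial>M) = (\<integral>z. (f z)\<^sup>2 \<partial>M) - ((\<integral>z. f z * T z \<partial>M) + 2 * m * (\<integral>z. f z \<partial>M)) + (\<integral>z. (g z)\<^sup>2 \<partial>M)" .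
      have e2: "(\<integral>z. ?d z \<partial>M) = (\<integral>z. f z \<partial>M) - m" unfolding m_def by (simp add: bI bi)
      show ?thesis unfolding phi_entropy_def v e1 e2 by (simp add: power2_diff)
    qed
    finally show "(\<integral>z. G (z, y) * T z \<partial>M) - v \<le> phi_entropy (\<lambda>u. u\<^sup>2) M (\<lambda>z. G (z, y))"
      unfolding f_def by simp
  qed
  finally show ?thesis using 1 unfolding v_def g_def by linarith
qed

lemma entropy_tensorization:
  assumes M: "prob_space M" and I: "finite I" and h: "bounded_rv (PiM I (\<lambda>_. M)) h"
  shows "phi_entropy xlnx (PiM I (\<lambda>_. M)) (\<lambda>x. exp (h x))
      \<le> (\<Sum>k\<in>I. \<integral>x. phi_entropy xlnx M (\<lambda>y. exp (h (x(k := y)))) \<partial>PiM I (\<lambda>_. M))"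
proof -
  obtain B where B: "B > 0" "\<And>x. x \<in> space (PiM I (\<lambda>_. M)) \<Longrightarrow> \<bar>h x\<bar> \<le> B" using h by (metis bounded_rvE)
  show ?thesis
  proof (rule phi_entropy_tensorization[OF M I, where lo="exp (-B)" and hi="exp B" and B="exp B * B"])
    show "xlnx \<in> borel_measurable borel" by measurable
    show "\<bar>u * ln u\<bar> \<le> exp B * B" if "u \<in> {exp (-B)..exp B}" for u
    proof -
      have u0: "u > 0" using that exp_gt_zero[of "-B"] by (meson atLeastAtMost_iff less_le_trans)
      have "ln u \<in> {-B..B}" using ln_between[OF exp_gt_zero that] by simp
      then show ?thesis unfolding abs_mult using that u0 by (intro mult_mono) auto
    qed
    show "(\<lambda>x. exp (h x)) \<in> borel_measurable (PiM I (\<lambda>_. M))" using h by (intro bounded_rv_measurable bounded_rv_intros)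
    show "exp (h x) \<in> {exp (-B)..exp B}" if "x \<in> space (PiM I (\<lambda>_. M))" for x
      using B(2)[OF that] by auto
  qed (rule entropy_convex[OF M], auto)
qed

lemma efron_stein:
  assumes M: "prob_space M" and I: "finite I" and h: "bounded_rv (PiM I (\<lambda>_. M)) h"
  shows "phi_entropy (\<lambda>u. u\<^sup>2) (PiM I (\<lambda>_. M)) h
      \<le> (\<Sum>k\<in>I. \<integral>x. phi_entropy (\<lambda>u. u\<^sup>2) M (\<lambda>y. h (x(k := y))) \<partial>PiM I (\<lambda>_. M))"
proof -
  obtain B where B: "B > 0" "\<And>x. x \<in> space (PiM I (\<lambda>_. M)) \<Longrightarrow> \<bar>h x\<bar> \<le> B" using h by (metis bounded_rvE)
  show ?thesis
  proof (rule phi_entropy_tensorization[OF M I, where lo="-B" and hi=B and B="B\<^sup>2"])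
    show "\<bar>u\<^sup>2\<bar> \<le> B\<^sup>2" if "u \<in> {-B..B}" for u :: real
      using that by (simp add: abs_le_square_iff[symmetric] abs_le_iff) 
    show "h \<in> borel_measurable (PiM I (\<lambda>_. M))" using h by (intro bounded_rv_measurable)
    show "h x \<in> {-B..B}" if "x \<in> space (PiM I (\<lambda>_. M))" for x
      using B(2)[OF that] by auto
  qed (simp, rule variance_convex[OF M])
qed

section \<open>Entropy of a single coordinate\<close>

text \<open>The primitive of \<open>s / (1 - s b / 3)\<^sup>3\<close>. The entropy bound wants a primitive of \<open>s exp (s b)\<close>; this
  larger function is the one for which the Bernstein constants come out exactly.\<close>
definition variance_profile :: "real \<Rightarrow> real \<Rightarrow> real" where
  "variance_profile b s = (s\<^sup>2 / 2) / (1 - s * b / 3)\<^sup>2"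

lemma variance_profile_deriv:
  assumes "s * b < 3"
  shows "(variance_profile b has_real_derivative s / (1 - s * b / 3) ^ 3) (at s)"
proof -
  have p: "1 - s * b / 3 > 0" using assms by simp
  have "s / (1 - s * b / 3) ^ 3 = (s * (1 - s * b / 3)\<^sup>2 - (s\<^sup>2 / 2) * (2 * (1 - s * b / 3) * (- b / 3))) / ((1 - s * b / 3)\<^sup>2 * (1 - s * b / 3)\<^sup>2)"
  proof -
    define q where "q = 1 - s * b / 3"
    have "s * q\<^sup>2 - (s\<^sup>2 / 2) * (2 * q * (- b / 3)) = s * q\<^sup>2 + s * q * (s * b / 3)"
      by (simp add: power2_eq_square)
    also have "s * b / 3 = 1 - q" unfolding q_def by simp
    also have "s * q\<^sup>2 + s * q * (1 - q) = s * q" by (simp add: power2_eq_square algebra_simps)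
    finally show ?thesis
      unfolding q_def[symmetric] using p q_def by (simp add: power2_eq_square power3_eq_cube)
  qed
  moreover have d1: "((\<lambda>s. s\<^sup>2 / 2) has_real_derivative s) (at s)" by (auto intro!: derivative_eq_intros)
  have d2: "((\<lambda>s. (1 - s * b / 3)\<^sup>2) has_real_derivative 2 * (1 - s * b / 3) * (- b / 3)) (at s)"
    by (auto intro!: derivative_eq_intros)
  have "(variance_profile b has_real_derivative
     (s * (1 - s * b / 3)\<^sup>2 - (s\<^sup>2 / 2) * (2 * (1 - s * b / 3) * (- b / 3))) / ((1 - s * b / 3)\<^sup>2 * (1 - s * b / 3)\<^sup>2)) (at s)"
    unfolding variance_profile_def using DERIV_divide[OF d1 d2] p by simp
  ultimately show ?thesis by simp
qed

lemma exp_le_inverse_cube: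
  fixes u :: real assumes "u < 3"
  shows "exp u \<le> 1 / (1 - u / 3) ^ 3"
proof -
  have "1 - u / 3 \<le> exp (- (u / 3))" using exp_ge_add_one_self[of "-(u/3)"] by simp
  then have "(1 - u / 3) ^ 3 \<le> exp (- (u / 3)) ^ 3" using assms by (intro power_mono) auto
  also have "\<dots> = exp (- u)" by (simp add: exp_of_nat_mult[symmetric])
  finally have "(1 - u / 3) ^ 3 * exp u \<le> exp (-u) * exp u" by (intro mult_right_mono) auto
  then have "(1 - u / 3) ^ 3 * exp u \<le> 1" by (simp add: exp_minus)
  then show ?thesis using assms by (simp add: pos_le_divide_eq mult.commute)
qed

lemma exp_moment_center:
  assumes M: "prob_space M" "bounded_rv M h"
  shows "(\<integral>x. (h x - c)\<^sup>2 * exp (s * h x) \<partial>M) = exp_moment M h 2 s - 2 * c * exp_moment M h 1 s + c\<^sup>2 * exp_moment M h 0 s"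
proof -
  have "(\<integral>x. (h x - c)\<^sup>2 * exp (s * h x) \<partial>M)
      = (\<integral>x. h x ^ 2 * exp (s * h x) - 2 * c * (h x ^ 1 * exp (s * h x)) + c\<^sup>2 * (h x ^ 0 * exp (s * h x)) \<partial>M)"
    by (intro Bochner_Integration.integral_cong refl) (simp add: power2_eq_square algebra_simps)
  also have "\<dots> = exp_moment M h 2 s - 2 * c * exp_moment M h 1 s + c\<^sup>2 * exp_moment M h 0 s"
    unfolding exp_moment_def
    by (simp add: bounded_rv_integrable[OF M(1)] bounded_rv_intros M(2) del: power_0 power_one_right)
  finally show ?thesis .
qed

text \<open>Integrate \<open>(h - c)\<^sup>2 exp (s h)\<close> with \<open>c\<close> the tilted mean.\<close>
lemma tilted_variance_nonneg:
  assumes M: "prob_space M" "bounded_rv M h"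
  shows "(exp_moment M h 1 s)\<^sup>2 \<le> exp_moment M h 2 s * exp_moment M h 0 s"
proof -
  let ?m = "exp_moment M h" let ?c = "?m 1 s / ?m 0 s"
  have p: "?m 0 s > 0" by (rule exp_moment_0_pos[OF M])
  have "0 \<le> (\<integral>x. (h x - ?c)\<^sup>2 * exp (s * h x) \<partial>M)" by (intro integral_nonneg_AE) auto
  then have "0 \<le> (?m 2 s - 2 * ?c * ?m 1 s + ?c\<^sup>2 * ?m 0 s) * ?m 0 s"
    unfolding exp_moment_center[OF M] using p by simp
  also have "\<dots> = ?m 2 s * ?m 0 s - (?m 1 s)\<^sup>2" using p by (simp add: field_simps power2_eq_square)
  finally show ?thesis by simp
qed

text \<open>The tilted variance is at most the tilted second moment about the untilted mean \<open>c\<close>. There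
  \<open>h - c \<le> b\<close> bounds the density \<open>exp (s h)\<close> by \<open>exp (s b) exp (s c)\<close>, and by Jensen \<open>exp (s c)\<close> is at
  most the normalising constant.\<close>
lemma entropy_le_variance_of_bounded_above:
  assumes M: "prob_space M" "bounded_rv M h" and b: "b > 0" "\<And>x. x \<in> space M \<Longrightarrow> h x - (\<integral>x. h x \<partial>M) \<le> b"
    and \<beta>: "0 \<le> \<beta>" "\<beta> * b < 3"
  shows "phi_entropy xlnx M (\<lambda>x. exp (\<beta> * h x))
      \<le> variance_profile b \<beta> * phi_entropy (\<lambda>u. u\<^sup>2) M h * exp_moment M h 0 \<beta>"
proof (rule entropy_le_of_tilted_variance[OF M \<beta>(1), where Q'="\<lambda>s. s / (1 - s * b / 3) ^ 3 * phi_entropy (\<lambda>u. u\<^sup>2) M h"])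
  interpret prob_space M by fact
  let ?m = "exp_moment M h"
  define c where "c = (\<integral>x. h x \<partial>M)"
  define v where "v = (\<integral>x. (h x - c)\<^sup>2 \<partial>M)"
  note bI = bounded_rv_integrable[OF M(1)] and bi = bounded_rv_intros M(2)
  have v: "phi_entropy (\<lambda>u. u\<^sup>2) M h = v"
    unfolding phi_entropy_def v_def c_def by (rule variance_eq[symmetric]) (intro bI bi)+
  have v0: "v \<ge> 0" unfolding v_def by simp
  fix s assume s: "0 \<le> s" "s \<le> \<beta>"
  have sb: "s * b < 3" using s b \<beta> by (meson le_less_trans less_imp_le mult_right_mono)
  show "((\<lambda>s. variance_profile b s * phi_entropy (\<lambda>u. u\<^sup>2) M h) has_real_derivative
      s / (1 - s * b / 3) ^ 3 * phi_entropy (\<lambda>u. u\<^sup>2) M h) (at s)"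
    by (rule DERIV_cmult_right[OF variance_profile_deriv[OF sb]])
  have m0: "exp (s * c) \<le> ?m 0 s"
  proof -
    have "exp (s * c) = (\<integral>x. exp (s * c) * (1 + s * (h x - c)) \<partial>M)"
      by (simp add: bI bi c_def prob_space)
    also have "\<dots> \<le> (\<integral>x. exp (s * h x) \<partial>M)"
    proof (intro integral_mono bI bi)
      fix x
      have "exp (s * c) * (1 + s * (h x - c)) \<le> exp (s * c) * exp (s * (h x - c))"
        by (intro mult_left_mono exp_ge_add_one_self) auto
      then show "exp (s * c) * (1 + s * (h x - c)) \<le> exp (s * h x)"
        by (simp add: exp_add[symmetric] algebra_simps)
    qed
    finally show ?thesis unfolding exp_moment_def by simp
  qed
  have p: "?m 0 s > 0" by (rule exp_moment_0_pos[OF M])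
  have e: "exp (s * b) \<le> 1 / (1 - s * b / 3) ^ 3" by (rule exp_le_inverse_cube[OF sb])
  have "?m 2 s - 2 * c * ?m 1 s + c\<^sup>2 * ?m 0 s \<le> (\<integral>x. exp (s * (b + c)) * (h x - c)\<^sup>2 \<partial>M)"
    unfolding exp_moment_center[OF M, symmetric]
  proof (intro integral_mono bI bi)
    fix x assume x: "x \<in> space M"
    have "s * h x \<le> s * (b + c)" using b(2)[OF x] s unfolding c_def by (intro mult_left_mono) auto
    then show "(h x - c)\<^sup>2 * exp (s * h x) \<le> exp (s * (b + c)) * (h x - c)\<^sup>2"
      by (subst mult.commute) (intro mult_right_mono, auto)
  qed
  also have "\<dots> = exp (s * b) * v * exp (s * c)" unfolding v_def by (simp add: exp_add algebra_simps)
  also have "\<dots> \<le> (1 / (1 - s * b / 3) ^ 3) * v * ?m 0 s"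
    using v0 m0 e sb by (intro mult_mono) auto
  finally have k: "?m 2 s - 2 * c * ?m 1 s + c\<^sup>2 * ?m 0 s \<le> (1 / (1 - s * b / 3) ^ 3) * v * ?m 0 s" .
  have "?m 2 s * ?m 0 s - (?m 1 s)\<^sup>2 \<le> ?m 2 s * ?m 0 s - (?m 1 s)\<^sup>2 + (?m 1 s - c * ?m 0 s)\<^sup>2" by simp
  also have "\<dots> = (?m 2 s - 2 * c * ?m 1 s + c\<^sup>2 * ?m 0 s) * ?m 0 s"
    by (simp add: power2_eq_square algebra_simps)
  also have "\<dots> \<le> (1 / (1 - s * b / 3) ^ 3) * v * ?m 0 s * ?m 0 s"
    using k p by (intro mult_right_mono) auto
  finally have "s * (?m 2 s * ?m 0 s - (?m 1 s)\<^sup>2) \<le> s * ((1 / (1 - s * b / 3) ^ 3) * v * ?m 0 s * ?m 0 s)"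
    using s by (intro mult_left_mono) auto
  then show "s * (?m 2 s * ?m 0 s - (?m 1 s)\<^sup>2) \<le> s / (1 - s * b / 3) ^ 3 * phi_entropy (\<lambda>u. u\<^sup>2) M h * (?m 0 s)\<^sup>2"
    unfolding v by (simp add: power2_eq_square mult.assoc)
qed (simp add: variance_profile_def)

text \<open>Under every tilted measure the variance is half the mean of \<open>(h x - h y)\<^sup>2\<close> over independent \<open>x\<close> and
  \<open>y\<close>, hence at most \<open>2 \<rho>\<close> times the tilted mean of \<open>h\<close>. This mean increases with the tilt, so its
  value at the endpoint may be used throughout. Symmetrising here, instead of comparing \<open>h\<close> with its
  infimum, halves the constant; the sharper constant is what makes \<open>J\<close> match \<open>\<gamma>\<close> below.\<close>
lemma entropy_le_of_self_bounded:
  assumes M: "prob_space M" "bounded_rv M h"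
    and h: "\<And>x y. x \<in> space M \<Longrightarrow> y \<in> space M \<Longrightarrow> (h x - h y)\<^sup>2 \<le> \<rho> * (2 * h x + 2 * h y)"
    and "\<rho> \<ge> 0" and "\<kappa> \<ge> 0"
  shows "phi_entropy xlnx M (\<lambda>x. exp (\<kappa> * h x)) \<le> \<kappa>\<^sup>2 * \<rho> * exp_moment M h 1 \<kappa>"
proof -
  let ?m = "exp_moment M h"
  note bI = bounded_rv_integrable[OF M(1)] and bi = bounded_rv_intros M(2)
  have pos: "?m 0 s > 0" for s by (rule exp_moment_0_pos[OF M])
  have tv: "?m 2 s * ?m 0 s - (?m 1 s)\<^sup>2 \<le> 2 * \<rho> * ?m 1 s * ?m 0 s" for s
  proof -
    have a: "?m 2 s - 2 * h y * ?m 1 s + (h y)\<^sup>2 * ?m 0 s \<le> 2 * \<rho> * (?m 1 s + h y * ?m 0 s)"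
      if y: "y \<in> space M" for y
    proof -
      have "(\<integral>x. (h x - h y)\<^sup>2 * exp (s * h x) \<partial>M) \<le> (\<integral>x. 2 * \<rho> * (h x ^ 1 * exp (s * h x) + h y * (h x ^ 0 * exp (s * h x))) \<partial>M)"
      proof (intro integral_mono bI bi)
        fix x assume x: "x \<in> space M"
        show "(h x - h y)\<^sup>2 * exp (s * h x) \<le> 2 * \<rho> * (h x ^ 1 * exp (s * h x) + h y * (h x ^ 0 * exp (s * h x)))"
          using mult_right_mono[OF h[OF x y], of "exp (s * h x)"] by (simp add: algebra_simps)
      qed
      also have "\<dots> = 2 * \<rho> * (?m 1 s + h y * ?m 0 s)"
        unfolding exp_moment_def by (simp add: bI bi del: power_0 power_one_right)
      finally show ?thesis unfolding exp_moment_center[OF M] .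
    qed
    have "2 * ?m 2 s * ?m 0 s - 2 * (?m 1 s)\<^sup>2
        = (\<integral>y. ?m 2 s * (h y ^ 0 * exp (s * h y)) - 2 * ?m 1 s * (h y ^ 1 * exp (s * h y)) + ?m 0 s * (h y ^ 2 * exp (s * h y)) \<partial>M)"
      unfolding exp_moment_def by (simp add: bI bi power2_eq_square del: power_0 power_one_right)
    also have "\<dots> \<le> (\<integral>y. 2 * \<rho> * (?m 1 s * (h y ^ 0 * exp (s * h y)) + ?m 0 s * (h y ^ 1 * exp (s * h y))) \<partial>M)"
    proof (intro integral_mono bI bi)
      fix y assume y: "y \<in> space M"
      show "?m 2 s * (h y ^ 0 * exp (s * h y)) - 2 * ?m 1 s * (h y ^ 1 * exp (s * h y)) + ?m 0 s * (h y ^ 2 * exp (s * h y))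
          \<le> 2 * \<rho> * (?m 1 s * (h y ^ 0 * exp (s * h y)) + ?m 0 s * (h y ^ 1 * exp (s * h y)))"
        using mult_right_mono[OF a[OF y], of "exp (s * h y)"] by (simp add: algebra_simps)
    qed
    also have "\<dots> = 2 * \<rho> * (?m 1 s * ?m 0 s + ?m 0 s * ?m 1 s)"
      unfolding exp_moment_def by (simp add: bI bi del: power_0 power_one_right)
    finally show ?thesis by (simp add: algebra_simps)
  qed
  have "phi_entropy xlnx M (\<lambda>x. exp (\<kappa> * h x)) \<le> (\<kappa>\<^sup>2 * \<rho> * (?m 1 \<kappa> / ?m 0 \<kappa>)) * ?m 0 \<kappa>"
  proof (rule entropy_le_of_tilted_variance[OF M \<open>\<kappa> \<ge> 0\<close>, where Q = "\<lambda>s. s\<^sup>2 * \<rho> * (?m 1 s / ?m 0 s)"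
      and Q'="\<lambda>s. 2 * s * \<rho> * (?m 1 s / ?m 0 s) + s\<^sup>2 * \<rho> * ((?m 2 s * ?m 0 s - ?m 1 s * ?m 1 s) / (?m 0 s * ?m 0 s))"])
    fix s assume s: "0 \<le> s" "s \<le> \<kappa>"
    have D: "((\<lambda>s. ?m 1 s / ?m 0 s) has_real_derivative (?m 2 s * ?m 0 s - ?m 1 s * ?m 1 s) / (?m 0 s * ?m 0 s)) (at s)"
      using DERIV_divide[OF exp_moment_deriv[OF M, of 1 s] exp_moment_deriv[OF M, of 0 s]] pos[of s]
      by (simp add: numeral_2_eq_2)
    have E: "((\<lambda>s. s\<^sup>2 * \<rho>) has_real_derivative 2 * s * \<rho>) (at s)" by (auto intro!: derivative_eq_intros)
    show "((\<lambda>s. s\<^sup>2 * \<rho> * (?m 1 s / ?m 0 s)) has_real_derivative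
        2 * s * \<rho> * (?m 1 s / ?m 0 s) + s\<^sup>2 * \<rho> * ((?m 2 s * ?m 0 s - ?m 1 s * ?m 1 s) / (?m 0 s * ?m 0 s))) (at s)"
      using DERIV_mult[OF E D] by (simp add: mult_ac)
    have "s * (?m 2 s * ?m 0 s - (?m 1 s)\<^sup>2) \<le> s * (2 * \<rho> * ?m 1 s * ?m 0 s)"
      using s tv by (intro mult_left_mono)
    also have "\<dots> = 2 * s * \<rho> * (?m 1 s / ?m 0 s) * (?m 0 s)\<^sup>2"
      using pos[of s] by (simp add: field_simps power2_eq_square)
    also have "\<dots> \<le> (2 * s * \<rho> * (?m 1 s / ?m 0 s) + s\<^sup>2 * \<rho> * ((?m 2 s * ?m 0 s - ?m 1 s * ?m 1 s) / (?m 0 s * ?m 0 s))) * (?m 0 s)\<^sup>2"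
      using \<open>\<rho> \<ge> 0\<close> pos[of s] tilted_variance_nonneg[OF M, of s]
      by (intro mult_right_mono) (auto simp: power2_eq_square)
    finally show "s * (?m 2 s * ?m 0 s - (?m 1 s)\<^sup>2) \<le> (2 * s * \<rho> * (?m 1 s / ?m 0 s) + s\<^sup>2 * \<rho> * ((?m 2 s * ?m 0 s - ?m 1 s * ?m 1 s) / (?m 0 s * ?m 0 s))) * (?m 0 s)\<^sup>2" .
  qed simp
  then show ?thesis using pos[of \<kappa>] by simp
qed

section \<open>From entropy bounds to exponential moments\<close>

lemma le_right_limit_of_deriv_nonpos:
  fixes F :: "real \<Rightarrow> real"
  assumes "B > 0" and d: "\<And>s. 0 < s \<Longrightarrow> s \<le> B \<Longrightarrow> \<exists>D. (F has_real_derivative D) (at s) \<and> D \<le> 0"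
    and lim: "(F \<longlongrightarrow> L) (at_right 0)"
  shows "F B \<le> L"
proof (rule tendsto_lowerbound[OF lim])
  show "\<forall>\<^sub>F s in at_right 0. F B \<le> F s"
    unfolding eventually_at_right[OF \<open>B > 0\<close>]
  proof (intro exI[of _ B] conjI allI impI \<open>B > 0\<close>)
    fix s assume "0 < s" "s < B"
    then show "F B \<le> F s" using d by (intro DERIV_nonpos_imp_nonincreasing[of s B F]) auto
  qed
qed simp

lemma log_mgf_over_tendsto:
  assumes M: "prob_space M" "bounded_rv M h"
  shows "((\<lambda>s. ln (exp_moment M h 0 s) / s) \<longlongrightarrow> (\<integral>x. h x \<partial>M)) (at_right 0)"
proof -
  interpret prob_space M by fact
  have 0: "exp_moment M h 0 0 = 1" unfolding exp_moment_def by (simp add: prob_space)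
  have "((\<lambda>s. ln (exp_moment M h 0 s)) has_real_derivative (\<integral>x. h x \<partial>M)) (at 0)"
    using log_mgf_deriv[OF M, of 0] 0 by (simp add: exp_moment_def[of M h "Suc 0"])
  then have "((\<lambda>s. ln (exp_moment M h 0 s) / s) \<longlongrightarrow> (\<integral>x. h x \<partial>M)) (at 0)"
    unfolding DERIV_def using 0 by simp
  then show ?thesis by (rule filterlim_mono) (auto simp: at_le)
qed

lemma log_mgf_over_deriv:
  assumes M: "prob_space M" "bounded_rv M h" and s: "s > 0"
  shows "((\<lambda>s. ln (exp_moment M h 0 s) / s) has_real_derivative
     phi_entropy xlnx M (\<lambda>x. exp (s * h x)) / (s\<^sup>2 * exp_moment M h 0 s)) (at s)"
proof -
  have p: "exp_moment M h 0 s > 0" by (rule exp_moment_0_pos[OF M])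
  have "phi_entropy xlnx M (\<lambda>x. exp (s * h x)) / (s\<^sup>2 * exp_moment M h 0 s)
     = (exp_moment M h 1 s / exp_moment M h 0 s * s - ln (exp_moment M h 0 s) * 1) / (s * s)"
    unfolding phi_entropy_exp using p s by (simp add: field_simps power2_eq_square)
  then show ?thesis using DERIV_divide[OF log_mgf_deriv[OF M, of s] DERIV_ident] s by simp
qed

text \<open>In terms of \<open>L(s) = ln E exp (s h)\<close> the hypothesis says \<open>(L(s) / s)' \<le> (a / 2) L'(s)\<close>, so
  \<open>L(s) / s - (a / 2) L(s)\<close> decreases from its limit \<open>E h\<close> at \<open>0\<close>.\<close>
lemma log_mgf_self_bounded:
  assumes M: "prob_space M" "bounded_rv M h"
    and ent: "\<And>s. 0 < s \<Longrightarrow> s \<le> \<kappa> \<Longrightarrow> phi_entropy xlnx M (\<lambda>x. exp (s * h x)) \<le> (s\<^sup>2 * a / 2) * exp_moment M h 1 s"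
    and \<kappa>: "\<kappa> > 0" "a * \<kappa> < 2"
  shows "ln (exp_moment M h 0 \<kappa>) \<le> \<kappa> * (\<integral>x. h x \<partial>M) / (1 - a * \<kappa> / 2)"
proof -
  interpret prob_space M by fact
  let ?G = "\<lambda>s. ln (exp_moment M h 0 s)"
  have 0: "exp_moment M h 0 0 = 1" unfolding exp_moment_def by (simp add: prob_space)
  have "?G \<kappa> / \<kappa> - (a / 2) * ?G \<kappa> \<le> (\<integral>x. h x \<partial>M) - (a / 2) * ?G 0"
  proof (rule le_right_limit_of_deriv_nonpos[OF \<kappa>(1), where F="\<lambda>s. ?G s / s - (a / 2) * ?G s"])
    fix s assume s: "0 < s" "s \<le> \<kappa>"
    have p: "exp_moment M h 0 s > 0" by (rule exp_moment_0_pos[OF M])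
    have "((\<lambda>s. ?G s / s - (a / 2) * ?G s) has_real_derivative
      phi_entropy xlnx M (\<lambda>x. exp (s * h x)) / (s\<^sup>2 * exp_moment M h 0 s) - (a / 2) * (exp_moment M h 1 s / exp_moment M h 0 s)) (at s)"
      by (intro DERIV_diff DERIV_cmult log_mgf_over_deriv M s log_mgf_deriv)
    moreover have "phi_entropy xlnx M (\<lambda>x. exp (s * h x)) / (s\<^sup>2 * exp_moment M h 0 s) - (a / 2) * (exp_moment M h 1 s / exp_moment M h 0 s) \<le> 0"
      using ent[OF s] s p by (simp add: field_simps)
    ultimately show "\<exists>D. ((\<lambda>s. ?G s / s - (a / 2) * ?G s) has_real_derivative D) (at s) \<and> D \<le> 0" by blast
  next
    have "(?G \<longlongrightarrow> ?G 0) (at_right 0)"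
      using DERIV_isCont[OF log_mgf_deriv[OF M, of 0]] unfolding isCont_def by (rule filterlim_mono) (auto simp: at_le)
    then show "((\<lambda>s. ?G s / s - (a / 2) * ?G s) \<longlongrightarrow> (\<integral>x. h x \<partial>M) - (a / 2) * ?G 0) (at_right 0)"
      by (intro tendsto_diff log_mgf_over_tendsto M tendsto_mult tendsto_const)
  qed
  then have "?G \<kappa> / \<kappa> - (a / 2) * ?G \<kappa> \<le> (\<integral>x. h x \<partial>M)" using 0 by simp
  then show ?thesis using \<kappa> by (simp add: field_simps)
qed

text \<open>The same argument for the difference of \<open>L(s) / s\<close> and \<open>(V / 2) s / (1 - c s)\<close>: the latter has
  derivative \<open>(V / 2) / (1 - c s)\<^sup>2\<close>.\<close>
lemma log_mgf_bernstein:
  assumes M: "prob_space M" "bounded_rv M h"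
    and ent: "\<And>s. 0 < s \<Longrightarrow> s \<le> \<beta> \<Longrightarrow>
       phi_entropy xlnx M (\<lambda>x. exp (s * h x)) \<le> ((s\<^sup>2 / 2) * V / (1 - c * s)\<^sup>2) * exp_moment M h 0 s"
    and \<beta>: "\<beta> > 0" "c * \<beta> < 1" and c: "c \<ge> 0"
  shows "ln (exp_moment M h 0 \<beta>) \<le> \<beta> * (\<integral>x. h x \<partial>M) + \<beta>\<^sup>2 * V / (2 * (1 - c * \<beta>))"
proof -
  let ?G = "\<lambda>s. ln (exp_moment M h 0 s)"
  have "?G \<beta> / \<beta> - (V / 2) * (\<beta> / (1 - c * \<beta>)) \<le> (\<integral>x. h x \<partial>M) - (V / 2) * (0 / (1 - c * 0))"
  proof (rule le_right_limit_of_deriv_nonpos[OF \<beta>(1), where F="\<lambda>s. ?G s / s - (V / 2) * (s / (1 - c * s))"])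
    fix s assume s: "0 < s" "s \<le> \<beta>"
    have cs: "1 - c * s > 0" using s \<beta> c mult_left_mono[of s \<beta> c] by simp
    have p: "exp_moment M h 0 s > 0" by (rule exp_moment_0_pos[OF M])
    have D: "((\<lambda>s. s / (1 - c * s)) has_real_derivative 1 / (1 - c * s)\<^sup>2) (at s)"
      using cs by (auto intro!: derivative_eq_intros simp: power2_eq_square field_simps)
    have "((\<lambda>s. ?G s / s - (V / 2) * (s / (1 - c * s))) has_real_derivative
      phi_entropy xlnx M (\<lambda>x. exp (s * h x)) / (s\<^sup>2 * exp_moment M h 0 s) - (V / 2) * (1 / (1 - c * s)\<^sup>2)) (at s)"
      by (intro DERIV_diff DERIV_cmult log_mgf_over_deriv M s D)
    moreover have "phi_entropy xlnx M (\<lambda>x. exp (s * h x)) / (s\<^sup>2 * exp_moment M h 0 s) \<le> (V / 2) * (1 / (1 - c * s)\<^sup>2)"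
    proof -
      have "phi_entropy xlnx M (\<lambda>x. exp (s * h x)) / (s\<^sup>2 * exp_moment M h 0 s)
          \<le> (((s\<^sup>2 / 2) * V / (1 - c * s)\<^sup>2) * exp_moment M h 0 s) / (s\<^sup>2 * exp_moment M h 0 s)"
        using s p by (intro divide_right_mono ent) auto
      also have "\<dots> = (V / 2) * (1 / (1 - c * s)\<^sup>2)" using s p by simp
      finally show ?thesis .
    qed
    ultimately show "\<exists>D. ((\<lambda>s. ?G s / s - (V / 2) * (s / (1 - c * s))) has_real_derivative D) (at s) \<and> D \<le> 0" by force
  next
    show "((\<lambda>s. ?G s / s - (V / 2) * (s / (1 - c * s))) \<longlongrightarrow> (\<integral>x. h x \<partial>M) - (V / 2) * (0 / (1 - c * 0))) (at_right 0)"
      by (intro tendsto_diff log_mgf_over_tendsto M tendsto_mult tendsto_const tendsto_divide tendsto_ident_at) simp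
  qed
  then have "?G \<beta> / \<beta> \<le> (\<integral>x. h x \<partial>M) + (V / 2) * (\<beta> / (1 - c * \<beta>))" by simp
  then have "?G \<beta> / \<beta> * \<beta> \<le> ((\<integral>x. h x \<partial>M) + (V / 2) * (\<beta> / (1 - c * \<beta>))) * \<beta>" using \<beta>(1) by (intro mult_right_mono) auto
  then show ?thesis using \<beta> by (simp add: algebra_simps power2_eq_square)
qed

lemma bernstein_tail_of_log_mgf:
  assumes M: "prob_space M" "bounded_rv M h"
    and mgf: "\<And>\<beta>. 0 < \<beta> \<Longrightarrow> c * \<beta> < 1 \<Longrightarrow>
       ln (exp_moment M h 0 \<beta>) \<le> \<beta> * (\<integral>x. h x \<partial>M) + \<beta>\<^sup>2 * V / (2 * (1 - c * \<beta>))"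
    and V: "V > 0" and c: "c \<ge> 0" and t: "t > 0"
  shows "measure M {x \<in> space M. h x - (\<integral>x. h x \<partial>M) > t} \<le> exp (- t\<^sup>2 / (2 * (V + c * t)))"
proof -
  interpret prob_space M by fact
  let ?e = "\<integral>x. h x \<partial>M"
  define W where "W = V + c * t"
  \<comment> \<open>The choice \<open>\<beta> = t / (V + c t)\<close> makes \<open>1 - c \<beta> = V / (V + c t)\<close>; this is where \<open>V > 0\<close> enters.\<close>
  have W: "W > 0" unfolding W_def using V c t by (simp add: add_pos_nonneg)
  define \<beta> where "\<beta> = t / W"
  have \<beta>: "\<beta> > 0" unfolding \<beta>_def using t W by simp
  have cb: "1 - c * \<beta> = V / W" unfolding \<beta>_def using W by (simp add: field_simps W_def)
  have cb1: "c * \<beta> < 1" using cb V W by (metis divide_pos_pos diff_gt_0_iff_gt)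
  have "measure M {x \<in> space M. h x - ?e > t} \<le> measure M {x \<in> space M. h x \<ge> ?e + t}"
    using bounded_rv_measurable[OF M(2)] by (intro finite_measure_mono) auto
  also have "\<dots> \<le> exp (- \<beta> * (?e + t)) * (\<integral>x\<in>space M. exp (\<beta> * h x) \<partial>M)"
    by (intro Chernoff_ineq_ge \<beta> sets.top)
      (unfold set_integrable_def, intro integrable_mult_indicator sets.top bounded_rv_integrable[OF M(1)] bounded_rv_intros M)
  also have "(\<integral>x\<in>space M. exp (\<beta> * h x) \<partial>M) = (\<integral>x. exp (\<beta> * h x) \<partial>M)"
    by (intro set_integral_space bounded_rv_integrable[OF M(1)] bounded_rv_intros M)
  also have "exp (- \<beta> * (?e + t)) * (\<integral>x. exp (\<beta> * h x) \<partial>M) = (\<integral>x. exp (\<beta> * h x) \<partial>M) / exp (\<beta> * (?e + t))"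
    by (simp only: mult_minus_left exp_minus divide_inverse mult.commute)
  also have "(\<integral>x. exp (\<beta> * h x) \<partial>M) = exp (ln (exp_moment M h 0 \<beta>))"
    using exp_moment_0_pos[OF M, of \<beta>] by (simp add: exp_moment_def)
  also have "exp (ln (exp_moment M h 0 \<beta>)) / exp (\<beta> * (?e + t)) = exp (ln (exp_moment M h 0 \<beta>) - \<beta> * (?e + t))"
    by (simp add: exp_diff)
  also have "\<dots> \<le> exp (\<beta>\<^sup>2 * V / (2 * (1 - c * \<beta>)) - \<beta> * t)"
    using mgf[OF \<beta> cb1] by (simp add: algebra_simps)
  also have "\<beta>\<^sup>2 * V / (2 * (1 - c * \<beta>)) - \<beta> * t = - t\<^sup>2 / (2 * (V + c * t))"
    unfolding cb W_def[symmetric] using W V by (simp add: \<beta>_def field_simps power2_eq_square)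
  finally show ?thesis .
qed

section \<open>Concentration for functions of bounded interaction\<close>

definition coord_variance :: "'a measure \<Rightarrow> 'i \<Rightarrow> (('i \<Rightarrow> 'a) \<Rightarrow> real) \<Rightarrow> ('i \<Rightarrow> 'a) \<Rightarrow> real" where
  "coord_variance M k f x = (\<integral>w. (f (x(k := fst w)) - f (x(k := snd w)))\<^sup>2 \<partial>(M \<Otimes>\<^sub>M M)) / 2"

definition variance_sum :: "'a measure \<Rightarrow> 'i set \<Rightarrow> (('i \<Rightarrow> 'a) \<Rightarrow> real) \<Rightarrow> ('i \<Rightarrow> 'a) \<Rightarrow> real" where
  "variance_sum M I f x = (\<Sum>k\<in>I. coord_variance M k f x)"

lemma variance_eq_half_square_diff:
  assumes M: "prob_space M" and h: "bounded_rv M h"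
  shows "(\<integral>w. (h (fst w) - h (snd w))\<^sup>2 \<partial>(M \<Otimes>\<^sub>M M)) / 2 = phi_entropy (\<lambda>u. u\<^sup>2) M h"
proof -
  interpret prob_space M by fact
  note bI = bounded_rv_integrable[OF M] and bi = bounded_rv_intros h
  have b: "bounded_rv (M \<Otimes>\<^sub>M M) (\<lambda>(y, z). (h y - h z)\<^sup>2)"
    using bounded_rv_compose[OF h measurable_fst] bounded_rv_compose[OF h measurable_snd]
    by (auto simp add: case_prod_unfold intro!: bounded_rv_intros)
  have "(\<integral>w. (h (fst w) - h (snd w))\<^sup>2 \<partial>(M \<Otimes>\<^sub>M M)) = (\<integral>y. (\<integral>z. (h y - h z)\<^sup>2 \<partial>M) \<partial>M)"
    by (rule bounded_rv_fubini(2)[OF M M b, symmetric])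
  also have "\<dots> = (\<integral>y. (\<integral>z. (h y)\<^sup>2 - 2 * h y * h z + (h z)\<^sup>2 \<partial>M) \<partial>M)"
    by (simp add: power2_diff algebra_simps)
  also have "\<dots> = (\<integral>y. (h y)\<^sup>2 - 2 * h y * (\<integral>z. h z \<partial>M) + (\<integral>z. (h z)\<^sup>2 \<partial>M) \<partial>M)"
    by (simp add: bI bi prob_space)
  also have "\<dots> = (\<integral>z. (h z)\<^sup>2 \<partial>M) - 2 * (\<integral>z. h z \<partial>M) * (\<integral>z. h z \<partial>M) + (\<integral>z. (h z)\<^sup>2 \<partial>M)"
    by (simp add: bI bi prob_space)
  finally show ?thesis unfolding phi_entropy_def by (simp add: power2_eq_square)
qed

text \<open>Cauchy--Schwarz in the form of a discriminant. It applies to a mixture of a sum and integrals without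
  packaging the two into one inner product.\<close>
lemma square_le_of_quadratic_nonneg:
  fixes R D Q :: real
  assumes "\<And>\<tau>. 0 \<le> \<tau>\<^sup>2 * R - 2 * \<tau> * D + Q" "0 \<le> R"
  shows "D\<^sup>2 \<le> R * Q"
proof (cases "R = 0")
  case True
  have "D = 0"
  proof (rule ccontr)
    assume "D \<noteq> 0"
    then show False using assms(1)[of "(Q + 1) / (2 * D)"] True by simp
  qed
  then show ?thesis using True by simp
next
  case False
  then have "R > 0" using assms(2) by simp
  have "0 \<le> ((D / R)\<^sup>2 * R - 2 * (D / R) * D + Q) * R" using assms(1)[of "D / R"] \<open>R > 0\<close> by simp
  also have "\<dots> = R * Q - D\<^sup>2" using \<open>R > 0\<close> by (simp add: field_simps power2_eq_square)
  finally show ?thesis by simp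
qed

locale product_function = prob_space M for M :: "'a measure" +
  fixes I :: "'i set" and f :: "('i \<Rightarrow> 'a) \<Rightarrow> real"
  assumes finite_I: "finite I" and bounded_f: "bounded_rv (PiM I (\<lambda>_. M)) f"
begin

abbreviation P where "P \<equiv> PiM I (\<lambda>_. M)"

abbreviation MM where "MM \<equiv> M \<Otimes>\<^sub>M M"

lemma prob_M: "prob_space M" by (rule prob_space_axioms)
lemma prob_P: "prob_space P" by (intro prob_space_PiM prob_M)
lemma prob_pair: "prob_space MM" by (intro prob_space_pair prob_M)

lemma bounded_rv_upd:
  assumes "bounded_rv P g" "k \<in> I" "u \<in> measurable N P" "v \<in> measurable N M"
  shows "bounded_rv N (\<lambda>x. g ((u x)(k := v x)))"
  by (rule bounded_rv_compose[OF assms(1) measurable_upd[OF assms(2-4)]])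

lemma bounded_section:
  assumes "bounded_rv P g" "k \<in> I" "x \<in> space P" shows "bounded_rv M (\<lambda>y. g (x(k := y)))"
  using assms by (intro bounded_rv_upd) auto

lemma coord_variance_nonneg: "0 \<le> coord_variance M k f x"
  unfolding coord_variance_def by (intro divide_nonneg_nonneg integral_nonneg_AE) auto

lemma variance_sum_nonneg: "0 \<le> variance_sum M I f x"
  unfolding variance_sum_def by (intro sum_nonneg coord_variance_nonneg)

lemma bounded_coord_variance:
  assumes g: "bounded_rv P g" and k: "k \<in> I" shows "bounded_rv P (coord_variance M k g)"
proof -
  have "bounded_rv (P \<Otimes>\<^sub>M MM) (\<lambda>z. (g ((fst z)(k := fst (snd z))) - g ((fst z)(k := snd (snd z))))\<^sup>2)"
    using k by (intro bounded_rv_intros bounded_rv_upd g) auto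
  then have "bounded_rv P (\<lambda>x. (\<integral>w. (g (x(k := fst w)) - g (x(k := snd w)))\<^sup>2 \<partial>MM))"
    by (intro bounded_rv_integral prob_pair) (simp add: case_prod_unfold)
  then show ?thesis unfolding coord_variance_def[abs_def]
    using bounded_rv_mult[OF _ bounded_rv_const[of _ "1/2"]] by fastforce
qed

lemma bounded_variance_sum: "bounded_rv P (variance_sum M I f)"
  unfolding variance_sum_def[abs_def] by (intro bounded_rv_sum bounded_coord_variance bounded_f)

lemma coord_variance_eq:
  assumes "bounded_rv P g" "k \<in> I" "x \<in> space P"
  shows "coord_variance M k g x = phi_entropy (\<lambda>u. u\<^sup>2) M (\<lambda>y. g (x(k := y)))"
  unfolding coord_variance_def using variance_eq_half_square_diff[OF prob_M bounded_section[OF assms]] by simp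

lemma coord_variance_upd_same: "coord_variance M k g (x(k := y)) = coord_variance M k g x"
  unfolding coord_variance_def by simp

lemma bounded_section_entropy:
  assumes h: "bounded_rv P h" and k: "k \<in> I"
  shows "bounded_rv P (\<lambda>x. phi_entropy xlnx M (\<lambda>y. exp (h (x(k := y)))))"
proof -
  obtain B where B: "B > 0" "\<And>x. x \<in> space P \<Longrightarrow> \<bar>h x\<bar> \<le> B" using h by (metis bounded_rvE)
  let ?Z = "\<lambda>x. \<integral>y. exp (h (x(k := y))) \<partial>M"
  have bu: "bounded_rv (P \<Otimes>\<^sub>M M) (\<lambda>z. h ((fst z)(k := snd z)))"
    by (intro bounded_rv_upd h k) auto
  have bZ: "bounded_rv P ?Z"
    using bounded_rv_exp[OF bu] by (intro bounded_rv_integral[OF prob_M]) (simp add: case_prod_unfold)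
  have bX: "bounded_rv P (\<lambda>x. \<integral>y. exp (h (x(k := y))) * h (x(k := y)) \<partial>M)"
    using bounded_rv_mult[OF bounded_rv_exp[OF bu] bu] by (intro bounded_rv_integral[OF prob_M]) (simp add: case_prod_unfold)
  have Z: "?Z x \<in> {exp (-B)..exp B}" if x: "x \<in> space P" for x
  proof (rule integral_between[OF prob_M bounded_rv_measurable[OF bounded_rv_exp[OF bounded_section[OF h k x]]]])
    fix y assume "y \<in> space M"
    then have "\<bar>h (x(k := y))\<bar> \<le> B" by (intro B(2) space_PiM_upd x k)
    then show "exp (h (x(k := y))) \<in> {exp (-B)..exp B}" by auto
  qed
  have "bounded_rv P (\<lambda>x. ln (?Z x))"
    using ln_between[OF _ Z]
    by (intro bounded_rv_between[where lo="ln (exp (-B))" and hi="ln (exp B)"] borel_measurable_ln bounded_rv_measurable[OF bZ]) auto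
  then show ?thesis unfolding phi_entropy_def by (simp add: bounded_rv_intros bX bZ)
qed

text \<open>
  In coordinate \<open>k\<close> the entropy is at most \<open>variance_profile b s * V\<^sub>k f\<close> times the integral of
  \<open>exp (s f)\<close> over that coordinate. As \<open>V\<^sub>k f\<close> is constant in coordinate \<open>k\<close>, it moves under this
  integral, and resampling turns the mean of the result into \<open>E[exp (s f) V\<^sub>k f]\<close>.
\<close>
lemma entropy_exp_le:
  assumes b: "b > 0" "\<And>x k. x \<in> space P \<Longrightarrow> k \<in> I \<Longrightarrow> f x - (\<integral>y. f (x(k := y)) \<partial>M) \<le> b"
    and s: "0 \<le> s" "s * b < 3"
  shows "phi_entropy xlnx P (\<lambda>x. exp (s * f x)) \<le> variance_profile b s * (\<integral>x. exp (s * f x) * variance_sum M I f x \<partial>P)"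
proof -
  note bI = bounded_rv_integrable[OF prob_P] and bi = bounded_rv_intros bounded_f
  have vk: "(\<integral>x. phi_entropy xlnx M (\<lambda>y. exp (s * f (x(k := y)))) \<partial>P)
      \<le> variance_profile b s * (\<integral>x. exp (s * f x) * coord_variance M k f x \<partial>P)" if k: "k \<in> I" for k
  proof -
    note bc = bounded_coord_variance[OF bounded_f k]
    have b1: "bounded_rv P (\<lambda>x. exp (s * f x) * coord_variance M k f x)" by (intro bi bc)
    have b2: "bounded_rv P (\<lambda>x. (\<integral>y. exp (s * f (x(k := y))) * coord_variance M k f (x(k := y)) \<partial>M))"
      using bounded_rv_upd[OF b1 k, of fst "P \<Otimes>\<^sub>M M" snd]
      by (intro bounded_rv_integral[OF prob_M]) (simp add: case_prod_unfold)
    have "(\<integral>x. phi_entropy xlnx M (\<lambda>y. exp (s * f (x(k := y)))) \<partial>P)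
       \<le> (\<integral>x. variance_profile b s * (\<integral>y. exp (s * f (x(k := y))) * coord_variance M k f (x(k := y)) \<partial>M) \<partial>P)"
    proof (rule integral_mono)
      show "integrable P (\<lambda>x. variance_profile b s * (\<integral>y. exp (s * f (x(k := y))) * coord_variance M k f (x(k := y)) \<partial>M))"
        by (intro bI bounded_rv_mult bounded_rv_const b2)
      show "integrable P (\<lambda>x. phi_entropy xlnx M (\<lambda>y. exp (s * f (x(k := y)))))"
        by (intro bI bounded_section_entropy k bi)
      show "phi_entropy xlnx M (\<lambda>y. exp (s * f (x(k := y))))
          \<le> variance_profile b s * (\<integral>y. exp (s * f (x(k := y))) * coord_variance M k f (x(k := y)) \<partial>M)"
        if x: "x \<in> space P" for x
      proof -
        have "phi_entropy xlnx M (\<lambda>y. exp (s * f (x(k := y))))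
           \<le> variance_profile b s * phi_entropy (\<lambda>u. u\<^sup>2) M (\<lambda>y. f (x(k := y))) * exp_moment M (\<lambda>y. f (x(k := y))) 0 s"
        proof (rule entropy_le_variance_of_bounded_above[OF prob_M bounded_section[OF bounded_f k x] b(1) _ s])
          fix y assume "y \<in> space M"
          then show "f (x(k := y)) - (\<integral>y. f (x(k := y)) \<partial>M) \<le> b"
            using b(2)[OF space_PiM_upd[OF x _ k] k, of y] by simp
        qed
        then show ?thesis unfolding coord_variance_upd_same coord_variance_eq[OF bounded_f k x, symmetric]
          by (simp add: exp_moment_def mult_ac)
      qed
    qed
    also have "\<dots> = variance_profile b s * (\<integral>x. exp (s * f x) * coord_variance M k f x \<partial>P)"
      using integral_PiM_resample[OF prob_M finite_I k b1] by simp
    finally show ?thesis .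
  qed
  have "phi_entropy xlnx P (\<lambda>x. exp (s * f x)) \<le> (\<Sum>k\<in>I. \<integral>x. phi_entropy xlnx M (\<lambda>y. exp (s * f (x(k := y)))) \<partial>P)"
    by (intro entropy_tensorization[OF prob_M finite_I] bi)
  also have "\<dots> \<le> (\<Sum>k\<in>I. variance_profile b s * (\<integral>x. exp (s * f x) * coord_variance M k f x \<partial>P))"
    by (intro sum_mono vk)
  also have "\<dots> = variance_profile b s * (\<integral>x. exp (s * f x) * variance_sum M I f x \<partial>P)"
    unfolding variance_sum_def sum_distrib_left[symmetric]
    by (subst Bochner_Integration.integral_sum[symmetric]) (auto simp: sum_distrib_left intro!: bI bi bounded_coord_variance)
  finally show ?thesis .
qed

text \<open>Let \<open>A\<close> and \<open>B\<close> be the families of first differences of \<open>f\<close> at \<open>x(l := y)\<close> and \<open>x(l := y')\<close>. With the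
  norm \<open>|A|\<^sup>2 = S\<close>, the difference of the two values of \<open>S\<close> is \<open>\<langle>A - B, A + B\<rangle>\<close>, and
  \<open>|A + B|\<^sup>2 \<le> 2 |A|\<^sup>2 + 2 |B|\<^sup>2\<close>. The squared norm \<open>R\<close> of \<open>A - B\<close> consists of second differences; it is
  the variance sum of the first difference of \<open>f\<close> in coordinate \<open>l\<close>.\<close>
lemma variance_sum_self_bounded:
  assumes \<rho>: "variance_sum M I (\<lambda>x. f (x(l := y)) - f (x(l := y'))) x \<le> \<rho>"
    and l: "l \<in> I" and x: "x \<in> space P" and y: "y \<in> space M" "y' \<in> space M"
  shows "(variance_sum M I f (x(l := y)) - variance_sum M I f (x(l := y')))\<^sup>2
     \<le> \<rho> * (2 * variance_sum M I f (x(l := y)) + 2 * variance_sum M I f (x(l := y')))"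
proof -
  let ?S = "variance_sum M I f (x(l := y))" and ?S' = "variance_sum M I f (x(l := y'))"
  define A where "A k w = f (x(l := y, k := fst w)) - f (x(l := y, k := snd w))" for k w
  define B where "B k w = f (x(l := y', k := fst w)) - f (x(l := y', k := snd w))" for k w
  define R where "R = (\<Sum>k\<in>I. (\<integral>w. (A k w - B k w)\<^sup>2 \<partial>MM) / 2)"
  have xy: "x(l := y) \<in> space P" "x(l := y') \<in> space P" using x y l by (auto intro: space_PiM_upd)
  have bA: "bounded_rv MM (A k)" and bB: "bounded_rv MM (B k)" if "k \<in> I" for k
    unfolding A_def[abs_def] B_def[abs_def]
    by (intro bounded_rv_diff bounded_rv_upd bounded_f that measurable_const xy measurable_fst measurable_snd)+
  have S: "?S = (\<Sum>k\<in>I. (\<integral>w. (A k w)\<^sup>2 \<partial>MM) / 2)" "?S' = (\<Sum>k\<in>I. (\<integral>w. (B k w)\<^sup>2 \<partial>MM) / 2)"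
    unfolding variance_sum_def coord_variance_def A_def B_def by auto
  have R: "R = variance_sum M I (\<lambda>x. f (x(l := y)) - f (x(l := y'))) x"
    unfolding R_def variance_sum_def
  proof (intro sum.cong refl)
    fix k assume "k \<in> I"
    show "(\<integral>w. (A k w - B k w)\<^sup>2 \<partial>MM) / 2 = coord_variance M k (\<lambda>x. f (x(l := y)) - f (x(l := y'))) x"
    \<comment> \<open>For \<open>k = l\<close> the new value of coordinate \<open>l\<close> is overwritten, so both sides vanish.\<close>
    proof (cases "k = l")
      case True
      then show ?thesis unfolding coord_variance_def A_def B_def by simp
    next
      case False
      then show ?thesis unfolding coord_variance_def A_def B_def
        by (simp add: fun_upd_twist[OF False] algebra_simps)
    qed
  qed
  have R0: "0 \<le> R" unfolding R_def by (intro sum_nonneg divide_nonneg_nonneg integral_nonneg_AE) auto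
  have "(?S - ?S')\<^sup>2 \<le> R * (2 * ?S + 2 * ?S')"
  proof (rule square_le_of_quadratic_nonneg[OF _ R0])
    fix \<tau> :: real
    have "\<tau>\<^sup>2 * R - 2 * \<tau> * (?S - ?S') + (2 * ?S + 2 * ?S')
      = (\<Sum>k\<in>I. \<tau>\<^sup>2 * ((\<integral>w. (A k w - B k w)\<^sup>2 \<partial>MM) / 2) + (2 - 2 * \<tau>) * ((\<integral>w. (A k w)\<^sup>2 \<partial>MM) / 2)
           + (2 + 2 * \<tau>) * ((\<integral>w. (B k w)\<^sup>2 \<partial>MM) / 2))"
      unfolding R_def S sum.distrib sum_distrib_left[symmetric] by (simp add: algebra_simps)
    also have "\<dots> \<ge> 0"
    proof (rule sum_nonneg)
      fix k assume k: "k \<in> I"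
      note bi = bounded_rv_intros bA[OF k] bB[OF k] and bI = bounded_rv_integrable[OF prob_pair]
      have "0 \<le> (\<integral>w. \<tau>\<^sup>2 * (A k w - B k w)\<^sup>2 + (2 - 2 * \<tau>) * (A k w)\<^sup>2 + (2 + 2 * \<tau>) * (B k w)\<^sup>2 \<partial>MM)"
      proof (intro integral_nonneg_AE AE_I2)
        fix w
        have "\<tau>\<^sup>2 * (A k w - B k w)\<^sup>2 + (2 - 2 * \<tau>) * (A k w)\<^sup>2 + (2 + 2 * \<tau>) * (B k w)\<^sup>2
          = (\<tau> * (A k w - B k w) - (A k w + B k w))\<^sup>2 + (A k w - B k w)\<^sup>2"
          by (simp add: power2_eq_square algebra_simps)
        then show "0 \<le> \<tau>\<^sup>2 * (A k w - B k w)\<^sup>2 + (2 - 2 * \<tau>) * (A k w)\<^sup>2 + (2 + 2 * \<tau>) * (B k w)\<^sup>2" by simp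
      qed
      also have "\<dots> = \<tau>\<^sup>2 * (\<integral>w. (A k w - B k w)\<^sup>2 \<partial>MM) + (2 - 2 * \<tau>) * (\<integral>w. (A k w)\<^sup>2 \<partial>MM)
           + (2 + 2 * \<tau>) * (\<integral>w. (B k w)\<^sup>2 \<partial>MM)"
        by (simp add: bI bi)
      finally show "0 \<le> \<tau>\<^sup>2 * ((\<integral>w. (A k w - B k w)\<^sup>2 \<partial>MM) / 2) + (2 - 2 * \<tau>) * ((\<integral>w. (A k w)\<^sup>2 \<partial>MM) / 2)
           + (2 + 2 * \<tau>) * ((\<integral>w. (B k w)\<^sup>2 \<partial>MM) / 2)" by simp
    qed
    finally show "0 \<le> \<tau>\<^sup>2 * R - 2 * \<tau> * (?S - ?S') + (2 * ?S + 2 * ?S')" .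
  qed
  also have "\<dots> \<le> \<rho> * (2 * ?S + 2 * ?S')"
    using \<rho> R variance_sum_nonneg by (intro mult_right_mono) auto
  finally show ?thesis .
qed

lemma entropy_exp_variance_sum_le:
  assumes \<rho>: "\<And>l x y y'. l \<in> I \<Longrightarrow> x \<in> space P \<Longrightarrow> y \<in> space M \<Longrightarrow> y' \<in> space M \<Longrightarrow>
      variance_sum M I (\<lambda>x. f (x(l := y)) - f (x(l := y'))) x \<le> \<rho>"
    and "\<rho> \<ge> 0" and s: "s \<ge> 0"
  shows "phi_entropy xlnx P (\<lambda>x. exp (s * variance_sum M I f x)) \<le> s\<^sup>2 * (real (card I) * \<rho>) * exp_moment P (variance_sum M I f) 1 s"
proof -
  let ?S = "variance_sum M I f"
  note bI = bounded_rv_integrable[OF prob_P] and bi = bounded_rv_intros bounded_variance_sum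
  have b1: "bounded_rv P (\<lambda>x. ?S x ^ 1 * exp (s * ?S x))" by (intro bi)
  have vl: "(\<integral>x. phi_entropy xlnx M (\<lambda>y. exp (s * ?S (x(l := y)))) \<partial>P) \<le> s\<^sup>2 * \<rho> * exp_moment P ?S 1 s" if l: "l \<in> I" for l
  proof -
    have b2: "bounded_rv P (\<lambda>x. \<integral>y. ?S (x(l := y)) ^ 1 * exp (s * ?S (x(l := y))) \<partial>M)"
      using bounded_rv_upd[OF b1 l, of fst "P \<Otimes>\<^sub>M M" snd]
      by (intro bounded_rv_integral[OF prob_M]) (simp add: case_prod_unfold)
    have "(\<integral>x. phi_entropy xlnx M (\<lambda>y. exp (s * ?S (x(l := y)))) \<partial>P)
       \<le> (\<integral>x. s\<^sup>2 * \<rho> * (\<integral>y. ?S (x(l := y)) ^ 1 * exp (s * ?S (x(l := y))) \<partial>M) \<partial>P)"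
    proof (rule integral_mono)
      show "integrable P (\<lambda>x. s\<^sup>2 * \<rho> * (\<integral>y. ?S (x(l := y)) ^ 1 * exp (s * ?S (x(l := y))) \<partial>M))"
        by (intro bI bounded_rv_mult bounded_rv_const b2)
      show "integrable P (\<lambda>x. phi_entropy xlnx M (\<lambda>y. exp (s * ?S (x(l := y)))))"
        by (intro bI bounded_section_entropy l bi)
      fix x assume x: "x \<in> space P"
      show "phi_entropy xlnx M (\<lambda>y. exp (s * ?S (x(l := y)))) \<le> s\<^sup>2 * \<rho> * (\<integral>y. ?S (x(l := y)) ^ 1 * exp (s * ?S (x(l := y))) \<partial>M)"
        unfolding exp_moment_def[symmetric]
        by (intro entropy_le_of_self_bounded[OF prob_M bounded_section[OF bounded_variance_sum l x]]
            variance_sum_self_bounded[OF \<rho>[OF l x] l x] \<open>\<rho> \<ge> 0\<close> s)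
    qed
    also have "\<dots> = s\<^sup>2 * \<rho> * exp_moment P ?S 1 s"
      using integral_PiM_resample[OF prob_M finite_I l b1] unfolding exp_moment_def by simp
    finally show ?thesis .
  qed
  have "phi_entropy xlnx P (\<lambda>x. exp (s * ?S x)) \<le> (\<Sum>l\<in>I. \<integral>x. phi_entropy xlnx M (\<lambda>y. exp (s * ?S (x(l := y)))) \<partial>P)"
    by (intro entropy_tensorization[OF prob_M finite_I] bi)
  also have "\<dots> \<le> (\<Sum>l\<in>I. s\<^sup>2 * \<rho> * exp_moment P ?S 1 s)" by (intro sum_mono vl)
  finally show ?thesis by (simp add: mult_ac)
qed

text \<open>Let \<open>H\<close> be the entropy of \<open>exp (s f)\<close>, \<open>Z\<close> its mean and \<open>q\<close> the variance profile at \<open>s\<close>. The variational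
  formula with \<open>T = \<kappa> S\<close> turns \<open>H \<le> q E[S exp (s f)]\<close> into
  \<open>H \<le> (q / \<kappa>) (H + Z ln E exp (\<kappa> S))\<close>, and the self-boundedness of \<open>S\<close> gives
  \<open>ln E exp (\<kappa> S) \<le> \<kappa> V / (1 - J\<^sup>2 \<kappa> / 2)\<close>. The best \<open>\<kappa>\<close> equalises \<open>q / \<kappa>\<close> and \<open>J\<^sup>2 \<kappa> / 2\<close>; with the
  common value \<open>\<eta>\<close> one gets \<open>H \<le> q V Z / (1 - \<eta>)\<^sup>2\<close>, and \<open>(1 - s b / 3) (1 - \<eta>)\<close> equals
  \<open>1 - (b / 3 + J / 2) s\<close>.\<close>
lemma log_mgf_bounded_interaction:
  assumes b: "b > 0" "\<And>x k. x \<in> space P \<Longrightarrow> k \<in> I \<Longrightarrow> f x - (\<integral>y. f (x(k := y)) \<partial>M) \<le> b"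
    and \<rho>: "\<And>l x y y'. l \<in> I \<Longrightarrow> x \<in> space P \<Longrightarrow> y \<in> space M \<Longrightarrow> y' \<in> space M \<Longrightarrow>
      variance_sum M I (\<lambda>x. f (x(l := y)) - f (x(l := y'))) x \<le> \<rho>" "\<rho> \<ge> 0"
    and V: "(\<integral>x. variance_sum M I f x \<partial>P) \<le> V"
    and J: "J > 0" "2 * real (card I) * \<rho> \<le> J\<^sup>2"
    and \<beta>: "\<beta> > 0" "(b / 3 + J / 2) * \<beta> < 1"
  shows "ln (exp_moment P f 0 \<beta>) \<le> \<beta> * (\<integral>x. f x \<partial>P) + \<beta>\<^sup>2 * V / (2 * (1 - (b / 3 + J / 2) * \<beta>))"
proof (rule log_mgf_bernstein[OF prob_P bounded_f _ \<beta>])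
  show "b / 3 + J / 2 \<ge> 0" using b J by simp
  let ?S = "variance_sum M I f"
  note bi = bounded_rv_intros bounded_f bounded_variance_sum
  have V0: "V \<ge> 0" using V by (rule order_trans[rotated]) (intro integral_nonneg_AE AE_I2 variance_sum_nonneg)
  fix s assume s: "0 < s" "s \<le> \<beta>"
  have "(b / 3 + J / 2) * s \<le> (b / 3 + J / 2) * \<beta>" using s b J by (intro mult_left_mono) auto
  then have cs: "(b / 3 + J / 2) * s < 1" using \<beta> by simp
  have Js: "J * s > 0" and bs: "b * s > 0" using s J b by auto
  define d where "d = 1 - s * b / 3"
  have d: "d > 0" unfolding d_def using cs Js by (simp add: algebra_simps)
  define w where "w = s / d"
  have w: "w > 0" unfolding w_def using s d by simp
  define \<kappa> where "\<kappa> = w / J"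
  have \<kappa>: "\<kappa> > 0" unfolding \<kappa>_def using w J by simp
  define \<eta> where "\<eta> = J * w / 2"
  have \<eta>d: "d * (1 - \<eta>) = 1 - (b / 3 + J / 2) * s"
    unfolding \<eta>_def w_def using d by (simp add: field_simps) (simp add: d_def field_simps)
  have \<eta>: "1 - \<eta> > 0" using \<eta>d cs d by (metis diff_gt_0_iff_gt zero_less_mult_pos)
  have q: "variance_profile b s = w\<^sup>2 / 2" unfolding variance_profile_def w_def d_def by (simp add: power_divide)
  have qk: "w\<^sup>2 / 2 = \<eta> * \<kappa>" unfolding \<eta>_def \<kappa>_def using J by (simp add: power2_eq_square)
  have Jk: "J\<^sup>2 * \<kappa> / 2 = \<eta>" unfolding \<eta>_def \<kappa>_def using J by (simp add: power2_eq_square)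
  let ?H = "phi_entropy xlnx P (\<lambda>x. exp (s * f x))" and ?Z = "exp_moment P f 0 s"
  have Z: "?Z = (\<integral>x. exp (s * f x) \<partial>P)" "?Z > 0" using exp_moment_0_pos[OF prob_P bounded_f] by (auto simp: exp_moment_def)
  have mgfS: "ln (\<integral>x. exp (\<kappa> * ?S x) \<partial>P) \<le> \<kappa> * V / (1 - \<eta>)"
  proof -
    have "ln (exp_moment P ?S 0 \<kappa>) \<le> \<kappa> * (\<integral>x. ?S x \<partial>P) / (1 - J\<^sup>2 * \<kappa> / 2)"
    proof (rule log_mgf_self_bounded[OF prob_P bounded_variance_sum _ \<kappa>])
      show "J\<^sup>2 * \<kappa> < 2" using Jk \<eta> by simp
      fix r assume r: "0 < r" "r \<le> \<kappa>"
      have "phi_entropy xlnx P (\<lambda>x. exp (r * ?S x)) \<le> r\<^sup>2 * (real (card I) * \<rho>) * exp_moment P ?S 1 r"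
        using r by (intro entropy_exp_variance_sum_le \<rho>) auto
      also have "\<dots> \<le> r\<^sup>2 * (J\<^sup>2 / 2) * exp_moment P ?S 1 r"
      proof (intro mult_right_mono mult_left_mono)
        show "0 \<le> exp_moment P ?S 1 r" unfolding exp_moment_def
          by (intro integral_nonneg_AE AE_I2) (simp add: variance_sum_nonneg)
      qed (use J(2) in auto)
      finally show "phi_entropy xlnx P (\<lambda>x. exp (r * ?S x)) \<le> (r\<^sup>2 * J\<^sup>2 / 2) * exp_moment P ?S 1 r" by simp
    qed
    also have "\<dots> \<le> \<kappa> * V / (1 - \<eta>)" unfolding Jk using V \<kappa> \<eta> by (intro divide_right_mono mult_left_mono) auto
    finally show ?thesis unfolding exp_moment_def by simp
  qed
  have dual: "(\<integral>x. exp (s * f x) * (\<kappa> * ?S x) \<partial>P) \<le> ?H + ?Z * ln (\<integral>x. exp (\<kappa> * ?S x) \<partial>P)"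
    unfolding Z(1) using Z(2)[unfolded Z(1)] by (intro entropy_duality[OF prob_P]) (simp_all add: bi)
  have "?H \<le> variance_profile b s * (\<integral>x. exp (s * f x) * ?S x \<partial>P)"
    using s d by (intro entropy_exp_le b) (auto simp: d_def)
  also have "\<dots> = \<eta> * (\<integral>x. exp (s * f x) * (\<kappa> * ?S x) \<partial>P)"
    unfolding q qk by (simp add: mult.left_commute)
  also have "\<dots> \<le> \<eta> * (?H + ?Z * (\<kappa> * V / (1 - \<eta>)))"
  proof (rule mult_left_mono)
    show "(\<integral>x. exp (s * f x) * (\<kappa> * ?S x) \<partial>P) \<le> ?H + ?Z * (\<kappa> * V / (1 - \<eta>))"
      using dual mult_left_mono[OF mgfS, of ?Z] Z(2) by simp
    show "0 \<le> \<eta>" unfolding \<eta>_def using J w by simp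
  qed
  also have "\<dots> = \<eta> * ?H + (w\<^sup>2 / 2) * V * ?Z / (1 - \<eta>)" unfolding qk by (simp add: algebra_simps)
  finally have "?H * (1 - \<eta>) \<le> (w\<^sup>2 / 2) * V * ?Z / (1 - \<eta>)" by (simp add: algebra_simps)
  then have "?H \<le> (w\<^sup>2 / 2) * V * ?Z / (1 - \<eta>) / (1 - \<eta>)" using \<eta> by (simp only: pos_le_divide_eq)
  also have "\<dots> = (s\<^sup>2 / 2) * V / (d * (1 - \<eta>))\<^sup>2 * ?Z" unfolding w_def by (simp add: power2_eq_square)
  finally show "?H \<le> (s\<^sup>2 / 2) * V / (1 - (b / 3 + J / 2) * s)\<^sup>2 * ?Z" unfolding \<eta>d .
qed

text \<open>The preceding estimates need \<open>J > 0\<close> and a positive variance proxy. They are applied with \<open>J + \<epsilon>\<close>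
  and \<open>V + \<epsilon>\<close>; since \<open>b > 0\<close>, the bound is continuous at \<open>\<epsilon> = 0\<close>.\<close>
theorem bounded_interaction_bernstein:
  assumes b: "b > 0" "\<And>x k. x \<in> space P \<Longrightarrow> k \<in> I \<Longrightarrow> f x - (\<integral>y. f (x(k := y)) \<partial>M) \<le> b"
    and \<rho>: "\<And>l x y y'. l \<in> I \<Longrightarrow> x \<in> space P \<Longrightarrow> y \<in> space M \<Longrightarrow> y' \<in> space M \<Longrightarrow>
      variance_sum M I (\<lambda>x. f (x(l := y)) - f (x(l := y'))) x \<le> \<rho>" "\<rho> \<ge> 0"
    and V: "(\<integral>x. variance_sum M I f x \<partial>P) \<le> V"
    and J: "J \<ge> 0" "2 * real (card I) * \<rho> \<le> J\<^sup>2"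
    and t: "t > 0"
  shows "measure P {x \<in> space P. f x - (\<integral>x. f x \<partial>P) > t} \<le> exp (- t\<^sup>2 / (2 * V + (2 * b / 3 + J) * t))"
proof -
  have V0: "V \<ge> 0" using V by (rule order_trans[rotated]) (intro integral_nonneg_AE AE_I2 variance_sum_nonneg)
  let ?E = "\<lambda>\<epsilon>. exp (- t\<^sup>2 / (2 * ((V + \<epsilon>) + (b / 3 + (J + \<epsilon>) / 2) * t)))"
  have "measure P {x \<in> space P. f x - (\<integral>x. f x \<partial>P) > t} \<le> ?E 0"
  proof (rule tendsto_lowerbound)
    have "V + (b / 3 + J / 2) * t > 0" using V0 b J t by (intro add_nonneg_pos mult_pos_pos add_pos_nonneg) auto
    then show "(?E \<longlongrightarrow> ?E 0) (at_right 0)" by (intro tendsto_intros) auto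
    show "\<forall>\<^sub>F \<epsilon> in at_right 0. measure P {x \<in> space P. f x - (\<integral>x. f x \<partial>P) > t} \<le> ?E \<epsilon>"
      unfolding eventually_at_right[OF zero_less_one]
    proof (intro exI[of _ 1] conjI allI impI zero_less_one)
      fix \<epsilon> :: real assume \<epsilon>: "0 < \<epsilon>" "\<epsilon> < 1"
      show "measure P {x \<in> space P. f x - (\<integral>x. f x \<partial>P) > t} \<le> ?E \<epsilon>"
      proof (rule bernstein_tail_of_log_mgf[OF prob_P bounded_f _ _ _ t])
        fix \<beta> :: real assume "0 < \<beta>" "(b / 3 + (J + \<epsilon>) / 2) * \<beta> < 1"
        moreover have "2 * real (card I) * \<rho> \<le> (J + \<epsilon>)\<^sup>2" using J \<epsilon> power_mono[of J "J + \<epsilon>" 2] by linarith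
        ultimately show "ln (exp_moment P f 0 \<beta>) \<le> \<beta> * (\<integral>x. f x \<partial>P) + \<beta>\<^sup>2 * (V + \<epsilon>) / (2 * (1 - (b / 3 + (J + \<epsilon>) / 2) * \<beta>))"
          using V J \<epsilon> by (intro log_mgf_bounded_interaction[OF b \<rho>]) auto
      qed (use V0 \<epsilon> b J in auto)
    qed
  qed simp
  also have "?E 0 = exp (- t\<^sup>2 / (2 * V + (2 * b / 3 + J) * t))" by (simp add: algebra_simps)
  finally show ?thesis .
qed

end

section \<open>Counting increasing index maps\<close>

text \<open>The index set of the sum in \<open>U_statistic\<close>.\<close>
definition increasing_maps :: "nat \<Rightarrow> nat \<Rightarrow> (nat \<Rightarrow> nat) set" where
  "increasing_maps m n = {i \<in> {1..m} \<rightarrow>\<^sub>E {1..n}. strict_mono_on {1..m} i}"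

lemma finite_increasing_maps: "finite (increasing_maps m n)"
  unfolding increasing_maps_def by (rule finite_subset[OF _ finite_PiE[of "{1..m}" "\<lambda>_. {1..n}"]]) auto

lemma increasing_maps_inj: "i \<in> increasing_maps m n \<Longrightarrow> inj_on i {1..m}"
  unfolding increasing_maps_def by (auto intro: strict_mono_on_imp_inj_on)

text \<open>An increasing map is determined by its range, whose sorted list it enumerates. Counting index maps
  is thereby counting subsets.\<close>
lemma increasing_maps_bij: "bij_betw (\<lambda>i. i ` {1..m}) (increasing_maps m n) {B. B \<subseteq> {1..n} \<and> card B = m}"
proof (rule bij_betw_imageI)
  show "inj_on (\<lambda>i. i ` {1..m}) (increasing_maps m n)"
  proof (rule inj_onI)
    fix i j assume i: "i \<in> increasing_maps m n" and j: "j \<in> increasing_maps m n" and eq: "i ` {1..m} = j ` {1..m}"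
    have srt: "sorted_wrt (<) (map a [1..<m+1])" if "a \<in> increasing_maps m n" for a
      unfolding sorted_wrt_map
      by (rule sorted_wrt_mono_rel[OF _ sorted_wrt_upt])
        (use that in \<open>auto simp: increasing_maps_def strict_mono_on_def\<close>)
    have ul: "set [1..<m+1] = {1..m}" by auto
    have "map i [1..<m+1] = map j [1..<m+1]"
      by (intro strict_sorted_equal srt i j) (simp only: set_map ul eq)
    then have "\<forall>x\<in>{1..m}. i x = j x" unfolding map_eq_conv ul .
    then show "i = j" using i j unfolding increasing_maps_def by (auto intro: PiE_ext)
  qed
  show "(\<lambda>i. i ` {1..m}) ` increasing_maps m n = {B. B \<subseteq> {1..n} \<and> card B = m}"
  proof (intro equalityI subsetI)
    fix B assume "B \<in> (\<lambda>i. i ` {1..m}) ` increasing_maps m n"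
    then obtain i where i: "i \<in> increasing_maps m n" "B = i ` {1..m}" by auto
    then have "card B = m" using increasing_maps_inj[OF i(1)] by (simp add: card_image)
    moreover have "B \<subseteq> {1..n}" using i unfolding increasing_maps_def by auto
    ultimately show "B \<in> {B. B \<subseteq> {1..n} \<and> card B = m}" by simp
  next
    fix B assume "B \<in> {B. B \<subseteq> {1..n} \<and> card B = m}"
    then have B: "B \<subseteq> {1..n}" "card B = m" "finite B" using finite_subset by auto
    obtain h where h: "bij_betw h {..<card B} B" "strict_mono_on {..<card B} h"
      using ex_bij_betw_strict_mono_card[OF B(3)] by blast
    define i where "i = (\<lambda>j\<in>{1..m}. h (j - 1))"
    have im: "(\<lambda>j. j - 1) ` {1..m} = {..<m}"
      by (auto simp: image_iff intro!: bexI[of _ "Suc _"])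
    have "i ` {1..m} = h ` ((\<lambda>j. j - 1) ` {1..m})" unfolding i_def image_image by auto
    then have iB: "i ` {1..m} = B" unfolding im using h(1) B(2) by (simp add: bij_betw_def)
    have "strict_mono_on {1..m} i"
    proof (rule strict_mono_onI)
      fix r s assume "r \<in> {1..m}" "s \<in> {1..m}" "r < s"
      then show "i r < i s" unfolding i_def
        using strict_mono_onD[OF h(2), of "r - 1" "s - 1"] B(2) by auto
    qed
    then have "i \<in> increasing_maps m n"
      unfolding increasing_maps_def using iB B(1) by (auto simp: i_def)
    then show "B \<in> (\<lambda>i. i ` {1..m}) ` increasing_maps m n" using iB by blast
  qed
qed

lemma card_subsets_containing:
  assumes "finite N" "A \<subseteq> N" "card A \<le> m"
  shows "card {B. A \<subseteq> B \<and> B \<subseteq> N \<and> card B = m} = (card N - card A) choose (m - card A)"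
proof -
  have fA: "finite A" using assms finite_subset by blast
  have "bij_betw (\<lambda>B. B - A) {B. A \<subseteq> B \<and> B \<subseteq> N \<and> card B = m} {B. B \<subseteq> N - A \<and> card B = m - card A}"
  proof (rule bij_betw_byWitness[where f'="\<lambda>B. B \<union> A"])
    show "(\<lambda>B. B - A) ` {B. A \<subseteq> B \<and> B \<subseteq> N \<and> card B = m} \<subseteq> {B. B \<subseteq> N - A \<and> card B = m - card A}"
      using fA by (auto simp: card_Diff_subset)
    show "(\<lambda>B. B \<union> A) ` {B. B \<subseteq> N - A \<and> card B = m - card A} \<subseteq> {B. A \<subseteq> B \<and> B \<subseteq> N \<and> card B = m}"
    proof (intro subsetI, elim imageE)
      fix C B assume B: "B \<in> {B. B \<subseteq> N - A \<and> card B = m - card A}" and C: "C = B \<union> A"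
      have "finite B" using B assms(1) finite_subset[of B N] by auto
      then have "card C = m" unfolding C using B fA assms by (subst card_Un_disjoint) auto
      then show "C \<in> {B. A \<subseteq> B \<and> B \<subseteq> N \<and> card B = m}" using B C assms by auto
    qed
  qed auto
  then have "card {B. A \<subseteq> B \<and> B \<subseteq> N \<and> card B = m} = card {B. B \<subseteq> N - A \<and> card B = m - card A}"
    by (rule bij_betw_same_card)
  also have "\<dots> = card (N - A) choose (m - card A)" using assms by (intro n_subsets) auto
  also have "card (N - A) = card N - card A" using assms fA by (simp add: card_Diff_subset)
  finally show ?thesis .
qed

lemma card_increasing_maps_containing:
  assumes "A \<subseteq> {1..n}" "card A \<le> m"
  shows "card {i \<in> increasing_maps m n. A \<subseteq> i ` {1..m}} = (n - card A) choose (m - card A)"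
proof -
  have "bij_betw (\<lambda>i. i ` {1..m}) {i \<in> increasing_maps m n. A \<subseteq> i ` {1..m}} {B \<in> {B. B \<subseteq> {1..n} \<and> card B = m}. A \<subseteq> B}"
  proof (rule bij_betw_subset[OF increasing_maps_bij])
    show "(\<lambda>i. i ` {1..m}) ` {i \<in> increasing_maps m n. A \<subseteq> i ` {1..m}} = {B \<in> {B. B \<subseteq> {1..n} \<and> card B = m}. A \<subseteq> B}"
      unfolding bij_betw_imp_surj_on[OF increasing_maps_bij[of m n], symmetric] by auto
  qed auto
  then have "card {i \<in> increasing_maps m n. A \<subseteq> i ` {1..m}} = card {B. A \<subseteq> B \<and> B \<subseteq> {1..n} \<and> card B = m}"
    using bij_betw_same_card by (metis (no_types, lifting) Collect_cong mem_Collect_eq)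
  then show ?thesis using card_subsets_containing[OF _ assms] by simp
qed

lemma card_increasing_maps: "card (increasing_maps m n) = n choose m"
  using card_increasing_maps_containing[of "{}" n m] by simp

lemma increasing_maps_ratio:
  assumes "1 \<le> m" "m < n" "k \<in> {1..n}"
  shows "real (card {i \<in> increasing_maps m n. k \<in> i ` {1..m}}) / real (n choose m) = m / n"
proof -
  have "card {i \<in> increasing_maps m n. k \<in> i ` {1..m}} = (n - 1) choose (m - 1)"
    using card_increasing_maps_containing[of "{k}" n m] assms by simp
  moreover have "m * (n choose m) = n * ((n - 1) choose (m - 1))"
    using assms by (intro times_binomial_minus1_eq) auto
  then have "real m * real (n choose m) = real n * real ((n - 1) choose (m - 1))"
    by (metis of_nat_mult)
  moreover have "real (n choose m) > 0" using assms by simp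
  ultimately show ?thesis using assms by (simp add: field_simps)
qed

text \<open>The probability that a random \<open>m\<close>-subset of an \<open>n\<close>-set contains two given points.\<close>
definition pair_ratio :: "nat \<Rightarrow> nat \<Rightarrow> real" where
  "pair_ratio m n = (real m * (real m - 1)) / (real n * (real n - 1))"

lemma increasing_maps_pair_ratio:
  assumes "1 \<le> m" "m < n" "k \<in> {1..n}" "l \<in> {1..n}" "k \<noteq> l"
  shows "real (card {i \<in> increasing_maps m n. l \<in> i ` {1..m} \<and> k \<in> i ` {1..m}}) / real (n choose m) = pair_ratio m n"
proof (cases "m = 1")
  case True
  then have "{i \<in> increasing_maps m n. l \<in> i ` {1..m} \<and> k \<in> i ` {1..m}} = {}" using assms by auto
  then show ?thesis using True by (simp only: pair_ratio_def card.empty) simp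
next
  case False
  then have m: "2 \<le> m" using assms by simp
  have "card {i \<in> increasing_maps m n. l \<in> i ` {1..m} \<and> k \<in> i ` {1..m}} = (n - 2) choose (m - 2)"
    using card_increasing_maps_containing[of "{k, l}" n m] assms m by (simp add: conj_commute numeral_2_eq_2)
  moreover have "m * (n choose m) = n * ((n - 1) choose (m - 1))"
    using assms by (intro times_binomial_minus1_eq) auto
  then have 1: "real m * real (n choose m) = real n * real ((n - 1) choose (m - 1))"
    by (metis of_nat_mult)
  have "(m - 1) * ((n - 1) choose (m - 1)) = (n - 1) * ((n - 1 - 1) choose (m - 1 - 1))"
    using m by (intro times_binomial_minus1_eq) auto
  then have "real (m - 1) * real ((n - 1) choose (m - 1)) = real (n - 1) * real ((n - 2) choose (m - 2))"
    by (metis of_nat_mult diff_diff_left one_add_one)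
  then have 2: "(real m - 1) * real ((n - 1) choose (m - 1)) = (real n - 1) * real ((n - 2) choose (m - 2))"
    using assms by simp
  have "real n * (real n - 1) * real ((n - 2) choose (m - 2)) = real m * (real m - 1) * real (n choose m)"
    using 1 2 by (metis (no_types, lifting) mult.assoc mult.left_commute)
  moreover have "real (n choose m) > 0" "real n > 0" "real n - 1 > 0" using assms by auto
  ultimately show ?thesis unfolding pair_ratio_def by (simp add: divide_simps mult_ac)
qed

section \<open>U-statistics\<close>

text \<open>Without this, simplification turns \<open>{1..m}\<close> into \<open>{Suc 0..m}\<close> and lemmas about the product
  over \<open>{1..m}\<close> no longer match.\<close>
declare One_nat_def [simp del]

definition pull_back :: "nat \<Rightarrow> (nat \<Rightarrow> nat) \<Rightarrow> (nat \<Rightarrow> 'a) \<Rightarrow> nat \<Rightarrow> 'a" where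
  "pull_back m i x = (\<lambda>j\<in>{1..m}. x (i j))"

lemma pull_back_upd_notin: "k \<notin> i ` {1..m} \<Longrightarrow> pull_back m i (x(k := y)) = pull_back m i x"
  unfolding pull_back_def by (intro ext) (auto simp: restrict_def)

lemma pull_back_upd:
  assumes "inj_on i {1..m}" "p \<in> {1..m}"
  shows "pull_back m i (x(i p := y)) = (pull_back m i x)(p := y)"
  using assms unfolding pull_back_def by (intro ext) (auto simp: restrict_def inj_on_eq_iff)

lemma sum_square_le: "(\<Sum>i\<in>A. a i)\<^sup>2 \<le> real (card A) * (\<Sum>i\<in>A. (a i)\<^sup>2)"
  using sum_squared_le_sum_of_squares[of a A] by (simp add: mult.commute)

lemma integral_sum_divide:
  assumes "prob_space N" "\<And>i. i \<in> A \<Longrightarrow> bounded_rv N (g i)"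
  shows "(\<integral>x. (\<Sum>i\<in>A. g i x) / c \<partial>N) = (\<Sum>i\<in>A. \<integral>x. g i x \<partial>N) / c"
  using assms by (simp add: bounded_rv_integrable Bochner_Integration.integral_sum)

text \<open>In the definition of \<open>\<beta>\<close> the first arguments of the two differences come with the sample and the
  second arguments from outside; the variance estimate pairs the two arguments of each difference.\<close>
lemma integral_four_rearrange:
  fixes q :: "'a \<Rightarrow> 'a \<Rightarrow> 'a \<Rightarrow> 'a \<Rightarrow> real"
  assumes M: "prob_space M"
    and q: "bounded_rv ((M \<Otimes>\<^sub>M M) \<Otimes>\<^sub>M (M \<Otimes>\<^sub>M M)) (\<lambda>t. q (fst (fst t)) (snd (fst t)) (fst (snd t)) (snd (snd t)))"
  shows "(\<integral>w. (\<integral>y. (\<integral>v. q y (fst v) w (snd v) \<partial>(M \<Otimes>\<^sub>M M)) \<partial>M) \<partial>M)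
     = (\<integral>v. (\<integral>w. q (fst v) (snd v) (fst w) (snd w) \<partial>(M \<Otimes>\<^sub>M M)) \<partial>(M \<Otimes>\<^sub>M M))"
proof -
  have MM: "prob_space (M \<Otimes>\<^sub>M M)" by (intro prob_space_pair M)
  have b: "bounded_rv N (\<lambda>x. q (a x) (b x) (c x) (d x))"
    if "a \<in> measurable N M" "b \<in> measurable N M" "c \<in> measurable N M" "d \<in> measurable N M" for N :: "'d measure" and a b c d
    using bounded_rv_compose[OF q, of "\<lambda>x. ((a x, b x), (c x, d x))" N] that by (simp add: measurable_Pair)
  have b1: "bounded_rv N (\<lambda>x. \<integral>w'. q (a x) (b x) (c x) w' \<partial>M)"
    if "a \<in> measurable N M" "b \<in> measurable N M" "c \<in> measurable N M" for N :: "'d measure" and a b c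
    using that by (intro bounded_rv_integral[OF M]) (auto simp: case_prod_unfold intro!: b measurable_compose[OF measurable_fst])
  have b2: "bounded_rv N (\<lambda>x. \<integral>y'. (\<integral>w'. q (a x) y' (c x) w' \<partial>M) \<partial>M)"
    if "a \<in> measurable N M" "c \<in> measurable N M" for N :: "'d measure" and a c
    using that by (intro bounded_rv_integral[OF M]) (auto simp: case_prod_unfold intro!: b1 measurable_compose[OF measurable_fst])
  have "(\<integral>w. (\<integral>y. (\<integral>v. q y (fst v) w (snd v) \<partial>(M \<Otimes>\<^sub>M M)) \<partial>M) \<partial>M)
      = (\<integral>w. (\<integral>y. (\<integral>y'. (\<integral>w'. q y y' w w' \<partial>M) \<partial>M) \<partial>M) \<partial>M)"
    by (intro Bochner_Integration.integral_cong refl bounded_rv_fubini(2)[OF M M, symmetric])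
      (auto simp: case_prod_unfold intro!: b)
  also have "\<dots> = (\<integral>y. (\<integral>w. (\<integral>y'. (\<integral>w'. q y y' w w' \<partial>M) \<partial>M) \<partial>M) \<partial>M)"
    by (rule bounded_rv_fubini(1)[OF M M]) (auto simp: case_prod_unfold intro!: b2)
  also have "\<dots> = (\<integral>y. (\<integral>y'. (\<integral>w. (\<integral>w'. q y y' w w' \<partial>M) \<partial>M) \<partial>M) \<partial>M)"
    by (intro Bochner_Integration.integral_cong refl bounded_rv_fubini(1)[OF M M])
      (auto simp: case_prod_unfold intro!: b1)
  also have "\<dots> = (\<integral>y. (\<integral>y'. (\<integral>w. q y y' (fst w) (snd w) \<partial>(M \<Otimes>\<^sub>M M)) \<partial>M) \<partial>M)"
    by (intro Bochner_Integration.integral_cong refl bounded_rv_fubini(2)[OF M M])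
      (auto simp: case_prod_unfold intro!: b)
  also have "\<dots> = (\<integral>v. (\<integral>w. q (fst v) (snd v) (fst w) (snd w) \<partial>(M \<Otimes>\<^sub>M M)) \<partial>(M \<Otimes>\<^sub>M M))"
  proof (rule bounded_rv_fubini(2)[OF M M])
    show "bounded_rv (M \<Otimes>\<^sub>M M) (\<lambda>(y, y'). \<integral>w. q y y' (fst w) (snd w) \<partial>(M \<Otimes>\<^sub>M M))"
      unfolding case_prod_unfold
      using q by (intro bounded_rv_integral[OF MM]) (simp add: case_prod_unfold)
  qed
  finally show ?thesis .
qed

text \<open>After clearing denominators this is \<open>m\<^sup>2 + n \<le> 2 m n\<close>. It replaces the exact second-order
  constants by the simpler ones of the theorem.\<close>
lemma pair_ratio_bound:
  assumes "1 \<le> m" "m < n"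
  shows "real n * (real n - 1) * (pair_ratio m n)\<^sup>2 \<le> real m ^ 4 / (real n)\<^sup>2"
proof -
  define a b where "a = real m" and "b = real n"
  have ab: "1 \<le> a" "a \<le> b" "1 < b" using assms unfolding a_def b_def by auto
  have "b * (b - 1) * (pair_ratio m n)\<^sup>2 = (a\<^sup>2 * (a - 1)\<^sup>2) / (b * (b - 1))"
    unfolding pair_ratio_def a_def[symmetric] b_def[symmetric] using ab
    by (simp add: power2_eq_square)
  also have "\<dots> \<le> a ^ 4 / b\<^sup>2"
  proof -
    have "a * a \<le> a * b" "1 * b \<le> a * b" using ab by (intro mult_left_mono mult_right_mono; simp)+
    then have nn: "0 \<le> 2 * (a * b) - a * a - b" by linarith
    have "(a - 1)\<^sup>2 * b\<^sup>2 \<le> a\<^sup>2 * (b * (b - 1))"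
    proof -
      have "0 \<le> b * (2 * (a * b) - a * a - b)" using ab nn by (intro mult_nonneg_nonneg) auto
      then show ?thesis by (simp add: power2_eq_square algebra_simps)
    qed
    then have "a\<^sup>2 * ((a - 1)\<^sup>2 * b\<^sup>2) \<le> a\<^sup>2 * (a\<^sup>2 * (b * (b - 1)))" by (intro mult_left_mono) auto
    moreover have "a\<^sup>2 * (a\<^sup>2 * (b * (b - 1))) = a ^ 4 * (b * (b - 1))" by (simp add: power2_eq_square power4_eq_xxxx mult.assoc)
    ultimately have "a\<^sup>2 * (a - 1)\<^sup>2 * b\<^sup>2 \<le> a ^ 4 * (b * (b - 1))" by (simp add: mult.assoc)
    moreover have "b * (b - 1) > 0" "b\<^sup>2 > 0" using ab by auto
    ultimately show ?thesis by (simp add: divide_le_eq pos_le_divide_eq mult_ac)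
  qed
  finally show ?thesis unfolding a_def b_def .
qed

locale symmetric_kernel_on = prob_space M for M :: "'a measure" +
  fixes m n :: nat and K :: "(nat \<Rightarrow> 'a) \<Rightarrow> real"
  assumes m_pos: "1 \<le> m" and m_less: "m < n"
    and K_measurable: "K \<in> borel_measurable (power_measure M m)"
    and K_range: "\<And>x. x \<in> space (power_measure M m) \<Longrightarrow> K x \<in> {-1..1}"
    and K_symmetric: "symmetric_kernel M m K"
begin

abbreviation Pm where "Pm \<equiv> power_measure M m"
abbreviation Pn where "Pn \<equiv> power_measure M n"
abbreviation U where "U \<equiv> U_statistic n m K"
abbreviation T where "T \<equiv> increasing_maps m n"

lemma bounded_K: "bounded_rv Pm K" by (rule bounded_rv_between[OF K_measurable K_range])

lemma U_eq: "U x = (\<Sum>i\<in>T. K (pull_back m i x)) / real (n choose m)"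
  unfolding U_statistic_def increasing_maps_def pull_back_def ..

lemma measurable_pull_back: "i \<in> {1..m} \<rightarrow> {1..n} \<Longrightarrow> pull_back m i \<in> measurable Pn Pm"
  unfolding pull_back_def[abs_def] by (intro measurable_restrict measurable_component_singleton) auto

lemma space_pull_back: "i \<in> {1..m} \<rightarrow> {1..n} \<Longrightarrow> x \<in> space Pn \<Longrightarrow> pull_back m i x \<in> space Pm"
  by (rule measurable_space[OF measurable_pull_back])

lemma T_maps: "i \<in> T \<Longrightarrow> i \<in> {1..m} \<rightarrow> {1..n}" unfolding increasing_maps_def by auto

lemma bounded_U: "bounded_rv Pn U"
proof -
  have "bounded_rv Pn (\<lambda>x. (\<Sum>i\<in>T. K (pull_back m i x)) * (1 / real (n choose m)))"
    by (intro bounded_rv_intros bounded_rv_compose[OF bounded_K] measurable_pull_back T_maps)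
  then show ?thesis unfolding U_eq[abs_def] by simp
qed

sublocale product_function M "{1..n}" U
  by (intro product_function.intro product_function_axioms.intro prob_space_axioms bounded_U) simp

lemma prob_Pm: "prob_space Pm" by (intro prob_space_PiM prob_M)

lemma integral_pull_back:
  fixes g :: "(nat \<Rightarrow> 'a) \<Rightarrow> real"
  assumes "i \<in> {1..m} \<rightarrow> {1..n}" "inj_on i {1..m}" "g \<in> borel_measurable Pm"
  shows "(\<integral>x. g (pull_back m i x) \<partial>Pn) = (\<integral>x. g x \<partial>Pm)"
proof -
  have "distr Pn Pm (pull_back m i) = Pm"
    using distr_PiM_reindex[of "{1..n}" "\<lambda>_. M" i "{1..m}"] prob_M assms unfolding pull_back_def[abs_def] by simp
  then show ?thesis using integral_distr[OF measurable_pull_back[OF assms(1)] assms(3)] by simp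
qed

lemma expectation_U: "(\<integral>x. U x \<partial>Pn) = (\<integral>x. K x \<partial>Pm)"
proof -
  have "(\<integral>x. U x \<partial>Pn) = (\<Sum>i\<in>T. (\<integral>x. K (pull_back m i x) \<partial>Pn)) / real (n choose m)"
    unfolding U_eq
    by (intro integral_sum_divide prob_P bounded_rv_compose[OF bounded_K] measurable_pull_back T_maps)
  also have "\<dots> = (\<Sum>i\<in>T. (\<integral>x. K x \<partial>Pm)) / real (n choose m)"
    by (simp add: integral_pull_back T_maps increasing_maps_inj K_measurable)
  finally show ?thesis using m_less by (simp add: card_increasing_maps)
qed

text \<open>
  Symmetry lets any one or two of the selected indices be fed to the first arguments of the kernel, at
  the price of an index map that is injective but no longer increasing. Injectivity is all that the
  distribution of the selected sample depends on.
\<close>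
lemma K_pull_back_permute:
  assumes i: "i \<in> {1..m} \<rightarrow> {1..n}" "x \<in> space Pn" and \<pi>: "\<pi> permutes {1..m}"
  shows "K (pull_back m (i \<circ> \<pi>) x) = K (pull_back m i x)"
proof -
  have "pull_back m i x \<circ> \<pi> = pull_back m (i \<circ> \<pi>) x"
  proof (rule ext)
    fix j show "(pull_back m i x \<circ> \<pi>) j = pull_back m (i \<circ> \<pi>) x j"
      using permutes_in_image[OF \<pi>, of j] by (cases "j \<in> {1..m}") (simp_all add: pull_back_def)
  qed
  then show ?thesis
    using K_symmetric[unfolded symmetric_kernel_def, rule_format, OF \<pi> space_pull_back[OF i]] by simp
qed

lemma comp_permutes:
  assumes i: "i \<in> {1..m} \<rightarrow> {1..n}" "inj_on i {1..m}" and \<pi>: "\<pi> permutes {1..m}"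
  shows "i \<circ> \<pi> \<in> {1..m} \<rightarrow> {1..n}" "inj_on (i \<circ> \<pi>) {1..m}"
proof -
  show "i \<circ> \<pi> \<in> {1..m} \<rightarrow> {1..n}" using i permutes_in_image[OF \<pi>] by (auto simp: Pi_iff)
  show "inj_on (i \<circ> \<pi>) {1..m}"
    using i(2) permutes_inj_on[OF \<pi>] permutes_image[OF \<pi>] by (intro comp_inj_on) auto
qed

lemma first_argument:
  assumes i: "i \<in> T" "k \<in> i ` {1..m}"
  obtains j where "j \<in> {1..m} \<rightarrow> {1..n}" "inj_on j {1..m}" "j 1 = k"
    "\<And>x. x \<in> space Pn \<Longrightarrow> K (pull_back m i x) = K (pull_back m j x)"
proof -
  obtain p where p: "p \<in> {1..m}" "i p = k" using i by auto
  let ?\<pi> = "Transposition.transpose 1 p"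
  have \<pi>: "?\<pi> permutes {1..m}" using p m_pos by (intro permutes_swap_id) auto
  note j = comp_permutes[OF T_maps[OF i(1)] increasing_maps_inj[OF i(1)] \<pi>]
  show ?thesis
  proof (rule that[OF j])
    show "(i \<circ> ?\<pi>) 1 = k" using p by simp
    show "K (pull_back m i x) = K (pull_back m (i \<circ> ?\<pi>) x)" if "x \<in> space Pn" for x
      using K_pull_back_permute[OF T_maps[OF i(1)] that \<pi>] by simp
  qed
qed

lemma first_two_arguments:
  assumes i: "i \<in> T" "l \<in> i ` {1..m}" "k \<in> i ` {1..m}" "k \<noteq> l"
  obtains j where "2 \<le> m" "j \<in> {1..m} \<rightarrow> {1..n}" "inj_on j {1..m}" "j 1 = l" "j 2 = k"
    "\<And>x. x \<in> space Pn \<Longrightarrow> K (pull_back m i x) = K (pull_back m j x)"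
proof -
  obtain p q where p: "p \<in> {1..m}" "i p = l" and q: "q \<in> {1..m}" "i q = k" using i by auto
  have pq: "p \<noteq> q" using p q i by auto
  then have m2: "2 \<le> m" using p q by auto
  let ?s = "Transposition.transpose 1 p"
  let ?\<pi> = "?s \<circ> Transposition.transpose 2 (?s q)"
  have s: "?s permutes {1..m}" using p m_pos by (intro permutes_swap_id) auto
  have \<pi>: "?\<pi> permutes {1..m}"
    using m2 q permutes_in_image[OF s] by (intro permutes_compose s permutes_swap_id) auto
  have "?s q \<noteq> 1" using pq by (auto simp: Transposition.transpose_def)
  then have \<pi>1: "?\<pi> 1 = p" by (simp add: transpose_def)
  have \<pi>2: "?\<pi> 2 = q" by (simp add: transpose_def)
  note j = comp_permutes[OF T_maps[OF i(1)] increasing_maps_inj[OF i(1)] \<pi>]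
  show ?thesis
  proof (rule that[OF m2 j])
    show "(i \<circ> ?\<pi>) 1 = l" "(i \<circ> ?\<pi>) 2 = k" using p q \<pi>1 \<pi>2 by (simp_all only: comp_apply)
    show "K (pull_back m i x) = K (pull_back m (i \<circ> ?\<pi>) x)" if "x \<in> space Pn" for x
      using K_pull_back_permute[OF T_maps[OF i(1)] that \<pi>] by simp
  qed
qed

subsection \<open>First differences\<close>

lemma U_diff: "U x - U z = (\<Sum>i\<in>T. K (pull_back m i x) - K (pull_back m i z)) / real (n choose m)"
  unfolding U_eq by (simp add: sum_subtractf diff_divide_distrib)

lemma abs_U_diff_le:
  assumes "k \<in> {1..n}" "x \<in> space Pn" "y \<in> space M" "y' \<in> space M"
  shows "\<bar>U (x(k := y)) - U (x(k := y'))\<bar> \<le> 2 * m / n"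
proof -
  let ?d = "\<lambda>i. K (pull_back m i (x(k := y))) - K (pull_back m i (x(k := y')))"
  let ?T = "{i \<in> T. k \<in> i ` {1..m}}"
  have "\<bar>\<Sum>i\<in>T. ?d i\<bar> = \<bar>\<Sum>i\<in>?T. ?d i\<bar>"
    by (subst sum.mono_neutral_right[of T ?T]) (auto simp: finite_increasing_maps pull_back_upd_notin)
  also have "\<dots> \<le> (\<Sum>i\<in>?T. \<bar>?d i\<bar>)" by (rule sum_abs)
  also have "\<dots> \<le> (\<Sum>i\<in>?T. 2)"
  proof (rule sum_mono)
    fix i assume "i \<in> ?T"
    then have i: "i \<in> {1..m} \<rightarrow> {1..n}" using T_maps by auto
    show "\<bar>?d i\<bar> \<le> 2"
      using K_range[OF space_pull_back[OF i space_PiM_upd[OF assms(2,3,1)]]] K_range[OF space_pull_back[OF i space_PiM_upd[OF assms(2,4,1)]]]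
      by auto
  qed
  finally have "\<bar>\<Sum>i\<in>T. ?d i\<bar> / real (n choose m) \<le> 2 * (real (card ?T) / real (n choose m))"
    by (simp add: divide_right_mono)
  then show ?thesis unfolding U_diff increasing_maps_ratio[OF m_pos m_less assms(1)] by simp
qed

lemma U_minus_mean_le:
  assumes "k \<in> {1..n}" "x \<in> space Pn"
  shows "U x - (\<integral>y. U (x(k := y)) \<partial>M) \<le> 2 * m / n"
proof -
  have "U x - 2 * m / n \<le> U (x(k := y))" if "y \<in> space M" for y
    using abs_U_diff_le[OF assms space_PiM_component[OF assms(2,1)] that] by simp
  then have "U x - 2 * m / n \<le> (\<integral>y. U (x(k := y)) \<partial>M)"
    by (intro integral_ge_const bounded_rv_integrable[OF prob_M] bounded_section[OF bounded_U] assms) auto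
  then show ?thesis by simp
qed

text \<open>The conditional expectation of the kernel given its first argument, as a function on the base
  space.\<close>
definition first_projection :: "'a \<Rightarrow> real" where
  "first_projection y = (\<integral>z. K (z(1 := y)) \<partial>Pm)"

lemma one_in: "1 \<in> {1..m}" using m_pos by simp

lemma bounded_first_projection: "bounded_rv M first_projection"
proof -
  have "bounded_rv (M \<Otimes>\<^sub>M Pm) (\<lambda>z. K ((snd z)(1 := fst z)))"
    by (intro bounded_rv_compose[OF bounded_K] measurable_upd one_in) auto
  then show ?thesis unfolding first_projection_def[abs_def]
    by (intro bounded_rv_integral prob_Pm) (simp add: case_prod_unfold)
qed

text \<open>Only the index tuples containing \<open>k\<close> contribute, and each of them contributes the same amount once \<open>k\<close>
  is moved to the front.\<close>
lemma expectation_U_diff: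
  assumes k: "k \<in> {1..n}" and y: "y \<in> space M" "y' \<in> space M"
  shows "(\<integral>x. U (x(k := y)) - U (x(k := y')) \<partial>Pn) = (m / n) * (first_projection y - first_projection y')"
proof -
  let ?T = "{i \<in> T. k \<in> i ` {1..m}}"
  have bi: "bounded_rv Pn (\<lambda>x. K (pull_back m i (x(k := y))))" if "i \<in> T" "y \<in> space M" for i y
    using that k by (intro bounded_rv_compose[OF bounded_K] measurable_compose[OF _ measurable_pull_back] measurable_upd T_maps) auto
  have fp: "(\<integral>x. K (pull_back m i (x(k := y))) \<partial>Pn) = first_projection y" if i: "i \<in> ?T" and y: "y \<in> space M" for i y
  proof -
    obtain j where j: "j \<in> {1..m} \<rightarrow> {1..n}" "inj_on j {1..m}" "j 1 = k"
      "\<And>x. x \<in> space Pn \<Longrightarrow> K (pull_back m i x) = K (pull_back m j x)"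
      using first_argument i by blast
    have "(\<integral>x. K (pull_back m i (x(k := y))) \<partial>Pn) = (\<integral>x. K ((pull_back m j x)(1 := y)) \<partial>Pn)"
    proof (intro Bochner_Integration.integral_cong refl)
      fix x assume x: "x \<in> space Pn"
      show "K (pull_back m i (x(k := y))) = K ((pull_back m j x)(1 := y))"
        using j(4)[OF space_PiM_upd[OF x y k]] pull_back_upd[OF j(2) one_in, of x y] j(3) by simp
    qed
    also have "\<dots> = first_projection y" unfolding first_projection_def
      using y by (intro integral_pull_back[OF j(1,2)] measurable_compose[OF measurable_upd K_measurable] one_in) auto
    finally show ?thesis .
  qed
  have "(\<integral>x. U (x(k := y)) - U (x(k := y')) \<partial>Pn)
     = (\<Sum>i\<in>T. (\<integral>x. K (pull_back m i (x(k := y))) - K (pull_back m i (x(k := y'))) \<partial>Pn)) / real (n choose m)"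
    unfolding U_diff by (intro integral_sum_divide prob_P bounded_rv_diff bi y)
  also have "(\<Sum>i\<in>T. (\<integral>x. K (pull_back m i (x(k := y))) - K (pull_back m i (x(k := y'))) \<partial>Pn))
     = (\<Sum>i\<in>?T. (\<integral>x. K (pull_back m i (x(k := y))) - K (pull_back m i (x(k := y'))) \<partial>Pn))"
    by (subst sum.mono_neutral_right[of T ?T]) (auto simp: finite_increasing_maps pull_back_upd_notin)
  also have "\<dots> = (\<Sum>i\<in>?T. first_projection y - first_projection y')"
  proof (intro sum.cong refl)
    fix i assume i: "i \<in> ?T"
    then have iT: "i \<in> T" by simp
    show "(\<integral>x. K (pull_back m i (x(k := y))) - K (pull_back m i (x(k := y'))) \<partial>Pn) = first_projection y - first_projection y'"
      using bounded_rv_integrable[OF prob_P bi[OF iT y(1)]] bounded_rv_integrable[OF prob_P bi[OF iT y(2)]]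
        fp[OF i y(1)] fp[OF i y(2)] by simp
  qed
  also have "\<dots> / real (n choose m) = (real (card ?T) / real (n choose m)) * (first_projection y - first_projection y')"
    by simp
  finally show ?thesis unfolding increasing_maps_ratio[OF m_pos m_less k] .
qed

subsection \<open>The first-order variance\<close>

text \<open>The conditional expectation given the first coordinate is the first projection evaluated there: on an
  event \<open>x 1 \<in> B\<close>, resampling the first coordinate and exchanging the integrals shows that both
  have the same integral.\<close>
lemma kernel_sigma1_sq_eq: "kernel_sigma1_sq M m K = phi_entropy (\<lambda>u. u\<^sup>2) M first_projection"
proof -
  interpret Pm: prob_space Pm by (rule prob_Pm)
  let ?F = "vimage_algebra (space Pm) (\<lambda>x. x 1) M"
  have c: "(\<lambda>x. x 1) \<in> measurable Pm M" using one_in by measurable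
  have c0: "(\<lambda>x. x 1) \<in> space Pm \<rightarrow> space M" using measurable_space[OF c] by blast
  have sub: "subalgebra Pm ?F"
    unfolding subalgebra_def using measurable_sets[OF c] sets_vimage_algebra2[OF c0] by auto
  interpret F: finite_measure_subalgebra Pm ?F by unfold_locales (rule sub)
  have c': "(\<lambda>x. x 1) \<in> measurable ?F M"
    by (rule measurable_vimage_algebra1[OF c0])
  have bh: "bounded_rv Pm (\<lambda>x. first_projection (x 1))" by (rule bounded_rv_compose[OF bounded_first_projection c])
  have ae: "AE x in Pm. real_cond_exp Pm ?F K x = first_projection (x 1)"
  proof (rule F.real_cond_exp_charact)
    show "integrable Pm K" by (rule bounded_rv_integrable[OF prob_Pm bounded_K])
    show "integrable Pm (\<lambda>x. first_projection (x 1))" by (rule bounded_rv_integrable[OF prob_Pm bh])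
    show "(\<lambda>x. first_projection (x 1)) \<in> borel_measurable ?F"
      by (rule measurable_compose[OF c' bounded_rv_measurable[OF bounded_first_projection]])
    fix A assume "A \<in> sets ?F"
    then obtain B where B: "B \<in> sets M" "A = (\<lambda>x. x 1) -` B \<inter> space Pm"
      using sets_vimage_algebra2[OF c0] by auto
    have bB: "bounded_rv M (indicator B)" using B by (intro bounded_rvI[where B=1]) (auto split: split_indicator)
    have b1: "bounded_rv Pm (\<lambda>x. indicator B (x 1) * K x)"
      by (intro bounded_rv_mult bounded_K bounded_rv_compose[OF bB c])
    have b2: "bounded_rv (Pm \<Otimes>\<^sub>M M) (\<lambda>(x, y). indicator B y * K (x(1 := y)))"
      using bounded_rv_mult[OF bounded_rv_compose[OF bB measurable_snd] bounded_rv_compose[OF bounded_K measurable_upd[OF one_in measurable_fst measurable_snd]]]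
      by (simp add: case_prod_unfold)
    have "(\<integral>x\<in>A. K x \<partial>Pm) = (\<integral>x. indicator B (x 1) * K x \<partial>Pm)"
      unfolding set_lebesgue_integral_def B by (intro Bochner_Integration.integral_cong refl) (auto split: split_indicator)
    also have "\<dots> = (\<integral>x. (\<integral>y. indicator B y * K (x(1 := y)) \<partial>M) \<partial>Pm)"
      using integral_PiM_resample[OF prob_M _ one_in b1] by simp
    also have "\<dots> = (\<integral>y. (\<integral>x. indicator B y * K (x(1 := y)) \<partial>Pm) \<partial>M)"
      by (rule bounded_rv_fubini(1)[OF prob_M prob_Pm b2])
    also have "\<dots> = (\<integral>y. indicator B y * first_projection y \<partial>M)" unfolding first_projection_def by simp
    also have "\<dots> = (\<integral>y. indicator B y * first_projection y \<partial>distr Pm M (\<lambda>x. x 1))"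
      using distr_PiM_component[of "{1..m}" "\<lambda>_. M" 1] prob_M one_in by simp
    also have "\<dots> = (\<integral>x. indicator B (x 1) * first_projection (x 1) \<partial>Pm)"
      using bounded_rv_measurable[OF bounded_rv_mult[OF bB bounded_first_projection]] by (intro integral_distr c) simp
    also have "\<dots> = (\<integral>x\<in>A. first_projection (x 1) \<partial>Pm)"
      unfolding set_lebesgue_integral_def B by (intro Bochner_Integration.integral_cong refl) (auto split: split_indicator)
    finally show "(\<integral>x\<in>A. K x \<partial>Pm) = (\<integral>x\<in>A. first_projection (x 1) \<partial>Pm)" .
  qed
  have e: "(\<integral>x. g (real_cond_exp Pm ?F K x) \<partial>Pm) = (\<integral>y. g (first_projection y) \<partial>M)"
    if g: "g \<in> borel_measurable borel" for g :: "real \<Rightarrow> real"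
  proof -
    have mF: "real_cond_exp Pm ?F K \<in> borel_measurable Pm" by (rule borel_measurable_cond_exp2)
    have "(\<integral>x. g (real_cond_exp Pm ?F K x) \<partial>Pm) = (\<integral>x. g (first_projection (x 1)) \<partial>Pm)"
      using ae by (intro integral_cong_AE measurable_compose[OF _ g] mF bounded_rv_measurable[OF bh]) auto
    also have "\<dots> = (\<integral>y. g (first_projection y) \<partial>distr Pm M (\<lambda>x. x 1))"
      by (rule integral_distr[symmetric, OF c measurable_compose[OF bounded_rv_measurable[OF bounded_first_projection] g]])
    also have "distr Pm M (\<lambda>x. x 1) = M" using distr_PiM_component[of "{1..m}" "\<lambda>_. M" 1] prob_M one_in by simp
    finally show ?thesis .
  qed
  have "kernel_sigma1_sq M m K = (\<integral>x. (real_cond_exp Pm ?F K x - (\<integral>x. real_cond_exp Pm ?F K x \<partial>Pm))\<^sup>2 \<partial>Pm)"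
    unfolding kernel_sigma1_sq_def Let_def ..
  also have "\<dots> = (\<integral>y. (first_projection y - (\<integral>y. first_projection y \<partial>M))\<^sup>2 \<partial>M)"
    using e[of "\<lambda>u. u"] by (subst e) auto
  also have "\<dots> = phi_entropy (\<lambda>u. u\<^sup>2) M first_projection"
    unfolding phi_entropy_def
    by (rule variance_eq) (intro bounded_rv_integrable[OF prob_M] bounded_rv_intros bounded_first_projection)+
  finally show ?thesis .
qed

subsection \<open>Second differences\<close>

text \<open>The second difference of the kernel in its first two arguments in explicit form. It is set to \<open>0\<close> for
  \<open>m = 1\<close>, in agreement with \<open>diff_op\<close>, so that the case needs no separate treatment later.\<close>
definition mixed_diff :: "(nat \<Rightarrow> 'a) \<Rightarrow> 'a \<Rightarrow> 'a \<Rightarrow> 'a \<Rightarrow> 'a \<Rightarrow> real" where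
  "mixed_diff z y y' w w' = (if 2 \<le> m then
     K (z(1 := y, 2 := w)) - K (z(1 := y, 2 := w')) - K (z(1 := y', 2 := w)) + K (z(1 := y', 2 := w')) else 0)"

lemma coord_subst_eq:
  assumes "z \<in> space Pm" "y \<in> space M" "k \<in> {1..m}"
  shows "coord_subst m k y z = z(k := y)"
  using space_PiM_upd[OF assms] unfolding coord_subst_def space_PiM PiE_def
  by (intro extensional_restrict) auto

lemma diff_op_eq_mixed_diff:
  assumes "z \<in> space Pm" "y \<in> space M" "y' \<in> space M" "2 \<le> m \<Longrightarrow> w \<in> space M" "2 \<le> m \<Longrightarrow> w' \<in> space M"
  shows "diff_op m 1 y y' (diff_op m 2 w w' K) z = mixed_diff z y y' w w'"
proof (cases "2 \<le> m")
  case True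
  then have 2: "2 \<in> {1..m}" by simp
  show ?thesis unfolding diff_op_def mixed_diff_def using True assms
    by (simp add: coord_subst_eq space_PiM_upd one_in 2 del: atLeastAtMost_iff)
next
  case False
  then have "2 \<notin> {1..m}" by simp
  then have "coord_subst m 2 v x = coord_subst m 2 v' x" for v v' and x :: "nat \<Rightarrow> 'a"
    unfolding coord_subst_def by (intro ext) (auto simp: restrict_def)
  then have "diff_op m 2 w w' K = (\<lambda>_. 0)" unfolding diff_op_def by (metis cancel_comm_monoid_add_class.diff_cancel)
  then show ?thesis unfolding mixed_diff_def using False by (simp add: diff_op_def)
qed

lemma bounded_mixed_diff:
  assumes "u \<in> measurable N Pm" "a \<in> measurable N M" "b \<in> measurable N M" "c \<in> measurable N M" "d \<in> measurable N M"
  shows "bounded_rv N (\<lambda>x. mixed_diff (u x) (a x) (b x) (c x) (d x))"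
proof (cases "2 \<le> m")
  case True
  then have 2: "2 \<in> {1..m}" by simp
  have "bounded_rv N (\<lambda>x. K ((u x)(1 := p x, 2 := q x)))" if "p \<in> measurable N M" "q \<in> measurable N M" for p q
    by (intro bounded_rv_compose[OF bounded_K] measurable_upd one_in 2 assms that)
  then show ?thesis unfolding mixed_diff_def using True assms
    by (simp add: bounded_rv_add bounded_rv_diff)
next
  case False
  then show ?thesis unfolding mixed_diff_def by (simp add: bounded_rv_const)
qed

lemma bounded_mixed_square:
  assumes "u \<in> measurable N Pm" "a \<in> measurable N M" "b \<in> measurable N M"
  shows "bounded_rv N (\<lambda>x. \<integral>w. (mixed_diff (u x) (a x) (b x) (fst w) (snd w))\<^sup>2 \<partial>MM)"
proof -
  have "bounded_rv (N \<Otimes>\<^sub>M MM) (\<lambda>x. (mixed_diff (u (fst x)) (a (fst x)) (b (fst x)) (fst (snd x)) (snd (snd x)))\<^sup>2)"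
    by (intro bounded_rv_power bounded_mixed_diff measurable_compose[OF measurable_fst] measurable_compose[OF measurable_snd] assms measurable_fst measurable_snd)
  then show ?thesis by (intro bounded_rv_integral prob_pair) (simp add: case_prod_unfold)
qed

lemma abs_mixed_diff_le:
  assumes "z \<in> space Pm" "y \<in> space M" "y' \<in> space M" "w \<in> space M" "w' \<in> space M"
  shows "\<bar>mixed_diff z y y' w w'\<bar> \<le> 4"
proof (cases "2 \<le> m")
  case True
  then have 2: "2 \<in> {1..m}" by simp
  have "K (z(1 := p, 2 := q)) \<in> {-1..1}" if "p \<in> space M" "q \<in> space M" for p q
    by (intro K_range space_PiM_upd assms that one_in 2)
  from this[OF assms(2,4)] this[OF assms(2,5)] this[OF assms(3,4)] this[OF assms(3,5)]
  show ?thesis unfolding mixed_diff_def using True by auto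
qed (simp add: mixed_diff_def)

lemma mixed_square_le_gamma:
  assumes z: "z \<in> space Pm" and y: "y \<in> space M" "y' \<in> space M"
  shows "(\<integral>w. (mixed_diff z y y' (fst w) (snd w))\<^sup>2 \<partial>MM) \<le> kernel_gamma M m K"
proof -
  let ?I = "\<lambda>(x, y, y'). \<integral>(x2, x2'). (diff_op m 1 y y' (diff_op m 2 x2 x2' K) x)\<^sup>2 \<partial>MM"
  let ?D = "space Pm \<times> space M \<times> space M"
  have eq: "?I (z, y, y') = (\<integral>w. (mixed_diff z y y' (fst w) (snd w))\<^sup>2 \<partial>MM)"
    if "z \<in> space Pm" "y \<in> space M" "y' \<in> space M" for z y y'
    using that by (auto intro!: Bochner_Integration.integral_cong simp: diff_op_eq_mixed_diff space_pair_measure)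
  have "(\<integral>w. (mixed_diff z y y' (fst w) (snd w))\<^sup>2 \<partial>MM) \<in> {0..4\<^sup>2}"
    if "z \<in> space Pm" "y \<in> space M" "y' \<in> space M" for z y y'
  proof (rule integral_between[OF prob_pair])
    show "(\<lambda>w. (mixed_diff z y y' (fst w) (snd w))\<^sup>2) \<in> borel_measurable MM"
      using that by (intro bounded_rv_measurable bounded_rv_power bounded_mixed_diff) auto
    fix w assume "w \<in> space MM"
    then have "\<bar>mixed_diff z y y' (fst w) (snd w)\<bar> \<le> 4"
      using that by (intro abs_mixed_diff_le) (auto simp: space_pair_measure)
    then have "(mixed_diff z y y' (fst w) (snd w))\<^sup>2 \<le> 4\<^sup>2" by (metis abs_ge_zero power2_abs power_mono)
    then show "(mixed_diff z y y' (fst w) (snd w))\<^sup>2 \<in> {0..4\<^sup>2}" by simp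
  qed
  then have "bdd_above (?I ` ?D)" using eq by (intro bdd_aboveI[of _ "4\<^sup>2"]) auto
  moreover have "(z, y, y') \<in> ?D" using z y by simp
  ultimately have "?I (z, y, y') \<le> kernel_gamma M m K" unfolding kernel_gamma_def by (intro cSUP_upper)
  then show ?thesis using eq[OF z y] by simp
qed

lemma kernel_gamma_nonneg: "0 \<le> kernel_gamma M m K"
proof -
  interpret P: prob_space Pm by (rule prob_Pm)
  obtain z y where "z \<in> space Pm" "y \<in> space M" using P.not_empty not_empty by blast
  then have "(\<integral>w. (mixed_diff z y y (fst w) (snd w))\<^sup>2 \<partial>MM) \<le> kernel_gamma M m K"
    by (intro mixed_square_le_gamma)
  moreover have "0 \<le> (\<integral>w. (mixed_diff z y y (fst w) (snd w))\<^sup>2 \<partial>MM)" by simp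
  ultimately show ?thesis by linarith
qed

text \<open>The mixed second difference in \<open>l\<close> and \<open>k\<close> removes every index tuple that misses one of the two. In the
  remaining ones \<open>l\<close> and \<open>k\<close> are moved to the first two places by the maps \<open>J i\<close>.\<close>
lemma U_second_difference:
  assumes k: "k \<in> {1..n}" and l: "l \<in> {1..n}" and kl: "k \<noteq> l"
  defines "T2 \<equiv> {i \<in> T. l \<in> i ` {1..m} \<and> k \<in> i ` {1..m}}"
  obtains J where "\<And>i. i \<in> T2 \<Longrightarrow> J i \<in> {1..m} \<rightarrow> {1..n}" "\<And>i. i \<in> T2 \<Longrightarrow> inj_on (J i) {1..m}"
    "\<And>x y y' w w'. x \<in> space Pn \<Longrightarrow> y \<in> space M \<Longrightarrow> y' \<in> space M \<Longrightarrow> w \<in> space M \<Longrightarrow> w' \<in> space M \<Longrightarrow>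
      U (x(l := y, k := w)) - U (x(l := y, k := w')) - U (x(l := y', k := w)) + U (x(l := y', k := w'))
        = (\<Sum>i\<in>T2. mixed_diff (pull_back m (J i) x) y y' w w') / real (n choose m)"
proof -
  have "\<exists>j. 2 \<le> m \<and> j \<in> {1..m} \<rightarrow> {1..n} \<and> inj_on j {1..m} \<and> j 1 = l \<and> j 2 = k \<and>
    (\<forall>x\<in>space Pn. K (pull_back m i x) = K (pull_back m j x))" if "i \<in> T2" for i
  proof -
    have i: "i \<in> T" "l \<in> i ` {1..m}" "k \<in> i ` {1..m}" using that unfolding T2_def by auto
    obtain j where "2 \<le> m" "j \<in> {1..m} \<rightarrow> {1..n}" "inj_on j {1..m}" "j 1 = l" "j 2 = k"
      "\<And>x. x \<in> space Pn \<Longrightarrow> K (pull_back m i x) = K (pull_back m j x)"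
      by (rule first_two_arguments[OF i kl]) (rule that)
    then show ?thesis by (intro exI[of _ j] conjI ballI)
  qed
  then have "\<forall>i\<in>T2. \<exists>j. 2 \<le> m \<and> j \<in> {1..m} \<rightarrow> {1..n} \<and> inj_on j {1..m} \<and> j 1 = l \<and> j 2 = k \<and>
    (\<forall>x\<in>space Pn. K (pull_back m i x) = K (pull_back m j x))" by (rule ballI)
  then obtain J where J: "\<forall>i\<in>T2. 2 \<le> m \<and> J i \<in> {1..m} \<rightarrow> {1..n} \<and> inj_on (J i) {1..m} \<and> J i 1 = l \<and> J i 2 = k \<and>
    (\<forall>x\<in>space Pn. K (pull_back m i x) = K (pull_back m (J i) x))" by (rule bchoice[THEN exE])
  show ?thesis
  proof (rule that[of J])
    fix x y y' w w' assume x: "x \<in> space Pn" and y: "y \<in> space M" "y' \<in> space M" and w: "w \<in> space M" "w' \<in> space M"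
    let ?K = "\<lambda>i v u. K (pull_back m i (x(l := v, k := u)))"
    let ?d = "\<lambda>i. ?K i y w - ?K i y w' - ?K i y' w + ?K i y' w'"
    have "U (x(l := y, k := w)) - U (x(l := y, k := w')) - U (x(l := y', k := w)) + U (x(l := y', k := w'))
      = (\<Sum>i\<in>T. ?d i) / real (n choose m)"
      unfolding U_eq by (simp add: sum.distrib sum_subtractf diff_divide_distrib add_divide_distrib)
    also have "(\<Sum>i\<in>T. ?d i) = (\<Sum>i\<in>T2. ?d i)"
    proof (rule sum.mono_neutral_right[OF finite_increasing_maps])
      show "T2 \<subseteq> T" unfolding T2_def by auto
      show "\<forall>i\<in>T - T2. ?d i = 0"
      proof
        fix i assume i: "i \<in> T - T2"
        show "?d i = 0"
        proof (cases "k \<in> i ` {1..m}")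
          case False
          then show ?thesis by (simp add: pull_back_upd_notin)
        next
          case True
          then have "l \<notin> i ` {1..m}" using i unfolding T2_def by auto
          then show ?thesis by (simp add: fun_upd_twist[OF kl[symmetric]] pull_back_upd_notin)
        qed
      qed
    qed
    also have "\<dots> = (\<Sum>i\<in>T2. mixed_diff (pull_back m (J i) x) y y' w w')"
    proof (intro sum.cong refl)
      fix i assume i: "i \<in> T2"
      have m2: "2 \<le> m" and j: "inj_on (J i) {1..m}" "J i 1 = l" "J i 2 = k"
        and e: "\<And>x. x \<in> space Pn \<Longrightarrow> K (pull_back m i x) = K (pull_back m (J i) x)"
        using J i by auto
      have 2: "2 \<in> {1..m}" using m2 by simp
      have "?K i v u = K ((pull_back m (J i) x)(1 := v, 2 := u))" if "v \<in> space M" "u \<in> space M" for v u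
      proof -
        have "?K i v u = K (pull_back m (J i) (x(l := v, k := u)))"
          using that by (intro e space_PiM_upd x k l)
        also have "pull_back m (J i) (x(l := v, k := u)) = (pull_back m (J i) x)(1 := v, 2 := u)"
          using pull_back_upd[OF j(1) one_in, of x v] pull_back_upd[OF j(1) 2, of "x(l := v)" u] j by simp
        finally show ?thesis .
      qed
      then show "?d i = mixed_diff (pull_back m (J i) x) y y' w w'"
        unfolding mixed_diff_def using m2 y w by simp
    qed
    finally show "U (x(l := y, k := w)) - U (x(l := y, k := w')) - U (x(l := y', k := w)) + U (x(l := y', k := w'))
        = (\<Sum>i\<in>T2. mixed_diff (pull_back m (J i) x) y y' w w') / real (n choose m)" .
  qed (use J in auto)
qed

abbreviation U_diff_fn where "U_diff_fn l y y' \<equiv> \<lambda>x. U (x(l := y)) - U (x(l := y'))"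

lemma coord_variance_U_diff_same: "coord_variance M l (U_diff_fn l y y') x = 0"
  unfolding coord_variance_def by simp

text \<open>Cauchy--Schwarz over the index tuples containing both \<open>l\<close> and \<open>k\<close>, integrated over the two values of
  coordinate \<open>k\<close>. The sum is kept for the two uses that follow: for fixed \<open>x\<close> each of its terms is at
  most \<open>\<gamma>\<close>, and in the mean over \<open>x\<close>, \<open>y\<close> and \<open>y'\<close> each of them is \<open>\<beta>\<close>.\<close>
lemma coord_variance_U_diff:
  assumes k: "k \<in> {1..n}" and l: "l \<in> {1..n}" and kl: "k \<noteq> l"
  defines "T2 \<equiv> {i \<in> T. l \<in> i ` {1..m} \<and> k \<in> i ` {1..m}}"
  obtains J where "\<And>i. i \<in> T2 \<Longrightarrow> J i \<in> {1..m} \<rightarrow> {1..n}" "\<And>i. i \<in> T2 \<Longrightarrow> inj_on (J i) {1..m}"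
    "\<And>x y y'. x \<in> space Pn \<Longrightarrow> y \<in> space M \<Longrightarrow> y' \<in> space M \<Longrightarrow>
      coord_variance M k (U_diff_fn l y y') x
        \<le> (real (card T2) / (real (n choose m))\<^sup>2 / 2) *
          (\<Sum>i\<in>T2. \<integral>w. (mixed_diff (pull_back m (J i) x) y y' (fst w) (snd w))\<^sup>2 \<partial>MM)"
proof -
  obtain J where J: "\<And>i. i \<in> T2 \<Longrightarrow> J i \<in> {1..m} \<rightarrow> {1..n}" "\<And>i. i \<in> T2 \<Longrightarrow> inj_on (J i) {1..m}"
    and e: "\<And>x y y' w w'. x \<in> space Pn \<Longrightarrow> y \<in> space M \<Longrightarrow> y' \<in> space M \<Longrightarrow> w \<in> space M \<Longrightarrow> w' \<in> space M \<Longrightarrow>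
      U (x(l := y, k := w)) - U (x(l := y, k := w')) - U (x(l := y', k := w)) + U (x(l := y', k := w'))
        = (\<Sum>i\<in>T2. mixed_diff (pull_back m (J i) x) y y' w w') / real (n choose m)"
    using U_second_difference[OF k l kl] unfolding T2_def by blast
  show ?thesis
  proof (rule that[OF J])
    fix x y y' assume x: "x \<in> space Pn" and y: "y \<in> space M" "y' \<in> space M"
    let ?C = "real (n choose m)"
    have bm: "bounded_rv MM (\<lambda>w. (mixed_diff (pull_back m (J i) x) y y' (fst w) (snd w))\<^sup>2)" if "i \<in> T2" for i
      using y space_pull_back[OF J(1)[OF that] x] by (intro bounded_rv_power bounded_mixed_diff) auto
    have bU: "bounded_rv MM (\<lambda>w. (U_diff_fn l y y' (x(k := fst w)) - U_diff_fn l y y' (x(k := snd w)))\<^sup>2)"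
      using x y by (intro bounded_rv_power bounded_rv_diff bounded_rv_upd[OF bounded_U] measurable_upd k l) auto
    have "(\<integral>w. (U_diff_fn l y y' (x(k := fst w)) - U_diff_fn l y y' (x(k := snd w)))\<^sup>2 \<partial>MM)
      \<le> (\<integral>w. (\<Sum>i\<in>T2. (mixed_diff (pull_back m (J i) x) y y' (fst w) (snd w))\<^sup>2) / (?C\<^sup>2 / card T2) \<partial>MM)"
    proof (intro integral_mono bounded_rv_integrable prob_pair bU)
      show "bounded_rv MM (\<lambda>w. (\<Sum>i\<in>T2. (mixed_diff (pull_back m (J i) x) y y' (fst w) (snd w))\<^sup>2) / (?C\<^sup>2 / card T2))"
        using bounded_rv_mult[OF bounded_rv_sum[OF bm] bounded_rv_const[of _ "1 / (?C\<^sup>2 / card T2)"]] by simp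
      fix w assume "w \<in> space MM"
      then have w: "fst w \<in> space M" "snd w \<in> space M" by (auto simp: space_pair_measure)
      have "U_diff_fn l y y' (x(k := fst w)) - U_diff_fn l y y' (x(k := snd w))
        = (\<Sum>i\<in>T2. mixed_diff (pull_back m (J i) x) y y' (fst w) (snd w)) / ?C"
        unfolding e[OF x y w, symmetric] by (simp add: fun_upd_twist[OF kl])
      then have "(U_diff_fn l y y' (x(k := fst w)) - U_diff_fn l y y' (x(k := snd w)))\<^sup>2
        = (\<Sum>i\<in>T2. mixed_diff (pull_back m (J i) x) y y' (fst w) (snd w))\<^sup>2 / ?C\<^sup>2"
        by (simp add: power_divide)
      also have "\<dots> \<le> (card T2 * (\<Sum>i\<in>T2. (mixed_diff (pull_back m (J i) x) y y' (fst w) (snd w))\<^sup>2)) / ?C\<^sup>2"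
        by (intro divide_right_mono sum_square_le) auto
      finally show "(U_diff_fn l y y' (x(k := fst w)) - U_diff_fn l y y' (x(k := snd w)))\<^sup>2
        \<le> (\<Sum>i\<in>T2. (mixed_diff (pull_back m (J i) x) y y' (fst w) (snd w))\<^sup>2) / (?C\<^sup>2 / card T2)" by (simp add: mult.commute)
    qed
    also have "\<dots> = (\<Sum>i\<in>T2. \<integral>w. (mixed_diff (pull_back m (J i) x) y y' (fst w) (snd w))\<^sup>2 \<partial>MM) / (?C\<^sup>2 / card T2)"
      by (intro integral_sum_divide prob_pair bm)
    finally show "coord_variance M k (U_diff_fn l y y') x \<le> (real (card T2) / ?C\<^sup>2 / 2) *
          (\<Sum>i\<in>T2. \<integral>w. (mixed_diff (pull_back m (J i) x) y y' (fst w) (snd w))\<^sup>2 \<partial>MM)"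
      unfolding coord_variance_def by (simp add: mult_ac)
  qed
qed

lemma coord_variance_U_diff_le_gamma:
  assumes k: "k \<in> {1..n}" and l: "l \<in> {1..n}" and kl: "k \<noteq> l" and x: "x \<in> space Pn" and y: "y \<in> space M" "y' \<in> space M"
  shows "coord_variance M k (U_diff_fn l y y') x \<le> (pair_ratio m n)\<^sup>2 * kernel_gamma M m K / 2"
proof -
  let ?T = "{i \<in> T. l \<in> i ` {1..m} \<and> k \<in> i ` {1..m}}" and ?C = "real (n choose m)"
  obtain J where J: "\<And>i. i \<in> ?T \<Longrightarrow> J i \<in> {1..m} \<rightarrow> {1..n}" "\<And>i. i \<in> ?T \<Longrightarrow> inj_on (J i) {1..m}"
    "\<And>x y y'. x \<in> space Pn \<Longrightarrow> y \<in> space M \<Longrightarrow> y' \<in> space M \<Longrightarrow>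
      coord_variance M k (U_diff_fn l y y') x
        \<le> (real (card ?T) / ?C\<^sup>2 / 2) *
          (\<Sum>i\<in>?T. \<integral>w. (mixed_diff (pull_back m (J i) x) y y' (fst w) (snd w))\<^sup>2 \<partial>MM)"
    by (rule coord_variance_U_diff[OF k l kl]) (rule that)
  have "coord_variance M k (U_diff_fn l y y') x
        \<le> (real (card ?T) / ?C\<^sup>2 / 2) *
          (\<Sum>i\<in>?T. \<integral>w. (mixed_diff (pull_back m (J i) x) y y' (fst w) (snd w))\<^sup>2 \<partial>MM)"
    by (rule J(3)[OF x y])
  also have "\<dots> \<le> (real (card ?T) / ?C\<^sup>2 / 2) * (\<Sum>i\<in>?T. kernel_gamma M m K)"
    by (intro mult_left_mono sum_mono mixed_square_le_gamma space_pull_back J x y) auto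
  also have "\<dots> = (real (card ?T) / ?C)\<^sup>2 * kernel_gamma M m K / 2" by (simp add: power2_eq_square)
  finally show ?thesis unfolding increasing_maps_pair_ratio[OF m_pos m_less k l kl] .
qed

lemma variance_sum_U_diff_le:
  assumes l: "l \<in> {1..n}" and x: "x \<in> space Pn" and y: "y \<in> space M" "y' \<in> space M"
  shows "variance_sum M {1..n} (U_diff_fn l y y') x \<le> (real n - 1) * ((pair_ratio m n)\<^sup>2 * kernel_gamma M m K / 2)"
proof -
  have "variance_sum M {1..n} (U_diff_fn l y y') x = (\<Sum>k\<in>{1..n} - {l}. coord_variance M k (U_diff_fn l y y') x)"
    unfolding variance_sum_def using l by (subst sum.remove[OF _ l]) (auto simp: coord_variance_U_diff_same)
  also have "\<dots> \<le> (\<Sum>k\<in>{1..n} - {l}. (pair_ratio m n)\<^sup>2 * kernel_gamma M m K / 2)"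
    by (intro sum_mono coord_variance_U_diff_le_gamma l x y) auto
  also have "\<dots> = real (card ({1..n} - {l})) * ((pair_ratio m n)\<^sup>2 * kernel_gamma M m K / 2)" by simp
  also have "real (card ({1..n} - {l})) = real n - 1" using l m_less by (simp add: card_Diff_singleton)
  finally show ?thesis .
qed

text \<open>Resampling the first two coordinates of the sample makes the arguments of both differences
  independent of the remaining coordinates.\<close>
lemma kernel_beta_eq:
  "kernel_beta M m K = (\<integral>v. (\<integral>z. (\<integral>w. (mixed_diff z (fst v) (snd v) (fst w) (snd w))\<^sup>2 \<partial>MM) \<partial>Pm) \<partial>MM)"
proof -
  let ?q = "\<lambda>z y y' w w'. (mixed_diff z y y' w w')\<^sup>2"
  have "kernel_beta M m K = (\<integral>t. ?q (fst t) (fst t 1) (fst (snd t)) (fst t 2) (snd (snd t)) \<partial>(Pm \<Otimes>\<^sub>M MM))"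
    unfolding kernel_beta_def
  proof (intro Bochner_Integration.integral_cong refl)
    fix t assume t: "t \<in> space (Pm \<Otimes>\<^sub>M MM)"
    obtain z v v' where tt: "t = (z, v, v')" by (cases t) auto
    have s: "z \<in> space Pm" "v \<in> space M" "v' \<in> space M" using t tt by (auto simp: space_pair_measure)
    have "z 2 \<in> space M" if "2 \<le> m" using space_PiM_component[OF s(1), of 2] that by simp
    then have "diff_op m 1 (z 1) v (diff_op m 2 (z 2) v' K) z = mixed_diff z (z 1) v (z 2) v'"
      using s space_PiM_component[OF s(1) one_in] by (intro diff_op_eq_mixed_diff) auto
    then show "(\<lambda>(x, x1', x2'). (diff_op m 1 (x 1) x1' (diff_op m 2 (x 2) x2' K) x)\<^sup>2) t = ?q (fst t) (fst t 1) (fst (snd t)) (fst t 2) (snd (snd t))"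
      unfolding tt by simp
  qed
  also have "\<dots> = (\<integral>v. (\<integral>z. (\<integral>w. ?q z (fst v) (snd v) (fst w) (snd w) \<partial>MM) \<partial>Pm) \<partial>MM)"
  proof (cases "2 \<le> m")
    case False
    then show ?thesis by (simp add: mixed_diff_def)
  next
    case True
    then have two: "2 \<in> {1..m}" by simp
    let ?F = "\<lambda>z. \<integral>v. ?q z (z 1) (fst v) (z 2) (snd v) \<partial>MM"
    have b: "bounded_rv (Pm \<Otimes>\<^sub>M MM) (\<lambda>t. ?q (fst t) (fst t 1) (fst (snd t)) (fst t 2) (snd (snd t)))"
      using one_in two by (intro bounded_rv_power bounded_mixed_diff measurable_compose[OF measurable_fst measurable_component_singleton]) auto
    have bF: "bounded_rv Pm ?F"
      using b by (intro bounded_rv_integral prob_pair) (simp add: case_prod_unfold)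
    have bG: "bounded_rv Pm (\<lambda>z. \<integral>y. ?F (z(1 := y)) \<partial>M)"
      using bounded_rv_compose[OF bF measurable_upd[OF one_in measurable_fst measurable_snd]]
      by (intro bounded_rv_integral[OF prob_M]) (simp only: case_prod_unfold)
    have ignore: "mixed_diff (z(2 := w, 1 := y)) a b c d = mixed_diff z a b c d" for z w y a b c d
      unfolding mixed_diff_def by (simp add: fun_upd_twist[of 2 1] )
    have "(\<integral>t. ?q (fst t) (fst t 1) (fst (snd t)) (fst t 2) (snd (snd t)) \<partial>(Pm \<Otimes>\<^sub>M MM)) = (\<integral>z. ?F z \<partial>Pm)"
      using b by (intro bounded_rv_fubini(2)[OF prob_pair prob_Pm, symmetric]) (simp add: case_prod_unfold)
    also have "\<dots> = (\<integral>z. (\<integral>y. ?F (z(1 := y)) \<partial>M) \<partial>Pm)"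
      by (rule integral_PiM_resample[OF prob_M _ one_in bF, symmetric]) simp
    also have "\<dots> = (\<integral>z. (\<integral>w. (\<integral>y. ?F (z(2 := w, 1 := y)) \<partial>M) \<partial>M) \<partial>Pm)"
      by (rule integral_PiM_resample[OF prob_M _ two bG, symmetric]) simp
    also have "\<dots> = (\<integral>z. (\<integral>w. (\<integral>y. (\<integral>v. ?q z y (fst v) w (snd v) \<partial>MM) \<partial>M) \<partial>M) \<partial>Pm)"
      by (simp add: ignore)
    also have "\<dots> = (\<integral>z. (\<integral>v. (\<integral>w. ?q z (fst v) (snd v) (fst w) (snd w) \<partial>MM) \<partial>MM) \<partial>Pm)"
    proof (intro Bochner_Integration.integral_cong refl integral_four_rearrange[OF prob_M])
      fix z assume z: "z \<in> space Pm"
      have c: "(\<lambda>_. z) \<in> measurable (MM \<Otimes>\<^sub>M MM) Pm" using z by (rule measurable_const)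
      show "bounded_rv (MM \<Otimes>\<^sub>M MM) (\<lambda>t. ?q z (fst (fst t)) (snd (fst t)) (fst (snd t)) (snd (snd t)))"
        by (rule bounded_rv_power[OF bounded_mixed_diff[OF c]]) measurable
    qed
    also have "\<dots> = (\<integral>v. (\<integral>z. (\<integral>w. ?q z (fst v) (snd v) (fst w) (snd w) \<partial>MM) \<partial>Pm) \<partial>MM)"
    proof (rule bounded_rv_fubini(1)[OF prob_pair prob_Pm])
      show "bounded_rv (Pm \<Otimes>\<^sub>M MM) (\<lambda>(z, v). \<integral>w. ?q z (fst v) (snd v) (fst w) (snd w) \<partial>MM)"
        unfolding case_prod_unfold by (intro bounded_mixed_square) measurable
    qed
    finally show ?thesis .
  qed
  finally show ?thesis .
qed

lemma kernel_beta_nonneg: "0 \<le> kernel_beta M m K"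
  unfolding kernel_beta_eq by (intro integral_nonneg_AE AE_I2) simp

lemma bounded_U_diff_pair:
  assumes "k \<in> {1..n}" "u \<in> measurable N Pn" "a \<in> measurable N M" "b \<in> measurable N M"
  shows "bounded_rv N (\<lambda>t. U ((u t)(k := a t)) - U ((u t)(k := b t)))"
  using assms by (intro bounded_rv_diff bounded_rv_upd[OF bounded_U])

lemma bounded_coord_variance_U_diff:
  assumes k: "k \<in> {1..n}" and l: "l \<in> {1..n}"
  shows "bounded_rv (Pn \<Otimes>\<^sub>M MM) (\<lambda>t. coord_variance M k (U_diff_fn l (fst (snd t)) (snd (snd t))) (fst t))"
proof -
  let ?N = "(Pn \<Otimes>\<^sub>M MM) \<Otimes>\<^sub>M MM"
  have "bounded_rv ?N (\<lambda>t. (U_diff_fn l (fst (snd (fst t))) (snd (snd (fst t))) ((fst (fst t))(k := fst (snd t)))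
     - U_diff_fn l (fst (snd (fst t))) (snd (snd (fst t))) ((fst (fst t))(k := snd (snd t))))\<^sup>2)"
    by (intro bounded_rv_power bounded_rv_diff bounded_U_diff_pair measurable_upd k l) measurable
  then have "bounded_rv (Pn \<Otimes>\<^sub>M MM) (\<lambda>t. (\<integral>w. (U_diff_fn l (fst (snd t)) (snd (snd t)) ((fst t)(k := fst w))
     - U_diff_fn l (fst (snd t)) (snd (snd t)) ((fst t)(k := snd w)))\<^sup>2 \<partial>MM))"
    by (intro bounded_rv_integral prob_pair) (simp only: case_prod_unfold fst_conv snd_conv)
  from bounded_rv_mult[OF this bounded_rv_const[of _ "1/2"]] show ?thesis
    unfolding coord_variance_def by simp
qed

lemma expected_coord_variance_U_diff_le_beta:
  assumes k: "k \<in> {1..n}" and l: "l \<in> {1..n}" and kl: "k \<noteq> l"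
  shows "(\<integral>v. (\<integral>x. coord_variance M k (U_diff_fn l (fst v) (snd v)) x \<partial>Pn) \<partial>MM) \<le> (pair_ratio m n)\<^sup>2 * kernel_beta M m K / 2"
proof -
  let ?T = "{i \<in> T. l \<in> i ` {1..m} \<and> k \<in> i ` {1..m}}" and ?C = "real (n choose m)"
  let ?c = "real (card ?T) / ?C\<^sup>2 / 2"
  let ?\<Psi> = "\<lambda>z y y'. \<integral>w. (mixed_diff z y y' (fst w) (snd w))\<^sup>2 \<partial>MM"
  obtain J where J: "\<And>i. i \<in> ?T \<Longrightarrow> J i \<in> {1..m} \<rightarrow> {1..n}" "\<And>i. i \<in> ?T \<Longrightarrow> inj_on (J i) {1..m}"
    "\<And>x y y'. x \<in> space Pn \<Longrightarrow> y \<in> space M \<Longrightarrow> y' \<in> space M \<Longrightarrow>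
      coord_variance M k (U_diff_fn l y y') x \<le> ?c * (\<Sum>i\<in>?T. ?\<Psi> (pull_back m (J i) x) y y')"
    by (rule coord_variance_U_diff[OF k l kl]) (rule that)
  have b: "bounded_rv N (\<lambda>t. ?\<Psi> (pull_back m (J i) (u t)) (a t) (b t))"
    if "i \<in> ?T" "u \<in> measurable N Pn" "a \<in> measurable N M" "b \<in> measurable N M" for i and N :: "'d measure" and u a b
    by (intro bounded_mixed_square measurable_compose[OF that(2) measurable_pull_back[OF J(1)[OF that(1)]]] that)
  have bs: "bounded_rv N (\<lambda>t. ?c * (\<Sum>i\<in>?T. ?\<Psi> (pull_back m (J i) (u t)) (a t) (b t)))"
    if "u \<in> measurable N Pn" "a \<in> measurable N M" "b \<in> measurable N M" for N :: "'d measure" and u a b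
    by (intro bounded_rv_mult bounded_rv_const bounded_rv_sum b that)
  have bz: "bounded_rv MM (\<lambda>v. \<integral>z. ?\<Psi> z (fst v) (snd v) \<partial>Pm)"
    by (intro bounded_rv_integral prob_Pm) (unfold case_prod_unfold, intro bounded_mixed_square, measurable)
  have inner: "(\<integral>x. ?c * (\<Sum>i\<in>?T. ?\<Psi> (pull_back m (J i) x) y y') \<partial>Pn) = ?c * (card ?T * (\<integral>z. ?\<Psi> z y y' \<partial>Pm))"
    if y: "y \<in> space M" "y' \<in> space M" for y y'
  proof -
    have "(\<integral>x. (\<Sum>i\<in>?T. ?\<Psi> (pull_back m (J i) x) y y') / 1 \<partial>Pn) = (\<Sum>i\<in>?T. \<integral>x. ?\<Psi> (pull_back m (J i) x) y y' \<partial>Pn) / 1"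
      by (intro integral_sum_divide prob_P b measurable_const y measurable_ident_sets refl)
    also have "\<dots> = (\<Sum>i\<in>?T. \<integral>z. ?\<Psi> z y y' \<partial>Pm) / 1"
      by (intro arg_cong2[where f="(/)"] sum.cong refl integral_pull_back J bounded_rv_measurable bounded_mixed_square measurable_const y measurable_ident_sets)
    finally show ?thesis by simp
  qed
  have bcv: "bounded_rv MM (\<lambda>v. \<integral>x. coord_variance M k (U_diff_fn l (fst v) (snd v)) x \<partial>Pn)"
    using bounded_rv_compose[OF bounded_coord_variance_U_diff[OF k l], of "\<lambda>(v, x). (x, v)" "MM \<Otimes>\<^sub>M Pn"]
    by (intro bounded_rv_integral prob_P) (simp add: case_prod_unfold)
  have "(\<integral>v. (\<integral>x. coord_variance M k (U_diff_fn l (fst v) (snd v)) x \<partial>Pn) \<partial>MM)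
     \<le> (\<integral>v. ?c * (card ?T * (\<integral>z. ?\<Psi> z (fst v) (snd v) \<partial>Pm)) \<partial>MM)"
  proof (intro integral_mono bounded_rv_integrable prob_pair bcv bounded_rv_mult bounded_rv_const bz)
    fix v assume "v \<in> space MM"
    then have v: "fst v \<in> space M" "snd v \<in> space M" by (auto simp: space_pair_measure)
    have "(\<integral>x. coord_variance M k (U_diff_fn l (fst v) (snd v)) x \<partial>Pn) \<le> (\<integral>x. ?c * (\<Sum>i\<in>?T. ?\<Psi> (pull_back m (J i) x) (fst v) (snd v)) \<partial>Pn)"
    proof (intro integral_mono bounded_rv_integrable[OF prob_P])
      show "bounded_rv Pn (coord_variance M k (U_diff_fn l (fst v) (snd v)))"
        by (intro bounded_coord_variance[OF _ k] bounded_U_diff_pair l measurable_const v measurable_ident_sets refl)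
      show "bounded_rv Pn (\<lambda>x. ?c * (\<Sum>i\<in>?T. ?\<Psi> (pull_back m (J i) x) (fst v) (snd v)))"
        by (intro bs measurable_const v measurable_ident_sets refl)
    qed (use J(3) v in blast)
    then show "(\<integral>x. coord_variance M k (U_diff_fn l (fst v) (snd v)) x \<partial>Pn) \<le> ?c * (card ?T * (\<integral>z. ?\<Psi> z (fst v) (snd v) \<partial>Pm))"
      unfolding inner[OF v] .
  qed
  also have "\<dots> = (real (card ?T) / ?C)\<^sup>2 * kernel_beta M m K / 2"
    unfolding kernel_beta_eq by (simp add: power2_eq_square)
  finally show ?thesis unfolding increasing_maps_pair_ratio[OF m_pos m_less k l kl] .
qed

text \<open>The conditional variance in coordinate \<open>k\<close> is half the mean square of the first difference \<open>g\<close> over the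
  two values of that coordinate. The second moment of \<open>g\<close> over the sample is its squared mean,
  which is a difference of first projections, plus its variance, which Efron--Stein bounds by
  conditional variances of \<open>g\<close>, that is by second differences of \<open>U\<close>.\<close>
lemma expected_coord_variance_U_le:
  assumes k: "k \<in> {1..n}"
  shows "(\<integral>x. coord_variance M k U x \<partial>Pn) \<le> (m / n)\<^sup>2 * kernel_sigma1_sq M m K
       + (real n - 1) * ((pair_ratio m n)\<^sup>2 * kernel_beta M m K / 4)"
proof -
  interpret P: prob_space P by (rule prob_P)
  let ?g = "\<lambda>v. U_diff_fn k (fst v) (snd v)"
  have bg: "bounded_rv Pn (?g v)" if "v \<in> space MM" for v
    using that by (intro bounded_U_diff_pair k) (auto simp: space_pair_measure)
  have bg2: "bounded_rv (Pn \<Otimes>\<^sub>M MM) (\<lambda>(x, v). (?g v x)\<^sup>2)"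
    unfolding case_prod_unfold by (intro bounded_rv_power bounded_U_diff_pair k) measurable
  have bg3: "bounded_rv MM (\<lambda>v. \<integral>x. (?g v x)\<^sup>2 \<partial>Pn)"
    by (intro bounded_rv_integral prob_P) (unfold case_prod_unfold, intro bounded_rv_power bounded_U_diff_pair k, measurable)
  have bcv: "bounded_rv MM (\<lambda>v. \<integral>x. coord_variance M l (?g v) x \<partial>Pn)" if "l \<in> {1..n}" for l
    using bounded_rv_compose[OF bounded_coord_variance_U_diff[OF that k], of "\<lambda>(v, x). (x, v)" "MM \<Otimes>\<^sub>M Pn"]
    by (intro bounded_rv_integral prob_P) (simp add: case_prod_unfold)
  have bh: "bounded_rv MM (\<lambda>v. (m / n)\<^sup>2 * (first_projection (fst v) - first_projection (snd v))\<^sup>2)"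
    by (intro bounded_rv_intros bounded_rv_compose[OF bounded_first_projection]) measurable
  have split: "(\<integral>x. (?g v x)\<^sup>2 \<partial>Pn) \<le> (m / n)\<^sup>2 * (first_projection (fst v) - first_projection (snd v))\<^sup>2
     + (\<Sum>l\<in>{1..n} - {k}. \<integral>x. coord_variance M l (?g v) x \<partial>Pn)" if v: "v \<in> space MM" for v
  proof -
    have v': "fst v \<in> space M" "snd v \<in> space M" using v by (auto simp: space_pair_measure)
    have e: "(\<integral>x. (?g v x)\<^sup>2 \<partial>Pn) = (\<integral>x. ?g v x \<partial>Pn)\<^sup>2 + phi_entropy (\<lambda>u. u\<^sup>2) Pn (?g v)"
      unfolding phi_entropy_def by simp
    have "phi_entropy (\<lambda>u. u\<^sup>2) Pn (?g v) \<le> (\<Sum>l\<in>{1..n}. \<integral>x. phi_entropy (\<lambda>u. u\<^sup>2) M (\<lambda>y. ?g v (x(l := y))) \<partial>Pn)"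
      by (intro efron_stein prob_M bg v) simp
    also have "\<dots> = (\<Sum>l\<in>{1..n}. \<integral>x. coord_variance M l (?g v) x \<partial>Pn)"
      by (intro sum.cong Bochner_Integration.integral_cong refl coord_variance_eq[symmetric] bg v)
    also have "\<dots> = (\<Sum>l\<in>{1..n} - {k}. \<integral>x. coord_variance M l (?g v) x \<partial>Pn)"
    proof -
      have "coord_variance M k (?g v) = (\<lambda>_. 0)" by (rule ext) (rule coord_variance_U_diff_same)
      then show ?thesis using k by (subst sum.remove[OF _ k]) auto
    qed
    finally show ?thesis
      unfolding e expectation_U_diff[OF k v'] power_mult_distrib by (rule add_left_mono)
  qed
  have "(\<integral>x. coord_variance M k U x \<partial>Pn) = (\<integral>x. (\<integral>v. (?g v x)\<^sup>2 \<partial>MM) \<partial>Pn) / 2"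
    unfolding coord_variance_def by simp
  also have "\<dots> = (\<integral>v. (\<integral>x. (?g v x)\<^sup>2 \<partial>Pn) \<partial>MM) / 2"
    by (simp only: bounded_rv_fubini(1)[OF prob_pair prob_P bg2])
  also have "\<dots> \<le> (\<integral>v. (m / n)\<^sup>2 * (first_projection (fst v) - first_projection (snd v))\<^sup>2
     + (\<Sum>l\<in>{1..n} - {k}. \<integral>x. coord_variance M l (?g v) x \<partial>Pn) \<partial>MM) / 2"
    by (intro divide_right_mono integral_mono bounded_rv_integrable[OF prob_pair] bounded_rv_add bg3 bh bounded_rv_sum bcv split) auto
  also have "\<dots> = ((m / n)\<^sup>2 * (\<integral>v. (first_projection (fst v) - first_projection (snd v))\<^sup>2 \<partial>MM)
     + (\<Sum>l\<in>{1..n} - {k}. \<integral>v. (\<integral>x. coord_variance M l (?g v) x \<partial>Pn) \<partial>MM)) / 2"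
  proof -
    have "integrable MM (\<lambda>v. \<Sum>l\<in>{1..n} - {k}. \<integral>x. coord_variance M l (?g v) x \<partial>Pn)"
      by (intro bounded_rv_integrable prob_pair bounded_rv_sum bcv) auto
    moreover have "(\<integral>v. (\<Sum>l\<in>{1..n} - {k}. \<integral>x. coord_variance M l (?g v) x \<partial>Pn) \<partial>MM)
        = (\<Sum>l\<in>{1..n} - {k}. \<integral>v. (\<integral>x. coord_variance M l (?g v) x \<partial>Pn) \<partial>MM)"
      by (intro Bochner_Integration.integral_sum bounded_rv_integrable prob_pair bcv) auto
    ultimately show ?thesis
      using Bochner_Integration.integral_add[OF bounded_rv_integrable[OF prob_pair bh]] by simp
  qed
  also have "\<dots> \<le> ((m / n)\<^sup>2 * (\<integral>v. (first_projection (fst v) - first_projection (snd v))\<^sup>2 \<partial>MM)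
     + (\<Sum>l\<in>{1..n} - {k}. (pair_ratio m n)\<^sup>2 * kernel_beta M m K / 2)) / 2"
    by (intro divide_right_mono add_left_mono sum_mono expected_coord_variance_U_diff_le_beta k) auto
  also have "\<dots> = (m / n)\<^sup>2 * kernel_sigma1_sq M m K + (real (card ({1..n} - {k}))) * ((pair_ratio m n)\<^sup>2 * kernel_beta M m K / 4)"
    unfolding kernel_sigma1_sq_eq variance_eq_half_square_diff[OF prob_M bounded_first_projection, symmetric] by (simp add: algebra_simps)
  also have "real (card ({1..n} - {k})) = real n - 1" using k m_less by (simp add: card_Diff_singleton)
  finally show ?thesis .
qed

lemma expected_variance_sum_U_le:
  "(\<integral>x. variance_sum M {1..n} U x \<partial>Pn) \<le> (real m)\<^sup>2 * kernel_sigma1_sq M m K / n + real m ^ 4 * kernel_beta M m K / (4 * (real n)\<^sup>2)"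
proof -
  let ?\<beta> = "kernel_beta M m K" and ?\<sigma> = "kernel_sigma1_sq M m K"
  have n: "real n > 0" using m_less by simp
  have "(\<integral>x. variance_sum M {1..n} U x \<partial>Pn) = (\<Sum>k\<in>{1..n}. \<integral>x. coord_variance M k U x \<partial>Pn)"
    unfolding variance_sum_def
    by (intro Bochner_Integration.integral_sum bounded_rv_integrable[OF prob_P] bounded_coord_variance bounded_U)
  also have "\<dots> \<le> (\<Sum>k\<in>{1..n}. (m / n)\<^sup>2 * ?\<sigma> + (real n - 1) * ((pair_ratio m n)\<^sup>2 * ?\<beta> / 4))"
    by (intro sum_mono expected_coord_variance_U_le)
  also have "\<dots> = (real m)\<^sup>2 * ?\<sigma> / n + (real n * (real n - 1) * (pair_ratio m n)\<^sup>2) * ?\<beta> / 4"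
    using n by (simp add: field_simps power2_eq_square)
  also have "\<dots> \<le> (real m)\<^sup>2 * ?\<sigma> / n + (real m ^ 4 / (real n)\<^sup>2) * ?\<beta> / 4"
    by (intro add_left_mono divide_right_mono mult_right_mono pair_ratio_bound m_pos m_less kernel_beta_nonneg) simp
  finally show ?thesis by (simp add: mult_ac)
qed

theorem U_statistic_bernstein:
  assumes t: "t > 0"
  shows "measure Pn {x \<in> space Pn. U x - (\<integral>x. K x \<partial>Pm) > t}
    \<le> exp (- real n * t\<^sup>2 / (2 * (real m)\<^sup>2 * kernel_sigma1_sq M m K + (real m)^4 * kernel_beta M m K / (2 * real n)
         + ((real m)\<^sup>2 * sqrt (kernel_gamma M m K) + (4 / 3) * real m) * t))"
proof -
  let ?\<beta> = "kernel_beta M m K" and ?\<sigma> = "kernel_sigma1_sq M m K" and ?\<gamma> = "kernel_gamma M m K"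
  let ?V = "(real m)\<^sup>2 * ?\<sigma> / n + real m ^ 4 * ?\<beta> / (4 * (real n)\<^sup>2)"
  let ?J = "(real m)\<^sup>2 * sqrt ?\<gamma> / n" and ?b = "2 * real m / n"
  let ?\<rho> = "(real n - 1) * ((pair_ratio m n)\<^sup>2 * ?\<gamma> / 2)"
  have n: "real n > 0" "real n \<ge> 1" using m_less by auto
  have "measure Pn {x \<in> space Pn. U x - (\<integral>x. U x \<partial>Pn) > t} \<le> exp (- t\<^sup>2 / (2 * ?V + (2 * ?b / 3 + ?J) * t))"
  proof (rule bounded_interaction_bernstein[where \<rho>="?\<rho>"])
    show "?b > 0" using m_pos n by simp
    show "U x - (\<integral>y. U (x(k := y)) \<partial>M) \<le> ?b" if "x \<in> space Pn" "k \<in> {1..n}" for x k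
      using U_minus_mean_le[OF that(2,1)] by simp
    show "variance_sum M {1..n} (U_diff_fn l y y') x \<le> ?\<rho>"
      if "l \<in> {1..n}" "x \<in> space Pn" "y \<in> space M" "y' \<in> space M" for l x y y'
      by (rule variance_sum_U_diff_le[OF that])
    show "0 \<le> ?\<rho>" using n kernel_gamma_nonneg by (intro mult_nonneg_nonneg) auto
    show "(\<integral>x. variance_sum M {1..n} U x \<partial>Pn) \<le> ?V" by (rule expected_variance_sum_U_le)
    show "0 \<le> ?J" using kernel_gamma_nonneg by simp
    have "2 * real (card {1..n}) * ?\<rho> = (real n * (real n - 1) * (pair_ratio m n)\<^sup>2) * ?\<gamma>" by simp
    also have "\<dots> \<le> (real m ^ 4 / (real n)\<^sup>2) * ?\<gamma>"
      by (intro mult_right_mono pair_ratio_bound m_pos m_less kernel_gamma_nonneg)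
    also have "\<dots> = ?J\<^sup>2" using kernel_gamma_nonneg by (simp add: power_divide power_mult_distrib flip: power_mult)
    finally show "2 * real (card {1..n}) * ?\<rho> \<le> ?J\<^sup>2" .
  qed (rule t)
  also have "- t\<^sup>2 / (2 * ?V + (2 * ?b / 3 + ?J) * t) = - real n * t\<^sup>2 / (n * (2 * ?V + (2 * ?b / 3 + ?J) * t))"
    using n by simp
  also have "n * (2 * ?V + (2 * ?b / 3 + ?J) * t) = 2 * (real m)\<^sup>2 * ?\<sigma> + (real m)^4 * ?\<beta> / (2 * real n)
         + ((real m)\<^sup>2 * sqrt ?\<gamma> + (4 / 3) * real m) * t"
    using n by (simp add: field_simps power2_eq_square)
  finally show ?thesis unfolding expectation_U .
qed

end

section \<open>The two deviation bounds\<close>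

text \<open>The three summands of \<open>s\<close> dominate the three terms of the denominator separately. The middle one
  carries a factor \<open>L\<close> where its square alone would give \<open>sqrt L\<close>; this costs nothing for \<open>L \<ge> 1\<close>, which is
  the condition \<open>\<delta> \<le> 1 / e\<close>.\<close>
lemma bernstein_exponent_ge:
  fixes A B c s L n :: real
  assumes n: "n > 0" and L: "L \<ge> 1" and A: "A \<ge> 0" and B: "B \<ge> 0" and c: "c > 0"
  defines "s \<equiv> sqrt (A * L / n) + (sqrt B + c) * L / n"
  shows "s > 0" "L \<le> n * s\<^sup>2 / (A + B / n + c * s)"
proof -
  define p q r where "p = sqrt (A * L / n)" and "q = sqrt B * L / n" and "r = c * L / n"
  have s: "s = p + q + r" unfolding s_def p_def q_def r_def by (simp add: algebra_simps add_divide_distrib)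
  have pq: "p \<ge> 0" "q \<ge> 0" "r > 0" unfolding p_def q_def r_def using assms by auto
  show s0: "s > 0" unfolding s using pq by simp
  have "A * L = n * p\<^sup>2" unfolding p_def using n A L by simp
  moreover have "B / n * L \<le> n * q\<^sup>2"
  proof -
    have "B / n * L \<le> B / n * (L * L)" using B n L by (intro mult_left_mono) auto
    also have "\<dots> = n * q\<^sup>2" unfolding q_def using n B by (simp add: power_mult_distrib power_divide power2_eq_square field_simps)
    finally show ?thesis .
  qed
  moreover have "c * s * L = n * (s * r)" unfolding r_def using n by simp
  moreover have "L * (A + B / n + c * s) = A * L + B / n * L + c * s * L"
    "n * (p\<^sup>2 + q\<^sup>2 + s * r) = n * p\<^sup>2 + n * q\<^sup>2 + n * (s * r)"
    by (simp_all only: distrib_left mult.commute)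
  ultimately have "L * (A + B / n + c * s) \<le> n * (p\<^sup>2 + q\<^sup>2 + s * r)" by linarith
  also have "\<dots> \<le> n * s\<^sup>2"
  proof (rule mult_left_mono)
    have "s\<^sup>2 = p\<^sup>2 + q\<^sup>2 + s * r + 2 * (p * q) + r * (p + q)" unfolding s by (simp add: power2_eq_square algebra_simps)
    then show "p\<^sup>2 + q\<^sup>2 + s * r \<le> s\<^sup>2" using pq by simp
  qed (use n in simp)
  finally have "L * (A + B / n + c * s) \<le> n * s\<^sup>2" .
  moreover have "A + B / n + c * s > 0" using A B n c s0 by (intro add_nonneg_pos) auto
  ultimately show "L \<le> n * s\<^sup>2 / (A + B / n + c * s)" by (simp add: pos_le_divide_eq)
qed

theorem corollary3p4:
  fixes \<Omega> :: "'w measure" and \<mu> :: "'a measure"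
    and X :: "nat \<Rightarrow> 'w \<Rightarrow> 'a" and K :: "(nat \<Rightarrow> 'a) \<Rightarrow> real"
    and m n :: nat and \<theta> \<alpha> \<beta> \<gamma> \<sigma>1_sq :: real and U :: "'w \<Rightarrow> real"
  assumes "1 \<le> m" and "m < n"
    and "prob_space \<mu>"
    and "K \<in> borel_measurable (power_measure \<mu> m)"
    and "\<And>x. x \<in> space (power_measure \<mu> m) \<Longrightarrow> K x \<in> {-1..1}"
    and "symmetric_kernel \<mu> m K"
    and "prob_space \<Omega>"
    and "prob_space.indep_vars \<Omega> (\<lambda>_. \<mu>) X {1..n}"
    and "\<And>i. i \<in> {1..n} \<Longrightarrow> distr \<Omega> \<mu> (X i) = \<mu>"
  defines "\<theta> \<equiv> prob_space.expectation \<Omega> (\<lambda>\<omega>. K (\<lambda>i\<in>{1..m}. X i \<omega>))"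
    and "\<alpha> \<equiv> kernel_alpha \<mu> m K"
    and "\<beta> \<equiv> kernel_beta \<mu> m K"
    and "\<gamma> \<equiv> kernel_gamma \<mu> m K"
    and "\<sigma>1_sq \<equiv> kernel_sigma1_sq \<mu> m K"
    and "U \<equiv> (\<lambda>\<omega>. U_statistic n m K (\<lambda>i\<in>{1..n}. X i \<omega>))"
  shows "(\<forall>t>0. prob_space.prob \<Omega> {\<omega> \<in> space \<Omega>. U \<omega> - \<theta> > t}
            \<le> exp (- real n * t\<^sup>2 /
                 (2 * (real m)\<^sup>2 * \<sigma>1_sq + (real m)^4 * \<beta> / (2 * real n)
                   + ((real m)\<^sup>2 * sqrt \<gamma> + (4 / 3) * real m) * t)))
       \<and> (\<forall>\<delta>. 0 < \<delta> \<and> \<delta> \<le> 1 / exp 1 \<longrightarrow>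
            prob_space.prob \<Omega> {\<omega> \<in> space \<Omega>. U \<omega> - \<theta> \<le>
                 sqrt (2 * (real m)\<^sup>2 * \<sigma>1_sq * ln (1 / \<delta>) / real n)
                 + (\<alpha> * (real m)\<^sup>2 + 4 * real m / 3) * ln (1 / \<delta>) / real n}
              \<ge> 1 - \<delta>)"
  proof -
  interpret \<Omega>: prob_space \<Omega> by (rule assms)
  interpret S: symmetric_kernel_on \<mu> m n K
    using assms by (intro symmetric_kernel_on.intro symmetric_kernel_on_axioms.intro)
  define Y where "Y \<omega> = (\<lambda>i\<in>{1..n}. X i \<omega>)" for \<omega>
  have ne: "{1..n} \<noteq> {}" using assms(2) by auto
  have Xm: "X i \<in> measurable \<Omega> \<mu>" if "i \<in> {1..n}" for i
    using assms(8) that unfolding \<Omega>.indep_vars_def by auto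
  have Ym: "Y \<in> measurable \<Omega> (power_measure \<mu> n)"
    unfolding Y_def[abs_def] by (intro measurable_restrict Xm)
  have Yd: "distr \<Omega> (power_measure \<mu> n) Y = power_measure \<mu> n"
  proof -
    have "distr \<Omega> (power_measure \<mu> n) Y = PiM {1..n} (\<lambda>i. distr \<Omega> \<mu> (X i))"
      using \<Omega>.indep_vars_iff_distr_eq_PiM'[OF ne, where M'="\<lambda>_. \<mu>" and X=X] Xm assms(8) unfolding Y_def[abs_def] by blast
    also have "\<dots> = power_measure \<mu> n" by (intro PiM_cong refl assms(9))
    finally show ?thesis .
  qed
  have \<theta>: "\<theta> = (\<integral>x. K x \<partial>power_measure \<mu> m)"
  proof -
    have id: "id \<in> {1..m} \<rightarrow> {1..n}" using assms(2) by auto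
    have "\<theta> = (\<integral>\<omega>. K (pull_back m id (Y \<omega>)) \<partial>\<Omega>)"
      unfolding \<theta>_def pull_back_def Y_def using assms(2)
      by (intro Bochner_Integration.integral_cong refl arg_cong[where f=K]) (auto simp: restrict_def)
    also have "\<dots> = (\<integral>x. K (pull_back m id x) \<partial>distr \<Omega> (power_measure \<mu> n) Y)"
      by (rule integral_distr[symmetric, OF Ym measurable_compose[OF S.measurable_pull_back[OF id] assms(4)]])
    also have "\<dots> = (\<integral>x. K x \<partial>power_measure \<mu> m)"
      unfolding Yd by (intro S.integral_pull_back id assms(4)) simp
    finally show ?thesis .
  qed
  have Um: "U \<in> borel_measurable \<Omega>"
    using measurable_compose[OF Ym bounded_rv_measurable[OF S.bounded_U]] unfolding U_def Y_def .
  let ?D = "\<lambda>t. 2 * (real m)\<^sup>2 * \<sigma>1_sq + (real m)^4 * \<beta> / (2 * real n)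
                   + ((real m)\<^sup>2 * sqrt \<gamma> + (4 / 3) * real m) * t"
  have tail: "\<Omega>.prob {\<omega> \<in> space \<Omega>. U \<omega> - \<theta> > t} \<le> exp (- real n * t\<^sup>2 / ?D t)" if "t > 0" for t
  proof -
    let ?E = "{x \<in> space (power_measure \<mu> n). U_statistic n m K x - (\<integral>x. K x \<partial>power_measure \<mu> m) > t}"
    have "?E \<in> sets (power_measure \<mu> n)"
      using bounded_rv_measurable[OF S.bounded_U] by measurable
    then have "measure (power_measure \<mu> n) ?E = \<Omega>.prob (Y -` ?E \<inter> space \<Omega>)"
      using measure_distr[OF Ym] unfolding Yd by simp
    also have "Y -` ?E \<inter> space \<Omega> = {\<omega> \<in> space \<Omega>. U \<omega> - \<theta> > t}"
      using measurable_space[OF Ym] unfolding \<theta> U_def Y_def by auto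
    finally show ?thesis
      using S.U_statistic_bernstein[OF that] unfolding \<beta>_def \<gamma>_def \<sigma>1_sq_def by simp
  qed
  have quantile: "1 - \<delta> \<le> \<Omega>.prob {\<omega> \<in> space \<Omega>. U \<omega> - \<theta> \<le>
                 sqrt (2 * (real m)\<^sup>2 * \<sigma>1_sq * ln (1 / \<delta>) / real n)
                 + (\<alpha> * (real m)\<^sup>2 + 4 * real m / 3) * ln (1 / \<delta>) / real n}"
    if \<delta>: "0 < \<delta>" "\<delta> \<le> 1 / exp 1" for \<delta>
  proof -
    define L where "L = ln (1 / \<delta>)"
    define B where "B = (real m)^4 * \<beta> / 2"
    define c where "c = (real m)\<^sup>2 * sqrt \<gamma> + (4 / 3) * real m"
    define A where "A = 2 * (real m)\<^sup>2 * \<sigma>1_sq"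
    define s where "s = sqrt (A * L / n) + (sqrt B + c) * L / n"
    have "exp 1 \<le> 1 / \<delta>" using \<delta> by (simp add: field_simps)
    then have "ln (exp 1) \<le> ln (1 / \<delta>)" by (subst ln_le_cancel_iff) (use \<delta> in auto)
    then have L: "L \<ge> 1" unfolding L_def by simp
    have n: "real n > 0" using assms(2) by simp
    have \<sigma>0: "\<sigma>1_sq \<ge> 0" unfolding \<sigma>1_sq_def kernel_sigma1_sq_def Let_def
      by (intro integral_nonneg_AE AE_I2) simp
    have \<beta>0: "\<beta> \<ge> 0" unfolding \<beta>_def by (rule S.kernel_beta_nonneg)
    have \<gamma>0: "\<gamma> \<ge> 0" unfolding \<gamma>_def by (rule S.kernel_gamma_nonneg)
    have c0: "c > 0" unfolding c_def using \<gamma>0 assms(1) by (intro add_nonneg_pos) auto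
    have s: "s > 0" "L \<le> n * s\<^sup>2 / (A + B / n + c * s)"
      using bernstein_exponent_ge[OF n L, of A B c] \<sigma>0 \<beta>0 c0 unfolding s_def A_def B_def by auto
    have "sqrt B = (real m)\<^sup>2 * sqrt (\<beta> / 2)"
      unfolding B_def by (simp add: real_sqrt_mult[of "real m ^ 4", symmetric] real_sqrt_mult real_sqrt_divide power4_eq_xxxx power2_eq_square)
    then have se: "sqrt (2 * (real m)\<^sup>2 * \<sigma>1_sq * ln (1 / \<delta>) / real n)
                 + (\<alpha> * (real m)\<^sup>2 + 4 * real m / 3) * ln (1 / \<delta>) / real n = s"
      unfolding s_def A_def c_def L_def \<alpha>_def kernel_alpha_def \<beta>_def[symmetric] \<gamma>_def[symmetric]
      by (simp add: algebra_simps)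
    have "\<Omega>.prob {\<omega> \<in> space \<Omega>. U \<omega> - \<theta> > s} \<le> exp (- real n * s\<^sup>2 / ?D s)" by (rule tail[OF s(1)])
    also have "?D s = A + B / n + c * s" unfolding A_def B_def c_def by simp
    also have "exp (- real n * s\<^sup>2 / (A + B / n + c * s)) \<le> exp (- L)" using s(2) by simp
    also have "exp (- L) = \<delta>" unfolding L_def using \<delta> by (simp add: ln_div)
    finally have "\<Omega>.prob {\<omega> \<in> space \<Omega>. U \<omega> - \<theta> > s} \<le> \<delta>" .
    moreover have "\<Omega>.prob {\<omega> \<in> space \<Omega>. \<not> (U \<omega> - \<theta> > s)} = 1 - \<Omega>.prob {\<omega> \<in> space \<Omega>. U \<omega> - \<theta> > s}"
      using Um by (intro \<Omega>.prob_neg) measurable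
    ultimately show ?thesis unfolding se by (simp add: not_less)
  qed
  show ?thesis using tail quantile by blast
qed

end
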